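(* There exists $\varepsilon>0$ such that the following holds. Let $u_0\in\dot H^4(\mathbb{T})$ have zero mean and satisfy $\|u_0\|_{\dot H^4(\mathbb{T})}\le\varepsilon$. Then the Cauchy problem $$u_t+u\,u_\alpha=-\Lambda^{-1}(u)\quad(\alpha\in\mathbb{T},\ t\ge 0),\qquad u(\alpha,0)=u_0(\alpha),$$ has a solution $u$ with $u\in C([0,T],H^4(\mathbb{T}))$ for all $T>0$. Furthermore, there is a constant $C$ such that this solution satisfies $$\|u(t)\|_{L^2}\le C(1+t)^{-2.25}\quad\text{for all } t\ge 0.$$
   Context: $\mathbb{T}=\mathbb{R}/2\pi\mathbb{Z}$, identified with $[-\pi,\pi]$; functions are real-valued. The operator $\Lambda^{-1}$ is $$\Lambda^{-1}(u)(\alpha)=-\frac{1}{2\pi}\int_{-\pi}^{\pi}\log\Big(4\sin^2\Big(\frac{\alpha-\beta}{2}\Big)\Big)u(\beta)\,d\beta,$$ i.e. the Fourier multiplier $1/|n|$ for $n\neq0$ and $0$ for $n=0$. $\dot H^s(\mathbb{T})$ is the homogeneous Sobolev space, with norm $\|\Lambda^s u\|_{L^2}$, $\Lambda=(-\Delta)^{1/2}$. *)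

theory Defs
  imports "HOL-Analysis.Analysis"
begin

text \<open>
  A function on \<open>\<real>/2\<pi>\<int>\<close> is a \<open>2\<pi>\<close>-periodic function on the real line; elements of the
  Lebesgue and Sobolev spaces are represented by arbitrary measurable representatives.
\<close>

definition L2_torus :: "(real \<Rightarrow> real) set" where
  "L2_torus = {u. (\<forall>x. u (x + 2 * pi) = u x) \<and> u \<in> borel_measurable lebesgue \<and>
                  set_integrable lebesgue {-pi..pi} (\<lambda>x. (u x)\<^sup>2)}"

definition L2_norm :: "(real \<Rightarrow> real) \<Rightarrow> real" where
  "L2_norm u = sqrt (LINT x:{-pi..pi}|lebesgue. (u x)\<^sup>2)"

definition zero_mean :: "(real \<Rightarrow> real) \<Rightarrow> bool" where
  "zero_mean u \<longleftrightarrow> (LINT x:{-pi..pi}|lebesgue. u x) = 0"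

definition fourier_coeff :: "(real \<Rightarrow> real) \<Rightarrow> int \<Rightarrow> complex" where
  "fourier_coeff u n =
     (LINT x:{-pi..pi}|lebesgue. complex_of_real (u x) * cis (- (of_int n * x))) / (2 * pi)"

text \<open>
  \<open>is_Lambda_pow s u w\<close> says that \<open>w\<close> is a square-integrable representative of \<open>\<Lambda>\<^sup>s u\<close>, where
  \<open>\<Lambda>\<^sup>s\<close> is the Fourier multiplier \<open>\<bar>n\<bar>\<^sup>s\<close>. It determines \<open>w\<close> up to a null set, so the choice
  in \<open>Lambda_pow\<close> does not affect norms. The multiplier vanishes at \<open>n = 0\<close> for every \<open>s\<close>,
  because \<open>0 powr s = 0\<close>.
\<close>

definition is_Lambda_pow :: "real \<Rightarrow> (real \<Rightarrow> real) \<Rightarrow> (real \<Rightarrow> real) \<Rightarrow> bool" where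
  "is_Lambda_pow s u w \<longleftrightarrow> w \<in> L2_torus \<and>
     (\<forall>n. fourier_coeff w n = complex_of_real (\<bar>of_int n\<bar> powr s) * fourier_coeff u n)"

definition Lambda_pow :: "real \<Rightarrow> (real \<Rightarrow> real) \<Rightarrow> real \<Rightarrow> real" where
  "Lambda_pow s u = (SOME w. is_Lambda_pow s u w)"

text \<open>
  For \<open>s > 0\<close>. A zero-mean periodic distribution \<open>u\<close> with \<open>\<Lambda>\<^sup>s u\<close> in \<open>L\<^sup>2\<close> is itself in \<open>L\<^sup>2\<close>,
  so the zero-mean elements of the homogeneous space are the zero-mean elements of \<open>H_space s\<close>.
  \<open>Hdot_norm\<close> and \<open>H_norm\<close> are meaningful only on \<open>H_space s\<close>.
\<close>

definition H_space :: "real \<Rightarrow> (real \<Rightarrow> real) set" where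
  "H_space s = {u \<in> L2_torus. \<exists>w. is_Lambda_pow s u w}"

definition Hdot_norm :: "real \<Rightarrow> (real \<Rightarrow> real) \<Rightarrow> real" where
  "Hdot_norm s u = L2_norm (Lambda_pow s u)"

definition H_norm :: "real \<Rightarrow> (real \<Rightarrow> real) \<Rightarrow> real" where
  "H_norm s u = sqrt ((L2_norm u)\<^sup>2 + (Hdot_norm s u)\<^sup>2)"

text \<open>\<open>u t \<alpha>\<close> has time as its first argument; this is membership in \<open>C([0,T], H\<^sup>s)\<close>.\<close>

definition continuous_into_H :: "real \<Rightarrow> real \<Rightarrow> (real \<Rightarrow> real \<Rightarrow> real) \<Rightarrow> bool" where
  "continuous_into_H s T u \<longleftrightarrow>
     (\<forall>t\<in>{0..T}. u t \<in> H_space s) \<and>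
     (\<forall>t\<in>{0..T}. ((\<lambda>r. H_norm s (\<lambda>\<alpha>. u r \<alpha> - u t \<alpha>)) \<longlongrightarrow> 0) (at t within {0..T}))"

text \<open>The value \<open>ln 0 = 0\<close> of the kernel on the diagonal concerns only a null set.\<close>

definition Lambda_inv :: "(real \<Rightarrow> real) \<Rightarrow> real \<Rightarrow> real" where
  "Lambda_inv u \<alpha> =
     - (1 / (2 * pi)) * (LINT \<beta>:{-pi..pi}|lebesgue. ln (4 * (sin ((\<alpha> - \<beta>) / 2))\<^sup>2) * u \<beta>)"

text \<open>
  Classical global solutions: the equation holds at every point, with a one-sided time
  derivative at \<open>t = 0\<close>. The initial condition is an equality almost everywhere, since \<open>u0\<close> is
  an arbitrary representative of its class.
\<close>

definition solves_Cauchy :: "(real \<Rightarrow> real) \<Rightarrow> (real \<Rightarrow> real \<Rightarrow> real) \<Rightarrow> bool" where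
  "solves_Cauchy u0 u \<longleftrightarrow>
     (\<forall>t\<ge>0. \<forall>\<alpha>. \<exists>u_t u_\<alpha>.
        ((\<lambda>r. u r \<alpha>) has_real_derivative u_t) (at t within {0..}) \<and>
        (u t has_real_derivative u_\<alpha>) (at \<alpha>) \<and>
        u_t + u t \<alpha> * u_\<alpha> = - Lambda_inv (u t) \<alpha>) \<and>
     (AE \<alpha> in lebesgue. u 0 \<alpha> = u0 \<alpha>)"

end

theory Submission
  imports Defs "HOL-Complex_Analysis.Complex_Analysis" "HOL-Library.Nat_Bijection" "HOL-Real_Asymp.Real_Asymp"
begin

text \<open>
  All estimates are made on the Fourier coefficients \<open>a n\<close> of the solution, which satisfy
  \<open>a' n = - (i n / 2) (\<Sum>k. a k * a (n - k)) - a n / \<bar>n\<bar>\<close>. For an even weight \<open>G\<close> the quadratic term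
  contributes to the derivative of \<open>\<Sum>n. G n * \<bar>a n\<bar>\<^sup>2\<close> a sum over \<open>p + k + q = 0\<close> of
  \<open>(p G p + k G k + q G q) a p a k a q\<close>. It vanishes for \<open>G = 1\<close>, and for \<open>G n = n\<^sup>8\<close> the symmetrized
  symbol is bounded by the smallest frequency times the weight of the middle one, so that
  \<open>E' \<le> C A E\<close> with the Wiener norm \<open>A = \<Sum>n. \<bar>n\<bar> \<bar>a n\<bar>\<close>. As long as \<open>E \<le> M\<^sup>2\<close>, the damping and a
  frequency splitting give \<open>\<parallel>u\<parallel> = O (M (1 + t)\<^sup>-\<^sup>3)\<close> in \<open>L\<^sup>2\<close>, and interpolation gives
  \<open>A = O (M (1 + t)\<^sup>-\<^sup>3\<^sup>/\<^sup>2)\<close>, which is integrable in time; for small \<open>M\<close> the bound on \<open>E\<close> is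
  therefore never lost.

  The estimates hold uniformly for the Galerkin truncations, whose coefficients converge along a
  subsequence. The same energy estimate with the weight \<open>min 1 (\<bar>n\<bar> / m) n\<^sup>8\<close> shows that the \<open>H\<^sup>4\<close>
  tails are small uniformly in time and in the truncation. Hence continuity in time of each single
  coefficient already implies continuity in \<open>H\<^sup>4\<close>.
\<close>

section \<open>The cubic form of the energy identity\<close>

text \<open>The damping 1/|n| has no positive lower bound, so L^2 decay needs a uniform H^4 bound,
  while that bound needs a Wiener norm integrable in time: both must be closed together. For the
  squared L^2 norm y, cutting at frequency R gives y' <= -(2/R) (y - M^2/R^8). With R = (1+t)/3 the
  homogeneous part decays like (1+t)^(-6), and the forcing stays integrable after multiplication by
  (1+t)^6. The Wiener norm is at most a constant times the square root of (L^2 norm) * (H^4 norm),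
  so any L^2 rate beyond (1+t)^(-2) makes it integrable; the rate 3 leaves room and also exceeds the
  claimed 2.25. For the tails a sharp cutoff at |n| >= m would not do: its jump destroys the gain of
  the smallest frequency. The ramp in \<open>weight\<close> is concave in |n|, raises the effective
  degree by only one, and gives the constant 1023 = 2^10 - 1 independently of \<open>m\<close>.
  \<open>H_space\<close> speaks of L^2 representatives, whereas the analysis produces coefficients.
  Bessel, uniqueness of coefficients and Riesz-Fischer form the bridge between the two.\<close>

lemma one_plus_power_le_chord:
  fixes r :: real
  assumes "0 \<le> r" "r \<le> 1"
  shows "(1 + r) ^ n \<le> 1 + (2 ^ n - 1) * r"
proof (induction n)
  case (Suc n)
  have r2: "r * r \<le> r" using assms by (simp add: mult_left_le)
  have c: "(2::real) ^ n - 1 \<ge> 0" by simp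
  have "(1 + r) ^ Suc n \<le> (1 + r) * (1 + (2 ^ n - 1) * r)"
    using Suc assms by (simp add: mult_left_mono)
  also have "\<dots> = 1 + 2 ^ n * r + (2 ^ n - 1) * (r * r)" by (simp add: algebra_simps)
  also have "\<dots> \<le> 1 + 2 ^ n * r + (2 ^ n - 1) * r" using r2 c by (simp add: mult_left_mono)
  also have "\<dots> = 1 + (2 ^ Suc n - 1) * r" by (simp add: algebra_simps)
  finally show ?case .
qed simp

text \<open>For integers \<open>n\<close> and \<open>m = 1\<close> this is the \<open>H\<^sup>4\<close> weight. Propagating the energy with large \<open>m\<close>
  shows that the \<open>H\<^sup>4\<close> mass in the modes \<open>\<bar>n\<bar> \<ge> m\<close> stays small uniformly in time.\<close>

definition weight :: "real \<Rightarrow> real \<Rightarrow> real" where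
  "weight m s = min 1 (\<bar>s\<bar> / m) * s ^ 8"

lemma weight_minus [simp]: "weight m (- s) = weight m s"
  by (simp add: weight_def)

lemma weight_nonneg: "0 < m \<Longrightarrow> 0 \<le> weight m s"
  by (simp add: weight_def)

lemma weight_mono:
  assumes "0 < m" "\<bar>s\<bar> \<le> \<bar>t\<bar>" shows "weight m s \<le> weight m t"
proof -
  have "min 1 (\<bar>s\<bar> / m) \<le> min 1 (\<bar>t\<bar> / m)"
    using assms by (intro min.mono divide_right_mono) auto
  moreover have "s ^ 8 \<le> t ^ 8"
    using power_mono[OF assms(2), of 8] by simp
  ultimately show ?thesis
    unfolding weight_def using assms by (intro mult_mono) auto
qed

text \<open>Monotonicity of the weight makes \<open>s * weight m s\<close> superadditive on s >= 0,
  so the defect is nonnegative. Polynomial growth of bounded degree leaves an excess proportional to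
  the smaller frequency \<open>k\<close>.\<close>

lemma weight_odd_extension_defect:
  assumes m: "0 < m" and kp: "0 \<le> k" "k \<le> p"
  shows "\<bar>(k + p) * weight m (k + p) - k * weight m k - p * weight m p\<bar> \<le> 1023 * k * weight m p"
proof (cases "p = 0")
  case True
  with kp show ?thesis by simp
next
  case False
  with kp have p: "0 < p" by simp
  define g where "g s = min 1 (s / m)" for s
  have g0: "0 \<le> g p" using p m by (simp add: g_def)
  have w: "weight m s = g s * s ^ 8" if "0 \<le> s" for s
    using that by (simp add: weight_def g_def)
  \<comment> \<open>Concavity of the ramp, which starts at the origin: \<open>g s / s\<close> is
    nonincreasing, so the cutoff grows at most linearly.\<close>
  have gkp: "g (k + p) \<le> g p * ((k + p) / p)"
  proof (cases "p \<le> m")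
    case True
    then have "g p = p / m" using m by (simp add: g_def)
    then show ?thesis using p m by (simp add: g_def)
  next
    case False
    then have "g p = 1" using m by (simp add: g_def)
    moreover have "g (k + p) \<le> 1" by (simp add: g_def)
    moreover have "1 \<le> (k + p) / p" using p kp by simp
    ultimately show ?thesis by simp
  qed
  \<comment> \<open>The degree 10 is 8 from the weight, 1 from the outer factor and 1 from the
    growth of the cutoff. The chord bound then makes the excess over \<open>p ^ 10\<close> linear in
    \<open>k\<close>.\<close>
  have "(k + p) ^ 10 = p ^ 10 * (1 + k / p) ^ 10"
    using p by (simp add: power_mult_distrib[symmetric] field_simps)
  also have "\<dots> \<le> p ^ 10 * (1 + (2 ^ 10 - 1) * (k / p))"
    using kp p by (intro mult_left_mono one_plus_power_le_chord) auto
  also have "\<dots> = p ^ 10 + 1023 * k * p ^ 9"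
    using p by (simp add: field_simps eval_nat_numeral)
  finally have pow: "(k + p) ^ 10 \<le> p ^ 10 + 1023 * k * p ^ 9" .
  have "(k + p) * weight m (k + p) = g (k + p) * (k + p) ^ 9"
    using kp p by (simp add: w eval_nat_numeral)
  also have "\<dots> \<le> g p * ((k + p) / p) * (k + p) ^ 9"
    using gkp kp p by (intro mult_right_mono) auto
  also have "\<dots> = g p / p * (k + p) ^ 10" by (simp add: eval_nat_numeral)
  also have "\<dots> \<le> g p / p * (p ^ 10 + 1023 * k * p ^ 9)"
    using pow g0 p by (intro mult_left_mono) auto
  also have "\<dots> = p * weight m p + 1023 * k * weight m p"
    using p by (simp add: w field_simps eval_nat_numeral)
  finally have up: "(k + p) * weight m (k + p) \<le> p * weight m p + 1023 * k * weight m p" .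
  have "k * weight m k + p * weight m p \<le> k * weight m (k + p) + p * weight m (k + p)"
    using kp p m by (intro add_mono mult_left_mono weight_mono) auto
  then have "k * weight m k + p * weight m p \<le> (k + p) * weight m (k + p)"
    by (simp add: algebra_simps)
  moreover have "0 \<le> k * weight m k" using kp weight_nonneg[OF m] by simp
  ultimately show ?thesis using up by linarith
qed

text \<open>The gain of the smallest frequency replaces a commutator estimate.\<close>

lemma resonance_bound_ordered:
  fixes p k q :: real
  assumes m: "0 < m" and s: "p + k + q = 0" and o: "\<bar>p\<bar> \<le> \<bar>k\<bar>" "\<bar>k\<bar> \<le> \<bar>q\<bar>"
  shows "\<bar>p * weight m p + k * weight m k + q * weight m q\<bar> \<le> 1023 * \<bar>p\<bar> * weight m k"
proof -
  have q: "q = - (p + k)" using s by simp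
  \<comment> \<open>The last two cases are empty: if \<open>p\<close> and \<open>k\<close> had
    opposite signs, then |q| = |k| - |p| < |k|.\<close>
  consider "p = 0" | "p > 0" "k \<ge> 0" | "p < 0" "k \<le> 0" | "p > 0" "k < 0" | "p < 0" "k > 0"
    by linarith
  then show ?thesis
  proof cases
    case 1 then show ?thesis using q by simp
  next
    case 2
    then have "\<bar>(p + k) * weight m (p + k) - p * weight m p - k * weight m k\<bar> \<le> 1023 * p * weight m k"
      using o by (intro weight_odd_extension_defect m) auto
    then show ?thesis using 2 unfolding q weight_minus by (simp add: abs_minus_commute algebra_simps)
  next
    case 3
    then have "\<bar>(- p + - k) * weight m (- p + - k) - (- p) * weight m (- p) - (- k) * weight m (- k)\<bar>
        \<le> 1023 * (- p) * weight m (- k)"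
      using o by (intro weight_odd_extension_defect m) auto
    moreover have "weight m (- p + - k) = weight m q" "- p + - k = q" using s by (simp_all add: q)
    ultimately have "\<bar>q * weight m q + p * weight m p + k * weight m k\<bar> \<le> 1023 * (- p) * weight m k"
      by simp
    then show ?thesis using 3 by (simp add: add.commute add.left_commute)
  qed (use o q in auto)
qed

text \<open>The small factor |p| joins \<open>x\<close> to form a term of the Wiener norm. Young's
  inequality splits \<open>y * z\<close> into two energy terms, and monotonicity replaces the weight
  at \<open>k\<close> by the larger one at \<open>q\<close> in the second.\<close>

lemma resonance_bound_cubic_ordered:
  fixes p k q x y z :: real
  assumes m: "0 < m" and s: "p + k + q = 0" and o: "\<bar>p\<bar> \<le> \<bar>k\<bar>" "\<bar>k\<bar> \<le> \<bar>q\<bar>"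
    and n: "0 \<le> x" "0 \<le> y" "0 \<le> z"
  shows "\<bar>p * weight m p + k * weight m k + q * weight m q\<bar> * (x * y * z)
    \<le> 1023 / 2 * (\<bar>p\<bar> * x * (weight m k * y\<^sup>2 + weight m q * z\<^sup>2))"
proof -
  have "\<bar>p * weight m p + k * weight m k + q * weight m q\<bar> * (x * y * z)
      \<le> 1023 * \<bar>p\<bar> * weight m k * (x * y * z)"
    using n by (intro mult_right_mono resonance_bound_ordered assms) auto
  also have "\<dots> = 1023 * \<bar>p\<bar> * x * weight m k * (y * z)" by simp
  also have "\<dots> \<le> 1023 * \<bar>p\<bar> * x * weight m k * ((y\<^sup>2 + z\<^sup>2) / 2)"
    using n weight_nonneg[OF m] sum_squares_bound[of y z] by (intro mult_left_mono) auto
  also have "\<dots> = 1023 / 2 * (\<bar>p\<bar> * x * (weight m k * y\<^sup>2 + weight m k * z\<^sup>2))"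
    by (simp add: algebra_simps)
  also have "\<dots> \<le> 1023 / 2 * (\<bar>p\<bar> * x * (weight m k * y\<^sup>2 + weight m q * z\<^sup>2))"
    using n weight_mono[OF m o(2)] by (intro mult_left_mono add_mono mult_right_mono) auto
  finally show ?thesis .
qed

text \<open>Adding the nonnegative bounds for all three choices of the smallest frequency removes
  the ordering, so that the estimate can be summed over all triples.\<close>

lemma resonance_bound_cubic:
  fixes p k q x y z :: real
  assumes m: "0 < m" and s: "p + k + q = 0" and n: "0 \<le> x" "0 \<le> y" "0 \<le> z"
  shows "\<bar>p * weight m p + k * weight m k + q * weight m q\<bar> * (x * y * z)
    \<le> 1023 / 2 * (\<bar>p\<bar> * x * (weight m k * y\<^sup>2 + weight m q * z\<^sup>2)
                + \<bar>k\<bar> * y * (weight m p * x\<^sup>2 + weight m q * z\<^sup>2)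
                + \<bar>q\<bar> * z * (weight m p * x\<^sup>2 + weight m k * y\<^sup>2))"
proof -
  have nn: "0 \<le> \<bar>a\<bar> * u * (weight m b * v\<^sup>2 + weight m c * w\<^sup>2)" if "0 \<le> u" for a b c u v w :: real
    using that weight_nonneg[OF m] by simp
  define X Y Z where "X = weight m p * x\<^sup>2" and "Y = weight m k * y\<^sup>2" and "Z = weight m q * z\<^sup>2"
  define U where "U = \<bar>p * weight m p + k * weight m k + q * weight m q\<bar> * (x * y * z)"
  have P: "0 \<le> \<bar>p\<bar> * x * (weight m k * y\<^sup>2 + weight m q * z\<^sup>2)" by (rule nn[OF n(1)])
  have K: "0 \<le> \<bar>k\<bar> * y * (weight m p * x\<^sup>2 + weight m q * z\<^sup>2)" by (rule nn[OF n(2)])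
  have Q: "0 \<le> \<bar>q\<bar> * z * (weight m p * x\<^sup>2 + weight m k * y\<^sup>2)" by (rule nn[OF n(3)])
  note B = resonance_bound_cubic_ordered[OF m]
  consider "\<bar>p\<bar> \<le> \<bar>k\<bar>" "\<bar>k\<bar> \<le> \<bar>q\<bar>" | "\<bar>p\<bar> \<le> \<bar>q\<bar>" "\<bar>q\<bar> \<le> \<bar>k\<bar>" | "\<bar>k\<bar> \<le> \<bar>p\<bar>" "\<bar>p\<bar> \<le> \<bar>q\<bar>"
    | "\<bar>k\<bar> \<le> \<bar>q\<bar>" "\<bar>q\<bar> \<le> \<bar>p\<bar>" | "\<bar>q\<bar> \<le> \<bar>p\<bar>" "\<bar>p\<bar> \<le> \<bar>k\<bar>" | "\<bar>q\<bar> \<le> \<bar>k\<bar>" "\<bar>k\<bar> \<le> \<bar>p\<bar>"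
    by linarith
  then show ?thesis
  proof cases
    case 1
    have "U \<le> 1023 / 2 * (\<bar>p\<bar> * x * (Y + Z))"
      using B[of p k q x y z] 1 s n unfolding U_def X_def Y_def Z_def by (simp add: add.commute add.left_commute mult_ac)
    then show ?thesis using P K Q unfolding U_def[symmetric] X_def[symmetric] Y_def[symmetric] Z_def[symmetric] by (simp add: add.commute)
  next
    case 2
    have "U \<le> 1023 / 2 * (\<bar>p\<bar> * x * (Z + Y))"
      using B[of p q k x z y] 2 s n unfolding U_def X_def Y_def Z_def by (simp add: add.commute add.left_commute mult_ac)
    then show ?thesis using P K Q unfolding U_def[symmetric] X_def[symmetric] Y_def[symmetric] Z_def[symmetric] by (simp add: add.commute)
  next
    case 3
    have "U \<le> 1023 / 2 * (\<bar>k\<bar> * y * (X + Z))"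
      using B[of k p q y x z] 3 s n unfolding U_def X_def Y_def Z_def by (simp add: add.commute add.left_commute mult_ac)
    then show ?thesis using P K Q unfolding U_def[symmetric] X_def[symmetric] Y_def[symmetric] Z_def[symmetric] by (simp add: add.commute)
  next
    case 4
    have "U \<le> 1023 / 2 * (\<bar>k\<bar> * y * (Z + X))"
      using B[of k q p y z x] 4 s n unfolding U_def X_def Y_def Z_def by (simp add: add.commute add.left_commute mult_ac)
    then show ?thesis using P K Q unfolding U_def[symmetric] X_def[symmetric] Y_def[symmetric] Z_def[symmetric] by (simp add: add.commute)
  next
    case 5
    have "U \<le> 1023 / 2 * (\<bar>q\<bar> * z * (X + Y))"
      using B[of q p k z x y] 5 s n unfolding U_def X_def Y_def Z_def by (simp add: add.commute add.left_commute mult_ac)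
    then show ?thesis using P K Q unfolding U_def[symmetric] X_def[symmetric] Y_def[symmetric] Z_def[symmetric] by (simp add: add.commute)
  next
    case 6
    have "U \<le> 1023 / 2 * (\<bar>q\<bar> * z * (Y + X))"
      using B[of q k p z y x] 6 s n unfolding U_def X_def Y_def Z_def by (simp add: add.commute add.left_commute mult_ac)
    then show ?thesis using P K Q unfolding U_def[symmetric] X_def[symmetric] Y_def[symmetric] Z_def[symmetric] by (simp add: add.commute)
  qed
qed

text \<open>Both sums reduce to the part of the window that the reflection maps to itself.\<close>

lemma sum_reflect_support:
  fixes f :: "int \<Rightarrow> 'a::comm_monoid_add"
  assumes "\<And>p. N < \<bar>p\<bar> \<Longrightarrow> f p = 0" "\<And>p. N < \<bar>c - p\<bar> \<Longrightarrow> f p = 0"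
  shows "(\<Sum>p\<in>{-N..N}. f p) = (\<Sum>p\<in>{-N..N}. f (c - p))"
proof -
  define D where "D = {p\<in>{-N..N}. \<bar>c - p\<bar> \<le> N}"
  have D: "D \<subseteq> {-N..N}" "finite {-N..N}" by (auto simp: D_def)
  have "(\<Sum>p\<in>{-N..N}. f p) = sum f D"
    using assms D by (intro sum.mono_neutral_right) (auto simp: D_def)
  also have "\<dots> = (\<Sum>p\<in>D. f (c - p))"
    by (rule sum.reindex_bij_witness[of _ "\<lambda>p. c - p" "\<lambda>p. c - p"]) (auto simp: D_def)
  also have "\<dots> = (\<Sum>p\<in>{-N..N}. f (c - p))"
    using D assms(2) by (intro sum.mono_neutral_left) (auto simp: D_def abs_if intro: assms(1))
  finally show ?thesis .
qed

text \<open>Only an inequality, since the reflection may carry part of the support of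
  \<open>h\<close> out of the window.\<close>

lemma sum_reflect_le:
  fixes h :: "int \<Rightarrow> real"
  assumes "\<And>p. N < \<bar>p\<bar> \<Longrightarrow> h p = 0" "\<And>p. 0 \<le> h p"
  shows "(\<Sum>k\<in>{-N..N}. h (c - k)) \<le> (\<Sum>k\<in>{-N..N}. h k)"
proof -
  define D where "D = {p\<in>{-N..N}. \<bar>c - p\<bar> \<le> N}"
  have "(\<Sum>k\<in>{-N..N}. h (c - k)) = (\<Sum>k\<in>D. h (c - k))"
    by (intro sum.mono_neutral_right) (auto simp: D_def not_le intro: assms(1))
  also have "\<dots> = sum h ((\<lambda>k. c - k) ` D)"
    by (subst sum.reindex) (auto simp: inj_on_def)
  also have "\<dots> \<le> (\<Sum>k\<in>{-N..N}. h k)"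
    using assms by (intro sum_mono2) (auto simp: D_def)
  finally show ?thesis .
qed

text \<open>The n-th Fourier coefficient of -u u_x in the conservative form -(u^2/2)_x, which puts
  the derivative outside as the factor n. The index \<open>n - k\<close> may leave the window; a
  Galerkin solution vanishes there.\<close>

definition burgers_term :: "int \<Rightarrow> (int \<Rightarrow> complex) \<Rightarrow> int \<Rightarrow> complex" where
  "burgers_term N a n = - (\<i> * of_int n / 2) * (\<Sum>k\<in>{-N..N}. a k * a (n - k))"

text \<open>Reality and n = -p turn the left side into a sum over p + k + q = 0 with
  \<open>W\<close> in one slot only. Relabelling the triple moves \<open>W\<close> to each slot
  without changing the value, and averaging gives the factor 1/3.\<close>

lemma cubic_symmetrization:
  fixes a :: "int \<Rightarrow> complex" and G :: "int \<Rightarrow> real"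
  assumes supp: "\<And>n. N < \<bar>n\<bar> \<Longrightarrow> a n = 0" and real: "\<And>n. a (- n) = cnj (a n)"
    and even: "\<And>n. G (- n) = G n"
  defines "W \<equiv> (\<lambda>n. of_int n * G n)"
  shows "(\<Sum>n\<in>{-N..N}. G n * (2 * Re (cnj (a n) * burgers_term N a n))) =
     Re (\<i> / 3 * (\<Sum>p\<in>{-N..N}. \<Sum>k\<in>{-N..N}. of_real (W p + W k + W (- p - k)) * (a p * a k * a (- p - k))))"
proof -
  define I where "I = {-N..N}"
  define S where "S = (\<Sum>p\<in>I. \<Sum>k\<in>I. of_real (W p) * (a p * a k * a (- p - k)))"
  have "(\<Sum>n\<in>I. G n * (2 * Re (cnj (a n) * burgers_term N a n)))
      = Re (\<Sum>n\<in>I. - \<i> * of_real (W n) * cnj (a n) * (\<Sum>k\<in>I. a k * a (n - k)))"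
    unfolding Re_sum
  proof (rule sum.cong[OF refl])
    fix n
    have "of_real (G n) * (2 * (cnj (a n) * burgers_term N a n))
        = - \<i> * of_real (W n) * cnj (a n) * (\<Sum>k\<in>I. a k * a (n - k))"
      by (simp add: burgers_term_def W_def I_def algebra_simps)
    then have "Re (of_real (G n) * (2 * (cnj (a n) * burgers_term N a n)))
        = Re (- \<i> * of_real (W n) * cnj (a n) * (\<Sum>k\<in>I. a k * a (n - k)))" by metis
    then show "G n * (2 * Re (cnj (a n) * burgers_term N a n))
        = Re (- \<i> * of_real (W n) * cnj (a n) * (\<Sum>k\<in>I. a k * a (n - k)))"
      by simp
  qed
  also have "(\<Sum>n\<in>I. - \<i> * of_real (W n) * cnj (a n) * (\<Sum>k\<in>I. a k * a (n - k)))
      = (\<Sum>p\<in>I. - \<i> * of_real (W (- p)) * cnj (a (- p)) * (\<Sum>k\<in>I. a k * a (- p - k)))"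
    by (rule sum.reindex_bij_witness[of _ uminus uminus]) (auto simp: I_def)
  also have "\<dots> = \<i> * S"
    unfolding S_def sum_distrib_left
    by (intro sum.cong refl) (simp add: W_def even real algebra_simps)
  finally have 1: "(\<Sum>n\<in>I. G n * (2 * Re (cnj (a n) * burgers_term N a n))) = Re (\<i> * S)" .
  \<comment> \<open>Exchange of the first two slots by swapping the sums.\<close>
  have S2: "S = (\<Sum>p\<in>I. \<Sum>k\<in>I. of_real (W k) * (a p * a k * a (- p - k)))"
    unfolding S_def by (subst sum.swap) (simp add: minus_diff_commute mult_ac)
  \<comment> \<open>For fixed \<open>k\<close> the reflection p -> -k - p exchanges the first and
    the third frequency. The support condition makes the truncation compatible with it.\<close>
  have S3: "S = (\<Sum>p\<in>I. \<Sum>k\<in>I. of_real (W (- p - k)) * (a p * a k * a (- p - k)))"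
  proof -
    have "(\<Sum>p\<in>I. of_real (W p) * (a p * a k * a (- p - k)))
        = (\<Sum>p\<in>I. of_real (W (- p - k)) * (a p * a k * a (- p - k)))" for k
    proof -
      have "(\<Sum>p\<in>{-N..N}. of_real (W p) * (a p * a k * a (- p - k)))
        = (\<Sum>p\<in>{-N..N}. of_real (W (- k - p)) * (a (- k - p) * a k * a (- (- k - p) - k)))"
      proof (rule sum_reflect_support)
        fix p assume "N < \<bar>- k - p\<bar>"
        then have "a (- k - p) = 0" by (rule supp)
        then have "a (- p - k) = 0" by (simp only: minus_diff_commute)
        then show "of_real (W p) * (a p * a k * a (- p - k)) = 0" by simp
      qed (simp add: supp)
      also have "\<dots> = (\<Sum>p\<in>{-N..N}. of_real (W (- p - k)) * (a p * a k * a (- p - k)))"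
      proof (rule sum.cong[OF refl])
        fix p
        have "- k - p = - p - k" "- (- p - k) - k = p" by simp_all
        then show "of_real (W (- k - p)) * (a (- k - p) * a k * a (- (- k - p) - k))
          = of_real (W (- p - k)) * (a p * a k * a (- p - k))" by (simp only: mult_ac)
      qed
      finally show ?thesis by (simp add: I_def)
    qed
    then show ?thesis
      unfolding S_def by (subst (1 2) sum.swap) simp
  qed
  have "(\<Sum>p\<in>I. \<Sum>k\<in>I. of_real (W p + W k + W (- p - k)) * (a p * a k * a (- p - k))) = S + S + S"
    unfolding of_real_add distrib_right sum.distrib
    by (subst S_def, subst S2, subst S3) simp
  then have "\<i> / 3 * (\<Sum>p\<in>I. \<Sum>k\<in>I. of_real (W p + W k + W (- p - k)) * (a p * a k * a (- p - k))) = \<i> * S"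
    by simp
  with 1 show ?thesis unfolding I_def by metis
qed

text \<open>Expanding gives six double sums. Two are exact products; in the other four one factor
  sits at the third frequency, and \<open>sum_reflect_le\<close> bounds the inner sum.\<close>

lemma double_sum_resonant_le:
  fixes f h :: "int \<Rightarrow> real"
  assumes f: "\<And>p. N < \<bar>p\<bar> \<Longrightarrow> f p = 0" "\<And>p. 0 \<le> f p"
    and h: "\<And>p. N < \<bar>p\<bar> \<Longrightarrow> h p = 0" "\<And>p. 0 \<le> h p"
  shows "(\<Sum>p\<in>{-N..N}. \<Sum>k\<in>{-N..N}. f p * (h k + h (- p - k)) + f k * (h p + h (- p - k))
            + f (- p - k) * (h p + h k))
      \<le> 6 * (\<Sum>p\<in>{-N..N}. f p) * (\<Sum>p\<in>{-N..N}. h p)" (is "?L \<le> 6 * ?f * ?h")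
proof -
  let ?I = "{-N..N}"
  have *: "(\<Sum>p\<in>?I. \<Sum>k\<in>?I. u p * v (- p - k)) \<le> sum u ?I * sum v ?I"
    if u: "\<And>p. 0 \<le> u p" and v: "\<And>p. N < \<bar>p\<bar> \<Longrightarrow> v p = 0" "\<And>p. 0 \<le> v p" for u v :: "int \<Rightarrow> real"
    unfolding sum_distrib_left[symmetric] sum_distrib_right
    by (intro sum_mono mult_left_mono sum_reflect_le u v)
  have "?L = (\<Sum>p\<in>?I. \<Sum>k\<in>?I. f p * h k) + (\<Sum>p\<in>?I. \<Sum>k\<in>?I. f p * h (- p - k))
      + (\<Sum>p\<in>?I. \<Sum>k\<in>?I. h p * f k) + (\<Sum>p\<in>?I. \<Sum>k\<in>?I. f k * h (- p - k))
      + (\<Sum>p\<in>?I. \<Sum>k\<in>?I. h p * f (- p - k)) + (\<Sum>p\<in>?I. \<Sum>k\<in>?I. h k * f (- p - k))"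
    by (simp add: sum.distrib distrib_left distrib_right mult.commute)
  also have "(\<Sum>p\<in>?I. \<Sum>k\<in>?I. f k * h (- p - k)) = (\<Sum>p\<in>?I. \<Sum>k\<in>?I. f p * h (- p - k))"
    by (subst sum.swap) (simp add: minus_diff_commute)
  also have "(\<Sum>p\<in>?I. \<Sum>k\<in>?I. h k * f (- p - k)) = (\<Sum>p\<in>?I. \<Sum>k\<in>?I. h p * f (- p - k))"
    by (subst sum.swap) (simp add: minus_diff_commute)
  also have "(\<Sum>p\<in>?I. \<Sum>k\<in>?I. f p * h k) = ?f * ?h" by (simp add: sum_product)
  also have "(\<Sum>p\<in>?I. \<Sum>k\<in>?I. h p * f k) = ?f * ?h"
    by (subst sum.swap) (simp add: sum_product mult.commute)
  finally show ?thesis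
    using *[of f h] *[of h f] assms by (simp add: mult.commute mult.left_commute)
qed

text \<open>The constant is 1/3 * 1023/2 * 6: the average over the slots, the pointwise resonance
  bound, and the six double sums.\<close>

lemma cubic_energy_bound:
  fixes a :: "int \<Rightarrow> complex"
  assumes m: "0 < m" and supp: "\<And>n. N < \<bar>n\<bar> \<Longrightarrow> a n = 0" and real: "\<And>n. a (- n) = cnj (a n)"
  shows "\<bar>\<Sum>n\<in>{-N..N}. weight m (of_int n) * (2 * Re (cnj (a n) * burgers_term N a n))\<bar>
     \<le> 1023 * (\<Sum>n\<in>{-N..N}. \<bar>of_int n\<bar> * cmod (a n)) * (\<Sum>n\<in>{-N..N}. weight m (of_int n) * (cmod (a n))\<^sup>2)"
proof -
  let ?I = "{-N..N}"
  let ?w = "\<lambda>n::int. weight m (of_int n)"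
  let ?f = "\<lambda>n::int. \<bar>of_int n\<bar> * cmod (a n)"
  let ?h = "\<lambda>n::int. ?w n * (cmod (a n))\<^sup>2"
  let ?W = "\<lambda>n::int. of_int n * ?w n"
  let ?D = "\<Sum>p\<in>?I. \<Sum>k\<in>?I. of_real (?W p + ?W k + ?W (- p - k)) * (a p * a k * a (- p - k))"
  have "\<bar>\<Sum>n\<in>?I. ?w n * (2 * Re (cnj (a n) * burgers_term N a n))\<bar> = \<bar>Re (\<i> / 3 * ?D)\<bar>"
    by (subst cubic_symmetrization[where a = a and N = N and G = ?w]) (auto simp: supp real)
  also have "\<dots> \<le> cmod (\<i> / 3 * ?D)" by (rule abs_Re_le_cmod)
  also have "\<dots> = 1 / 3 * cmod ?D" by (simp add: norm_mult norm_divide)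
  also have "cmod ?D \<le> (\<Sum>p\<in>?I. \<Sum>k\<in>?I. \<bar>?W p + ?W k + ?W (- p - k)\<bar> * (cmod (a p) * cmod (a k) * cmod (a (- p - k))))"
    by (intro order.trans[OF norm_sum] sum_mono) (simp only: norm_mult norm_of_real order.refl)
  also have "\<dots> \<le> (\<Sum>p\<in>?I. \<Sum>k\<in>?I. 1023 / 2 * (?f p * (?h k + ?h (- p - k)) + ?f k * (?h p + ?h (- p - k))
            + ?f (- p - k) * (?h p + ?h k)))"
    by (intro sum_mono resonance_bound_cubic m) auto
  also have "\<dots> = 1023 / 2 * (\<Sum>p\<in>?I. \<Sum>k\<in>?I. ?f p * (?h k + ?h (- p - k)) + ?f k * (?h p + ?h (- p - k))
            + ?f (- p - k) * (?h p + ?h k))"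
    by (simp only: sum_distrib_left)
  also have "\<dots> \<le> 1023 / 2 * (6 * (\<Sum>p\<in>?I. ?f p) * (\<Sum>p\<in>?I. ?h p))"
    using supp weight_nonneg[OF m] by (intro mult_left_mono double_sum_resonant_le) auto
  finally show ?thesis by simp
qed

lemma cubic_energy_zero:
  fixes a :: "int \<Rightarrow> complex"
  assumes supp: "\<And>n. N < \<bar>n\<bar> \<Longrightarrow> a n = 0" and real: "\<And>n. a (- n) = cnj (a n)"
  shows "(\<Sum>n\<in>{-N..N}. 2 * Re (cnj (a n) * burgers_term N a n)) = 0"
  using cubic_symmetrization[where a = a and N = N and G = "\<lambda>_. 1"] supp real by simp

text \<open>The scalar \<open>c\<close> is the factor that a clamped nonlinearity acquires; the
  equation itself has \<open>c = 1\<close>.\<close>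

lemma energy_derivative:
  fixes a :: "real \<Rightarrow> int \<Rightarrow> complex"
  assumes der: "\<And>n. n \<in> {-N..N} \<Longrightarrow> ((\<lambda>s. a s n) has_vector_derivative
      of_real c * burgers_term N (a t) n - a t n / of_int \<bar>n\<bar>) (at t within S)"
  shows "((\<lambda>s. \<Sum>n\<in>{-N..N}. G n * (cmod (a s n))\<^sup>2) has_real_derivative
     c * (\<Sum>n\<in>{-N..N}. G n * (2 * Re (cnj (a t n) * burgers_term N (a t) n)))
      - 2 * (\<Sum>n\<in>{-N..N}. G n * ((cmod (a t n))\<^sup>2 / \<bar>of_int n\<bar>))) (at t within S)"
proof -
  have "((\<lambda>s. (cmod (a s n))\<^sup>2) has_real_derivative
      2 * Re (cnj (a t n) * (of_real c * burgers_term N (a t) n - a t n / of_int \<bar>n\<bar>))) (at t within S)"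
    if "n \<in> {-N..N}" for n
  proof -
    let ?d = "of_real c * burgers_term N (a t) n - a t n / of_int \<bar>n\<bar>"
    have "((\<lambda>s. inner (a s n) (a s n)) has_vector_derivative (inner (a t n) ?d + inner ?d (a t n))) (at t within S)"
      using bounded_bilinear.has_vector_derivative[OF bounded_bilinear_inner der[OF that] der[OF that]] by simp
    moreover have "inner (a t n) ?d + inner ?d (a t n) = 2 * Re (cnj (a t n) * ?d)"
      by (simp add: inner_complex_def algebra_simps add_divide_distrib)
    ultimately show ?thesis
      by (simp add: has_real_derivative_iff_has_vector_derivative power2_norm_eq_inner)
  qed
  then have "((\<lambda>s. \<Sum>n\<in>{-N..N}. G n * (cmod (a s n))\<^sup>2) has_real_derivative
     (\<Sum>n\<in>{-N..N}. G n * (2 * Re (cnj (a t n) * (of_real c * burgers_term N (a t) n - a t n / of_int \<bar>n\<bar>))))) (at t within S)"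
    by (intro DERIV_sum DERIV_cmult) auto
  moreover have "G n * (2 * Re (cnj (a t n) * (of_real c * burgers_term N (a t) n - a t n / of_int \<bar>n\<bar>)))
      = c * (G n * (2 * Re (cnj (a t n) * burgers_term N (a t) n))) - 2 * (G n * ((cmod (a t n))\<^sup>2 / \<bar>of_int n\<bar>))" for n
  proof -
    have "Re (cnj (a t n) * (a t n / of_int \<bar>n\<bar>)) = (cmod (a t n))\<^sup>2 / \<bar>of_int n\<bar>"
    proof -
      have "of_real ((cmod (a t n))\<^sup>2 / of_int \<bar>n\<bar>) = cnj (a t n) * (a t n / of_int \<bar>n\<bar>)"
        unfolding of_real_divide of_real_of_int_eq complex_norm_square by (simp add: mult.commute)
      then have "Re (cnj (a t n) * (a t n / of_int \<bar>n\<bar>)) = (cmod (a t n))\<^sup>2 / of_int \<bar>n\<bar>"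
        by (metis Re_complex_of_real)
      then show ?thesis by (simp only: of_int_abs)
    qed
    moreover have "Re (cnj (a t n) * (of_real c * burgers_term N (a t) n)) = c * Re (cnj (a t n) * burgers_term N (a t) n)"
      by (simp add: algebra_simps)
    ultimately show ?thesis by (simp only: right_diff_distrib minus_complex.sel) (simp add: algebra_simps)
  qed
  ultimately show ?thesis
    by (simp add: sum_subtractf sum_distrib_left)
qed

section \<open>Globally Lipschitz differential equations\<close>

lemma nonincreasing_from_zero:
  fixes f :: "real \<Rightarrow> real"
  assumes der: "\<And>s. 0 \<le> s \<Longrightarrow> s \<le> t \<Longrightarrow> (f has_real_derivative f' s) (at s within {0..})"
    and neg: "\<And>s. 0 \<le> s \<Longrightarrow> s \<le> t \<Longrightarrow> f' s \<le> 0" and t: "0 \<le> t"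
  shows "f t \<le> f 0"
proof (cases "t = 0")
  case False
  show ?thesis
  proof (rule DERIV_nonpos_imp_decreasing_open[of 0 t f])
    show "\<exists>y. (f has_real_derivative y) (at x) \<and> y \<le> 0" if "0 < x" "x < t" for x
    proof -
      have "at x within {0..} = at x" by (rule at_within_interior) (use that in auto)
      with der[of x] neg[of x] that show ?thesis by auto
    qed
    have "continuous (at s within {0..t}) f" if "s \<in> {0..t}" for s
      using that by (intro DERIV_continuous[OF DERIV_subset[OF der]]) auto
    then show "continuous_on {0..t} f" by (simp add: continuous_on_eq_continuous_within)
  qed (use t in auto)
qed simp

text \<open>Picard iteration for x(t) = exp(2 L t) y(t) with y bounded. In this weighted norm the
  Picard map contracts on the whole half-line at once, so no continuation argument is
  needed.\<close>

lemma lipschitz_ode_global_solution: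
  fixes F :: "'e::banach \<Rightarrow> 'e"
  assumes L: "0 < L" and lip: "\<And>x y. norm (F x - F y) \<le> L * norm (x - y)"
  obtains x where "x 0 = x0"
    "\<And>t. 0 \<le> t \<Longrightarrow> (x has_vector_derivative F (x t)) (at t within {0..})"
proof -
  have contF: "continuous_on UNIV F"
  proof (rule lipschitz_on_continuous_on)
    show "L-lipschitz_on UNIV F" using lip L by (auto simp: lipschitz_on_def dist_norm)
  qed
  \<comment> \<open>\<open>f y\<close> is the field along the rescaled curve; \<open>P y\<close> is
    the Picard map after division by the exponential.\<close>
  define f where "f = (\<lambda>(y :: real \<Rightarrow>\<^sub>C 'e) s. F (exp (2 * L * s) *\<^sub>R y s))"
  define P where "P = (\<lambda>(y :: real \<Rightarrow>\<^sub>C 'e) t. exp (- (2 * L * t)) *\<^sub>R (x0 + integral {0..t} (f y)))"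
  have contf: "continuous_on S (f y)" for y S
    unfolding f_def by (intro continuous_on_compose2[OF contF] continuous_intros) auto
  have intf: "f y integrable_on {0..t}" for y t
    by (intro integrable_continuous_real contf)
  have contP: "continuous_on {0..} (P y)" for y
  proof -
    have "continuous_on {0..} (\<lambda>t. integral {0..t} (f y))"
    proof (rule continuous_on_subset[OF _ subset_refl], unfold continuous_on_eq_continuous_within, intro ballI)
      fix t :: real assume t: "t \<in> {0..}"
      have "continuous_on {0..t+1} (\<lambda>t. integral {0..t} (f y))"
        by (rule indefinite_integral_continuous_1[OF intf])
      then have "continuous (at t within {0..t+1}) (\<lambda>t. integral {0..t} (f y))"
        using t by (auto simp: continuous_on_eq_continuous_within)
      moreover have "at t within {0..t+1} = at t within {0..}"
        by (rule at_within_nhd[of _ "{..<t+1}"]) auto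
      ultimately show "continuous (at t within {0..}) (\<lambda>t. integral {0..t} (f y))"
        by (simp add: continuous_within)
    qed
    then show ?thesis unfolding P_def by (intro continuous_intros) auto
  qed
  have int_exp: "((\<lambda>s. exp (2 * L * s)) has_integral (exp (2 * L * t) - 1) / (2 * L)) {0..t}" if "0 \<le> t" for t
  proof -
    have "((\<lambda>s. exp (2 * L * s)) has_integral exp (2 * L * t) / (2 * L) - exp (2 * L * 0) / (2 * L)) {0..t}"
    proof (rule fundamental_theorem_of_calculus[OF that])
      fix x assume "x \<in> {0..t}"
      show "((\<lambda>s. exp (2 * L * s) / (2 * L)) has_vector_derivative exp (2 * L * x)) (at x within {0..t})"
        unfolding has_real_derivative_iff_has_vector_derivative[symmetric]
        using L by (auto intro!: derivative_eq_intros)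
    qed
    then show ?thesis using L by (simp add: diff_divide_distrib)
  qed
  have diffP: "norm (P y t - P z t) \<le> norm (y - z) / 2" if "0 \<le> t" for y z t
  proof -
    have b: "norm (f y s - f z s) \<le> L * norm (y - z) * exp (2 * L * s)" for s
    proof -
      have "norm (f y s - f z s) \<le> L * norm (exp (2 * L * s) *\<^sub>R y s - exp (2 * L * s) *\<^sub>R z s)"
        unfolding f_def by (rule lip)
      also have "\<dots> = L * (exp (2 * L * s) * norm ((y - z) s))"
        by (simp add: scaleR_diff_right[symmetric])
      also have "\<dots> \<le> L * (exp (2 * L * s) * norm (y - z))"
        using L norm_bounded[of "y - z" s] by (intro mult_left_mono) auto
      finally show ?thesis by (simp add: mult_ac)
    qed
    have "P y t - P z t = exp (- (2 * L * t)) *\<^sub>R integral {0..t} (\<lambda>s. f y s - f z s)"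
      unfolding P_def by (simp add: integral_diff intf algebra_simps)
    also have "norm \<dots> = exp (- (2 * L * t)) * norm (integral {0..t} (\<lambda>s. f y s - f z s))" by simp
    also have "\<dots> \<le> exp (- (2 * L * t)) * (L * norm (y - z) * ((exp (2 * L * t) - 1) / (2 * L)))"
    proof (intro mult_left_mono)
      have h: "((\<lambda>s. L * norm (y - z) * exp (2 * L * s)) has_integral
          L * norm (y - z) * ((exp (2 * L * t) - 1) / (2 * L))) {0..t}"
        by (intro has_integral_mult_right int_exp that)
      have "norm (integral {0..t} (\<lambda>s. f y s - f z s)) \<le> integral {0..t} (\<lambda>s. L * norm (y - z) * exp (2 * L * s))"
        using b h by (intro integral_norm_bound_integral integrable_diff intf) (auto simp: has_integral_integrable)
      then show "norm (integral {0..t} (\<lambda>s. f y s - f z s)) \<le> L * norm (y - z) * ((exp (2 * L * t) - 1) / (2 * L))"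
        unfolding integral_unique[OF h] .
    qed simp
    \<comment> \<open>The growth rate 2 L, twice the Lipschitz constant, produces the contraction
      factor 1/2.\<close>
    also have "\<dots> = norm (y - z) / 2 * (1 - exp (- (2 * L * t)))"
      using L by (simp add: field_simps exp_minus)
    also have "\<dots> \<le> norm (y - z) / 2" by (simp add: mult_left_le)
    finally show ?thesis .
  qed
  have bddP: "\<exists>B. \<forall>t\<ge>0. norm (P y t) \<le> B" for y
  proof -
    have b0: "norm (P 0 t) \<le> norm x0 + norm (F 0) / (2 * L)" if t: "0 \<le> t" for t
    proof -
      have "P 0 t = exp (- (2 * L * t)) *\<^sub>R (x0 + t *\<^sub>R F 0)"
        using t by (simp add: P_def f_def)
      also have "norm \<dots> \<le> exp (- (2 * L * t)) * (norm x0 + t * norm (F 0))"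
        using t norm_triangle_ineq[of x0 "t *\<^sub>R F 0"] by (simp add: mult_left_mono)
      also have "\<dots> = exp (- (2 * L * t)) * norm x0 + (2 * L * t * exp (- (2 * L * t))) * (norm (F 0) / (2 * L))"
        using L by (simp add: field_simps)
      also have "\<dots> \<le> 1 * norm x0 + 1 * (norm (F 0) / (2 * L))"
      proof (intro add_mono mult_right_mono)
        have "2 * L * t \<le> exp (2 * L * t)" using exp_ge_add_one_self[of "2 * L * t"] by linarith
        then show "2 * L * t * exp (- (2 * L * t)) \<le> 1" by (simp add: exp_minus field_simps)
      qed (use L t in auto)
      finally show ?thesis by simp
    qed
    have "norm (P y t) \<le> norm (y - 0) / 2 + (norm x0 + norm (F 0) / (2 * L))" if "0 \<le> t" for t
      using diffP[OF that, of y 0] b0[OF that] norm_triangle_sub[of "P y t" "P 0 t"] by linarith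
    then show ?thesis by blast
  qed
  \<comment> \<open>Bounded continuous functions live on the whole line, so the Picard image is
    extended to negative times by its value at 0.\<close>
  define Q where "Q y = Bcontfun (\<lambda>t. P y (max 0 t))" for y
  have Q: "apply_bcontfun (Q y) t = P y (max 0 t)" for y t
  proof -
    obtain B where B: "\<forall>t\<ge>0. norm (P y t) \<le> B" using bddP by blast
    have "(\<lambda>t. P y (max 0 t)) \<in> bcontfun"
    proof (rule bcontfun_normI[of _ B])
      show "continuous_on UNIV (\<lambda>t. P y (max 0 t))"
        by (intro continuous_on_compose2[OF contP] continuous_intros) auto
    qed (use B in auto)
    then show ?thesis by (simp add: Q_def Bcontfun_inverse)
  qed
  have "\<exists>!y. Q y = y"
  proof (rule banach_fix_type[where c = "1/2"])
    show "\<forall>y z. dist (Q y) (Q z) \<le> 1 / 2 * dist y z"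
    proof (intro allI)
      fix y z
      have "norm (Q y - Q z) \<le> norm (y - z) / 2"
      proof (rule norm_bound)
        show "norm (apply_bcontfun (Q y - Q z) t) \<le> norm (y - z) / 2" for t
          using diffP[of "max 0 t" y z] by (simp add: Q)
      qed
      then show "dist (Q y) (Q z) \<le> 1 / 2 * dist y z" by (simp add: dist_norm)
    qed
  qed auto
  then obtain y where y: "Q y = y" by blast
  define x where "x t = exp (2 * L * t) *\<^sub>R y t" for t
  have x: "x t = x0 + integral {0..t} (\<lambda>s. F (x s))" if "0 \<le> t" for t
  proof -
    have "y t = P y t" using Q[of y t] y that by simp
    then show ?thesis
      by (simp add: x_def P_def f_def exp_minus)
  qed
  have "(x has_vector_derivative F (x t)) (at t within {0..})" if t: "0 \<le> t" for t
  proof -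
    have c: "continuous_on {0..t+1} (\<lambda>s. F (x s))"
      using contf[of "{0..t+1}" y] by (simp add: f_def x_def)
    have "((\<lambda>u. integral {0..u} (\<lambda>s. F (x s))) has_vector_derivative F (x t)) (at t within {0..t+1})"
      by (rule integral_has_vector_derivative[OF c]) (use t in auto)
    then have "((\<lambda>u. x0 + integral {0..u} (\<lambda>s. F (x s))) has_vector_derivative F (x t)) (at t within {0..t+1})"
      by (auto intro!: derivative_eq_intros)
    moreover have "at t within {0..t+1} = at t within {0..}"
      by (rule at_within_nhd[of _ "{..<t+1}"]) auto
    ultimately have "((\<lambda>u. x0 + integral {0..u} (\<lambda>s. F (x s))) has_vector_derivative F (x t)) (at t within {0..})"
      by simp
    then show ?thesis
      by (rule has_vector_derivative_transform[rotated 2]) (use t x in auto)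
  qed
  moreover have "x 0 = x0" using x[of 0] by simp
  ultimately show ?thesis using that by blast
qed

section \<open>Galerkin approximations\<close>

text \<open>Completeness of \<open>bcontfun\<close> is available in the library over metric domains only.\<close>

instance bcontfun :: (metric_space, banach) banach ..

text \<open>Its topology is discrete, so every bounded sequence is continuous and
  \<open>int \<Rightarrow>\<^sub>C complex\<close> becomes the Banach phase space of the truncated
  system.\<close>

instantiation int :: metric_space
begin

definition dist_int :: "int \<Rightarrow> int \<Rightarrow> real" where
  "dist_int m n = \<bar>real_of_int m - real_of_int n\<bar>"

definition uniformity_int :: "(int \<times> int) filter" where
  "uniformity_int = (INF e\<in>{0<..}. principal {(x, y). dist x y < e})"

instance
proof
  fix U :: "int set"
  have "\<forall>\<^sub>F (x', y) in uniformity. x' = x \<longrightarrow> y \<in> U" if "x \<in> U" for x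
    unfolding uniformity_int_def
  proof (rule eventually_INF1[of 1])
    have "x = b" if "\<bar>real_of_int x - real_of_int b\<bar> < 1" for b using that by linarith
    with that show "\<forall>\<^sub>F (x', y) in principal {(x, y). dist x y < 1}. x' = x \<longrightarrow> y \<in> U"
      by (auto simp: dist_int_def eventually_principal)
  qed simp
  then show "open U = (\<forall>x\<in>U. \<forall>\<^sub>F (x', y) in uniformity. x' = x \<longrightarrow> y \<in> U)"
    by (simp add: open_discrete)
qed (auto simp: uniformity_int_def dist_int_def)

end

lemma norm_divide_abs_int_le: "cmod (z / of_int \<bar>n\<bar>) \<le> cmod z"
proof (cases "n = 0")
  case False
  then have "1 \<le> \<bar>real_of_int n\<bar>" by linarith
  then have "cmod z / \<bar>real_of_int n\<bar> \<le> cmod z / 1" by (intro divide_left_mono) auto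
  then show ?thesis by (simp add: norm_divide)
qed simp

text \<open>For R > 0 this is the radial retraction onto the ball of radius R, written without a
  case distinction; it is the identity inside the ball.\<close>

definition radial_clamp :: "real \<Rightarrow> 'a::real_normed_vector \<Rightarrow> 'a" where
  "radial_clamp R x = (R / max R (norm x)) *\<^sub>R x"

lemma norm_radial_clamp_le:
  assumes "0 < R" shows "norm (radial_clamp R x) \<le> R"
proof -
  have "norm x / max R (norm x) \<le> 1" using assms by simp
  then have "R * (norm x / max R (norm x)) \<le> R * 1" using assms by (intro mult_left_mono) auto
  then show ?thesis using assms by (simp add: radial_clamp_def)
qed

text \<open>One contribution comes from x - y, one from the change of the scaling factor. The
  constant is 2 because the norm need not come from an inner product; here it is a sup norm.\<close>

lemma radial_clamp_lipschitz:
  assumes R: "0 < R" shows "norm (radial_clamp R x - radial_clamp R y) \<le> 2 * norm (x - y)"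
proof -
  define m where "m z = max R (norm z)" for z :: 'a
  have m: "0 < m z" "R \<le> m z" "norm z \<le> m z" for z using R by (auto simp: m_def)
  have mm: "\<bar>m y - m x\<bar> \<le> norm (x - y)"
    using norm_triangle_ineq3[of x y] by (auto simp: m_def max_def)
  have "radial_clamp R x - radial_clamp R y = (R / m x) *\<^sub>R (x - y) + (R * (m y - m x) / (m x * m y)) *\<^sub>R y"
  proof -
    have "R / m x - R * (m y - m x) / (m x * m y) = R / m y"
      using m(1)[of x] m(1)[of y] by (simp add: field_simps)
    then have "(R / m y) *\<^sub>R y = (R / m x) *\<^sub>R y - (R * (m y - m x) / (m x * m y)) *\<^sub>R y"
      by (metis scaleR_diff_left)
    then show ?thesis by (simp add: radial_clamp_def flip: m_def) (simp add: scaleR_diff_right)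
  qed
  also have "norm \<dots> \<le> \<bar>R / m x\<bar> * norm (x - y) + \<bar>R * (m y - m x) / (m x * m y)\<bar> * norm y"
    by (intro order.trans[OF norm_triangle_ineq]) simp
  also have "\<bar>R / m x\<bar> * norm (x - y) \<le> 1 * norm (x - y)"
    using m[of x] R by (intro mult_right_mono) auto
  also have "\<bar>R * (m y - m x) / (m x * m y)\<bar> * norm y = (R / m x) * (norm y / m y) * \<bar>m y - m x\<bar>"
    using m[of x] m[of y] R by (simp add: abs_mult)
  also have "\<dots> \<le> 1 * 1 * norm (x - y)"
    using m[of x] m[of y] R mm by (intro mult_mono) auto
  finally show ?thesis by simp
qed

text \<open>The condition satisfied by the Fourier coefficients of a real function.\<close>

definition hermitian :: "(int \<Rightarrow> complex) \<Rightarrow> bool" where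
  "hermitian a \<longleftrightarrow> (\<forall>n. a (- n) = cnj (a n))"

text \<open>A solution of the Fourier truncation of the equation to the modes \<open>\<bar>n\<bar> \<le> N\<close>;
  the term at \<open>n = 0\<close> contributes \<open>a t 0 / 0 = 0\<close>.\<close>

definition galerkin_solution :: "int \<Rightarrow> (int \<Rightarrow> complex) \<Rightarrow> (real \<Rightarrow> int \<Rightarrow> complex) \<Rightarrow> bool" where
  "galerkin_solution N a0 a \<longleftrightarrow>
     (\<forall>n. \<bar>n\<bar> \<le> N \<longrightarrow> a 0 n = a0 n) \<and>
     (\<forall>t\<ge>0. (\<forall>n. N < \<bar>n\<bar> \<longrightarrow> a t n = 0) \<and> a t 0 = 0 \<and> hermitian (a t)) \<and>
     (\<forall>t\<ge>0. \<forall>n\<in>{-N..N}. ((\<lambda>s. a s n) has_vector_derivative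
        burgers_term N (a t) n - a t n / of_int \<bar>n\<bar>) (at t within {0..}))"

text \<open>Quadratic homogeneity: clamping the argument multiplies the nonlinearity by a scalar, so
  the cubic form in the energy identity still vanishes.\<close>

lemma burgers_term_scaleR: "burgers_term N (\<lambda>n. c *\<^sub>R a n) n = of_real (c\<^sup>2) * burgers_term N a n"
  unfolding burgers_term_def sum_distrib_left
  by (intro sum.cong refl) (simp add: scaleR_conv_of_real power2_eq_square)

lemma burgers_term_hermitian:
  assumes "hermitian a" shows "burgers_term N a (- n) = cnj (burgers_term N a n)"
proof -
  have "(\<Sum>k\<in>{-N..N}. a k * a (- n - k)) = (\<Sum>k\<in>{-N..N}. cnj (a k) * cnj (a (n - k)))"
  proof (rule sum.reindex_bij_witness[of _ uminus uminus])
    fix k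
    have "a (- (n - - k)) = cnj (a (n - - k))" using assms unfolding hermitian_def by blast
    moreover have "- n - k = - (n - - k)" by simp
    ultimately have "a (- n - k) = cnj (a (n - - k))" by (simp only:)
    moreover have "a (- k) = cnj (a k)" using assms unfolding hermitian_def by blast
    ultimately show "cnj (a (- k)) * cnj (a (n - (- k))) = a k * a (- n - k)"
      by (simp only: complex_cnj_cnj)
  qed auto
  then show ?thesis by (simp add: burgers_term_def cnj_sum)
qed

lemma convolution_difference_bound:
  fixes a b :: "int \<Rightarrow> complex"
  assumes "\<And>n. cmod (a n) \<le> R" "\<And>n. cmod (b n) \<le> R" "\<And>n. cmod (a n - b n) \<le> d"
  shows "cmod (burgers_term N a n - burgers_term N b n) \<le> \<bar>of_int n\<bar> * (real (card {-N..N}) * (R * d))"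
proof -
  have d0: "0 \<le> d" using assms(3)[of 0] norm_ge_zero order.trans by blast
  have "cmod (a k * a (n - k) - b k * b (n - k)) \<le> R * d + R * d" for k
  proof -
    have "a k * a (n - k) - b k * b (n - k) = a k * (a (n - k) - b (n - k)) + b (n - k) * (a k - b k)"
      by (simp add: algebra_simps)
    also have "cmod \<dots> \<le> R * d + R * d"
      by (intro order.trans[OF norm_triangle_ineq] add_mono) (auto simp: norm_mult intro!: mult_mono assms order.trans[OF norm_ge_zero assms(1)])
    finally show ?thesis .
  qed
  then have "cmod (\<Sum>k\<in>{-N..N}. a k * a (n - k) - b k * b (n - k)) \<le> (\<Sum>k\<in>{-N..N}. 2 * (R * d))"
    by (intro sum_norm_le) simp
  then have "cmod (\<Sum>k\<in>{-N..N}. a k * a (n - k) - b k * b (n - k)) \<le> real (card {-N..N}) * (2 * (R * d))"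
    by (simp only: sum_constant)
  moreover have "burgers_term N a n - burgers_term N b n
      = - (\<i> * of_int n / 2) * (\<Sum>k\<in>{-N..N}. a k * a (n - k) - b k * b (n - k))"
    by (simp add: burgers_term_def sum_subtractf algebra_simps)
  ultimately have "cmod (burgers_term N a n - burgers_term N b n)
      \<le> \<bar>of_int n\<bar> / 2 * (real (card {-N..N}) * (2 * (R * d)))"
    using mult_left_mono[of "cmod (\<Sum>k\<in>{-N..N}. a k * a (n - k) - b k * b (n - k))"
        "real (card {-N..N}) * (2 * (R * d))" "\<bar>of_int n\<bar> / 2"]
    by (simp only: norm_mult norm_minus_cancel norm_divide) simp
  then show ?thesis by simp
qed

text \<open>The quadratic nonlinearity is made globally Lipschitz by a radial clamp, which leaves its direction
  and hence the conservation of energy intact, so that the clamp is never active. The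
  symmetrization built into the field keeps the coefficients Hermitian.\<close>

lemma galerkin_solution_exists:
  assumes N: "0 \<le> N" and herm: "hermitian a0" and zero: "a0 0 = 0"
  obtains a where "galerkin_solution N a0 a"
proof -
  let ?I = "{-N..N}"
  \<comment> \<open>Every coefficient is bounded by the l^2 norm, which will not exceed its initial
    value. The added 1 makes \<open>R\<close> positive also for zero data.\<close>
  define R where "R = 1 + sqrt (\<Sum>n\<in>?I. (cmod (a0 n))\<^sup>2)"
  have R: "0 < R" by (simp add: R_def sum_nonneg add_pos_nonneg)
  have discr: "continuous_on UNIV f" for f :: "int \<Rightarrow> complex"
    by (simp add: continuous_on_open_vimage open_discrete)
  have mk: "apply_bcontfun (Bcontfun (\<lambda>n. if n \<in> ?I then f n else 0)) n = (if n \<in> ?I then f n else 0)"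
    for f :: "int \<Rightarrow> complex" and n
  proof (subst Bcontfun_inverse)
    show "(\<lambda>n. if n \<in> ?I then f n else 0) \<in> bcontfun"
      by (rule bcontfun_normI[OF discr, of _ "\<Sum>n\<in>?I. cmod (f n)"]) (auto intro!: sum_nonneg member_le_sum[of _ ?I "\<lambda>n. cmod (f n)"])
  qed simp
  define sym where "sym x n = (apply_bcontfun x n + cnj (apply_bcontfun x (- n))) / 2" for x :: "int \<Rightarrow>\<^sub>C complex" and n
  \<comment> \<open>Only the quadratic term is clamped; the damping is linear and bounded
    already.\<close>
  define V where "V x n = burgers_term N (sym (radial_clamp R x)) n - sym x n / of_int \<bar>n\<bar>" for x n
  define F where "F x = Bcontfun (\<lambda>n. if n \<in> ?I then V x n else 0)" for x
  have F: "apply_bcontfun (F x) n = (if n \<in> ?I then V x n else 0)" for x n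
    by (simp only: F_def mk)
  have sym_diff: "sym x n - sym y n = sym (x - y) n" for x y n
    by (simp add: sym_def algebra_simps diff_divide_distrib add_divide_distrib)
  have sym_bound: "cmod (sym x n) \<le> norm x" for x n
  proof -
    have "cmod (apply_bcontfun x n + cnj (apply_bcontfun x (- n))) \<le> norm x + norm x"
      by (intro order.trans[OF norm_triangle_ineq] add_mono) (auto simp: norm_bounded)
    then show ?thesis by (simp add: sym_def norm_divide)
  qed
  have sym_herm: "hermitian (sym x)" for x
    by (simp add: hermitian_def sym_def add.commute)
  \<comment> \<open>The first summand is the Lipschitz constant of the clamped convolution, the
    final 1 that of the damping.\<close>
  define L where "L = real_of_int N * (real (card ?I) * (R * 2)) + 1"
  have L: "0 < L" using N R by (simp add: L_def add_nonneg_pos)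
  have lip: "norm (F x - F y) \<le> L * norm (x - y)" for x y
  proof (rule norm_bound)
    fix n
    show "norm (apply_bcontfun (F x - F y) n) \<le> L * norm (x - y)"
    proof (cases "n \<in> ?I")
      case True
      have 1: "cmod (burgers_term N (sym (radial_clamp R x)) n - burgers_term N (sym (radial_clamp R y)) n)
          \<le> \<bar>of_int n\<bar> * (real (card ?I) * (R * (2 * norm (x - y))))"
        using order.trans[OF sym_bound norm_radial_clamp_le[OF R]] order.trans[OF sym_bound radial_clamp_lipschitz[OF R]]
        by (intro convolution_difference_bound) (auto simp: sym_diff)
      also have "\<dots> \<le> of_int N * (real (card ?I) * (R * (2 * norm (x - y))))"
        using True R by (intro mult_right_mono) (auto simp: abs_le_iff)
      finally have 1: "cmod (burgers_term N (sym (radial_clamp R x)) n - burgers_term N (sym (radial_clamp R y)) n)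
          \<le> of_int N * (real (card ?I) * (R * 2)) * norm (x - y)" by (simp add: mult_ac)
      have 2: "cmod (sym (x - y) n / of_int \<bar>n\<bar>) \<le> norm (x - y)"
        by (rule order.trans[OF norm_divide_abs_int_le sym_bound])
      have "apply_bcontfun (F x - F y) n = (burgers_term N (sym (radial_clamp R x)) n - burgers_term N (sym (radial_clamp R y)) n)
          - sym (x - y) n / of_int \<bar>n\<bar>"
        using True unfolding sym_diff[symmetric] by (simp add: F V_def diff_divide_distrib)
      also have "cmod \<dots> \<le> of_int N * (real (card ?I) * (R * 2)) * norm (x - y) + norm (x - y)"
        using 1 2 norm_triangle_ineq4 by (meson add_mono order.trans)
      finally show ?thesis by (simp add: L_def algebra_simps)
    qed (use L in \<open>auto simp: F\<close>)
  qed
  define x0 where "x0 = Bcontfun (\<lambda>n. if n \<in> ?I then a0 n else 0)"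
  have x0: "apply_bcontfun x0 n = (if n \<in> ?I then a0 n else 0)" for n
    by (simp only: x0_def mk)
  obtain x where x_0: "x 0 = x0"
    and x_der: "\<And>t. 0 \<le> t \<Longrightarrow> (x has_vector_derivative F (x t)) (at t within {0..})"
    using lipschitz_ode_global_solution[of L F, OF L lip] by metis
  define a where "a t n = apply_bcontfun (x t) n" for t n
  have bl: "bounded_linear (\<lambda>x::int \<Rightarrow>\<^sub>C complex. apply_bcontfun x n)" for n
    by (rule bounded_linear_intro[of _ 1]) (auto simp: norm_bounded)
  have a_der: "((\<lambda>s. a s n) has_vector_derivative (if n \<in> ?I then V (x t) n else 0)) (at t within {0..})"
    if "0 \<le> t" for t n
    using bounded_linear.has_vector_derivative[OF bl x_der[OF that], of n] by (simp add: a_def F)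
  have const: "f t = f 0" if f: "\<And>t. 0 \<le> t \<Longrightarrow> (f has_vector_derivative 0) (at t within {0..})" and "0 \<le> t"
    for f :: "real \<Rightarrow> complex" and t
  proof -
    have "\<exists>c. \<forall>s\<in>{0..}. f s = c"
      using f by (intro has_derivative_zero_constant) (auto simp: has_vector_derivative_def)
    then show ?thesis using that(2) by (metis atLeast_iff order_refl)
  qed
  \<comment> \<open>\<open>V\<close> sees its argument only through \<open>sym\<close>, so its
    values are Hermitian for every \<open>x\<close>. Hence the defect
    \<open>a t (- n) - cnj (a t n)\<close> is constant in time and vanishes initially.\<close>
  have V_herm: "V x (- n) = cnj (V x n)" for x n
    using burgers_term_hermitian[OF sym_herm] sym_herm[of x] by (simp add: V_def hermitian_def)
  have a_herm: "a t (- n) = cnj (a t n)" if "0 \<le> t" for t n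
  proof -
    have "a t (- n) - cnj (a t n) = a 0 (- n) - cnj (a 0 n)"
    proof (rule const[OF _ that])
      fix t :: real assume t: "0 \<le> t"
      have "((\<lambda>s. a s (- n) - cnj (a s n)) has_vector_derivative
         (if - n \<in> ?I then V (x t) (- n) else 0) - cnj (if n \<in> ?I then V (x t) n else 0)) (at t within {0..})"
        by (intro has_vector_derivative_diff bounded_linear.has_vector_derivative[OF bounded_linear_cnj] a_der t)
      then show "((\<lambda>s. a s (- n) - cnj (a s n)) has_vector_derivative 0) (at t within {0..})"
        by (auto simp: V_herm split: if_splits)
    qed
    also have "\<dots> = 0" using herm by (auto simp: a_def x_0 x0 hermitian_def)
    finally show ?thesis by simp
  qed
  have a_supp: "a t n = 0" if "0 \<le> t" "n \<notin> ?I" for t n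
  proof -
    have "a t n = a 0 n"
      by (rule const[OF _ that(1)]) (use a_der[where n = n] that(2) in auto)
    also have "\<dots> = 0" using that(2) by (simp only: a_def x_0 x0 if_False)
    finally show ?thesis .
  qed
  have a_supp': "a t n = 0" if "0 \<le> t" "N < \<bar>n\<bar>" for t n
    using that by (intro a_supp) auto
  have a_zero: "a t 0 = 0" if "0 \<le> t" for t
  proof -
    have "a t 0 = a 0 0"
    proof (rule const[OF _ that])
      fix t :: real assume t: "0 \<le> t"
      show "((\<lambda>s. a s 0) has_vector_derivative 0) (at t within {0..})"
        using a_der[OF t, of 0] N by (simp add: V_def burgers_term_def)
    qed
    then show ?thesis using zero by (simp add: a_def x_0 x0)
  qed
  \<comment> \<open>The square comes from the quadratic homogeneity; \<open>c t = 1\<close> as long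
    as \<open>norm (x t) \<le> R\<close>.\<close>
  define c where "c t = (R / max R (norm (x t)))\<^sup>2" for t
  have sym_a: "sym (x t) = a t" if "0 \<le> t" for t
    using a_herm[OF that] by (auto simp: sym_def a_def fun_eq_iff)
  have V_a: "V (x t) n = of_real (c t) * burgers_term N (a t) n - a t n / of_int \<bar>n\<bar>" if "0 \<le> t" for t n
  proof -
    have "sym (radial_clamp R (x t)) = (\<lambda>n. (R / max R (norm (x t))) *\<^sub>R sym (x t) n)"
      by (rule ext) (simp add: sym_def radial_clamp_def scaleR_conv_of_real ring_distribs)
    then show ?thesis by (simp only: V_def sym_a[OF that] burgers_term_scaleR c_def)
  qed
  define y where "y t = (\<Sum>n\<in>?I. 1 * (cmod (a t n))\<^sup>2)" for t
  have y_der: "(y has_real_derivative - 2 * (\<Sum>n\<in>?I. 1 * ((cmod (a t n))\<^sup>2 / \<bar>of_int n\<bar>))) (at t within {0..})"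
    if t: "0 \<le> t" for t
  proof -
    have "(y has_real_derivative c t * (\<Sum>n\<in>?I. 1 * (2 * Re (cnj (a t n) * burgers_term N (a t) n)))
      - 2 * (\<Sum>n\<in>?I. 1 * ((cmod (a t n))\<^sup>2 / \<bar>of_int n\<bar>))) (at t within {0..})"
      unfolding y_def
    proof (rule energy_derivative)
      fix n assume "n \<in> ?I"
      then show "((\<lambda>s. a s n) has_vector_derivative of_real (c t) * burgers_term N (a t) n - a t n / of_int \<bar>n\<bar>)
          (at t within {0..})"
        using a_der[OF t, of n] by (simp only: V_a[OF t] if_True)
    qed
    moreover have "(\<Sum>n\<in>?I. 2 * Re (cnj (a t n) * burgers_term N (a t) n)) = 0"
      by (rule cubic_energy_zero) (use a_supp' a_herm t in blast)+
    ultimately show ?thesis by simp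
  qed
  have y_le: "y t \<le> y 0" if t: "0 \<le> t" for t
    by (rule nonincreasing_from_zero[OF y_der _ t]) (auto intro!: sum_nonneg)
  have norm_x: "norm (x t) \<le> R" if t: "0 \<le> t" for t
  proof (rule norm_bound)
    fix n
    show "norm (apply_bcontfun (x t) n) \<le> R"
    proof (cases "n \<in> ?I")
      case True
      have "(cmod (a t n))\<^sup>2 \<le> y t"
        using True by (auto simp: y_def intro!: member_le_sum[of n ?I "\<lambda>n. (cmod (a t n))\<^sup>2"])
      also have "\<dots> \<le> y 0" by (rule y_le[OF t])
      also have "y 0 = (\<Sum>n\<in>?I. (cmod (a0 n))\<^sup>2)"
        unfolding y_def by (intro sum.cong) (auto simp: a_def x_0 x0)
      finally have "cmod (a t n) \<le> sqrt (\<Sum>n\<in>?I. (cmod (a0 n))\<^sup>2)" by (rule real_le_rsqrt)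
      then show ?thesis by (simp add: a_def R_def)
    next
      case False
      then show ?thesis using a_supp[OF t, of n] R by (simp add: a_def)
    qed
  qed
  have "galerkin_solution N a0 a"
    unfolding galerkin_solution_def
  proof (intro conjI allI impI ballI)
    fix t :: real and n assume t: "0 \<le> t" and n: "n \<in> ?I"
    have "c t = 1" using norm_x[OF t] R by (simp add: c_def max_absorb1)
    then show "((\<lambda>s. a s n) has_vector_derivative burgers_term N (a t) n - a t n / of_int \<bar>n\<bar>) (at t within {0..})"
      using a_der[OF t, of n] V_a[OF t, of n] n by simp
  next
    show "a 0 n = a0 n" if "\<bar>n\<bar> \<le> N" for n using that by (auto simp: a_def x_0 x0)
  qed (auto simp: a_zero a_herm hermitian_def a_supp')
  then show ?thesis using that by blast
qed

section \<open>A priori bounds\<close>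

definition energy :: "int \<Rightarrow> (int \<Rightarrow> real) \<Rightarrow> (int \<Rightarrow> complex) \<Rightarrow> real" where
  "energy N G a = (\<Sum>n\<in>{-N..N}. G n * (cmod (a n))\<^sup>2)"

abbreviation sobolev_weight :: "real \<Rightarrow> int \<Rightarrow> real" where
  "sobolev_weight m n \<equiv> weight m (of_int n)"

lemma sobolev_weight_one: "sobolev_weight 1 n = of_int n ^ 8"
proof (cases "n = 0")
  case False
  then have "1 \<le> \<bar>real_of_int n\<bar>" by linarith
  then show ?thesis by (simp add: weight_def)
qed (simp add: weight_def)

text \<open>The mode n = 0 contributes 1/0 = 0. The sharper bound 4 - 2/N lets the induction
  telescope through 2/(N+1)^2 <= 2/N - 2/(N+1).\<close>

lemma sum_inverse_squares_le: "(\<Sum>n\<in>{-int N..int N}. 1 / (real_of_int n)\<^sup>2) \<le> (if N = 0 then 0 else 4 - 2 / real N)"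
proof (induction N)
  case (Suc N)
  have "{-int (Suc N)..int (Suc N)} = insert (int (Suc N)) (insert (- int (Suc N)) {-int N..int N})"
    by auto
  then have "(\<Sum>n\<in>{-int (Suc N)..int (Suc N)}. 1 / (real_of_int n)\<^sup>2)
      = 2 / (real N + 1)\<^sup>2 + (\<Sum>n\<in>{-int N..int N}. 1 / (real_of_int n)\<^sup>2)"
    by (simp add: add.commute power2_eq_square) (simp add: field_simps)
  also have "\<dots> \<le> 2 / (real N + 1)\<^sup>2 + (if N = 0 then 0 else 4 - 2 / real N)" using Suc by simp
  also have "\<dots> \<le> 4 - 2 / real (Suc N)"
  proof (cases "N = 0")
    case False
    have "2 / (real N + 1)\<^sup>2 \<le> 2 / (real N * (real N + 1))"
      using False by (intro divide_left_mono) (auto simp: power2_eq_square)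
    also have "\<dots> = 2 / real N - 2 / real (Suc N)" using False by (simp add: field_simps)
    finally show ?thesis using False by simp
  qed simp
  finally show ?case by simp
qed simp

lemma sum_inverse_squares_le_4:
  assumes "0 \<le> N" shows "(\<Sum>n\<in>{-N..N}. 1 / (real_of_int n)\<^sup>2) \<le> 4"
proof -
  have "(\<Sum>n\<in>{-N..N}. 1 / (real_of_int n)\<^sup>2) \<le> (if nat N = 0 then 0 else 4 - 2 / real (nat N))"
    using sum_inverse_squares_le[of "nat N"] assms by simp
  also have "\<dots> \<le> 4" by simp
  finally show ?thesis .
qed

lemma galerkin_energy_derivative:
  assumes g: "galerkin_solution N a0 a" and t: "0 \<le> t"
  shows "((\<lambda>s. energy N G (a s)) has_real_derivative
     (\<Sum>n\<in>{-N..N}. G n * (2 * Re (cnj (a t n) * burgers_term N (a t) n)))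
      - 2 * (\<Sum>n\<in>{-N..N}. G n * ((cmod (a t n))\<^sup>2 / \<bar>of_int n\<bar>))) (at t within {0..})"
proof -
  have "((\<lambda>s. energy N G (a s)) has_real_derivative
     1 * (\<Sum>n\<in>{-N..N}. G n * (2 * Re (cnj (a t n) * burgers_term N (a t) n)))
      - 2 * (\<Sum>n\<in>{-N..N}. G n * ((cmod (a t n))\<^sup>2 / \<bar>of_int n\<bar>))) (at t within {0..})"
    unfolding energy_def
    by (rule energy_derivative) (use assms in \<open>simp add: galerkin_solution_def\<close>)
  then show ?thesis by simp
qed

lemma galerkin_properties:
  assumes "galerkin_solution N a0 a" "0 \<le> t"
  shows "\<And>n. N < \<bar>n\<bar> \<Longrightarrow> a t n = 0" "a t 0 = 0" "\<And>n. a t (- n) = cnj (a t n)"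
  using assms by (auto simp: galerkin_solution_def hermitian_def)

lemma galerkin_initial_energy:
  "galerkin_solution N a0 a \<Longrightarrow> energy N G (a 0) = energy N G a0"
  unfolding energy_def galerkin_solution_def by (intro sum.cong) auto

lemma low_frequency_split:
  fixes n :: int and R :: real
  assumes "0 < R" "n \<noteq> 0" shows "1 \<le> R / \<bar>of_int n\<bar> + of_int n ^ 8 / R ^ 8"
proof (cases "\<bar>of_int n\<bar> \<le> R")
  case True
  with assms have "1 \<le> R / \<bar>of_int n\<bar>" by simp
  moreover have "0 \<le> of_int n ^ 8 / R ^ 8" using assms by simp
  ultimately show ?thesis by linarith
next
  case False
  then have "R ^ 8 \<le> \<bar>of_int n\<bar> ^ 8" using assms by (intro power_mono) auto
  then have "1 \<le> of_int n ^ 8 / R ^ 8" using assms by simp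
  moreover have "0 \<le> R / \<bar>of_int n\<bar>" using assms by simp
  ultimately show ?thesis by linarith
qed

text \<open>Low modes are damped at rate \<open>1 / \<bar>n\<bar>\<close> and high modes are controlled by the \<open>H\<^sup>4\<close> norm. Splitting
  at the growing frequency \<open>(1 + t) / 3\<close> yields algebraic decay; the constant is \<open>1 + 3\<^sup>9\<close>.\<close>

lemma galerkin_L2_decay:
  assumes g: "galerkin_solution N a0 a"
    and E: "\<And>s. 0 \<le> s \<Longrightarrow> s \<le> t \<Longrightarrow> energy N (sobolev_weight 1) (a s) \<le> M\<^sup>2" and t: "0 \<le> t"
  shows "energy N (\<lambda>_. 1) (a t) \<le> 19684 * M\<^sup>2 / (1 + t) ^ 6"
proof -
  let ?I = "{-N..N}"
  define y where "y s = energy N (\<lambda>_. 1) (a s)" for s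
  define D where "D s = (\<Sum>n\<in>?I. (cmod (a s n))\<^sup>2 / \<bar>of_int n\<bar>)" for s
  have y_der: "(y has_real_derivative - 2 * D s) (at s within {0..})" if "0 \<le> s" for s
    using galerkin_energy_derivative[OF g that, of "\<lambda>_. 1"]
      cubic_energy_zero[of N "a s", OF galerkin_properties(1)[OF g that] galerkin_properties(3)[OF g that]]
    by (simp add: y_def[abs_def] D_def)
  have D: "y s \<le> (1 + s) / 3 * D s + 3 ^ 8 / (1 + s) ^ 8 * M\<^sup>2" if s: "0 \<le> s" "s \<le> t" for s
  proof -
    define R where "R = (1 + s) / 3"
    have R: "0 < R" using s by (simp add: R_def)
    have "y s \<le> (\<Sum>n\<in>?I. R * ((cmod (a s n))\<^sup>2 / \<bar>of_int n\<bar>) + (sobolev_weight 1 n * (cmod (a s n))\<^sup>2) / R ^ 8)"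
      unfolding y_def energy_def
    proof (rule sum_mono)
      fix n
      show "1 * (cmod (a s n))\<^sup>2 \<le> R * ((cmod (a s n))\<^sup>2 / \<bar>of_int n\<bar>) + (sobolev_weight 1 n * (cmod (a s n))\<^sup>2) / R ^ 8"
      proof (cases "n = 0")
        case True
        then show ?thesis using galerkin_properties(2)[OF g s(1)] by simp
      next
        case False
        from mult_right_mono[OF low_frequency_split[OF R False], of "(cmod (a s n))\<^sup>2"]
        show ?thesis by (simp add: sobolev_weight_one algebra_simps)
      qed
    qed
    also have "\<dots> = R * D s + energy N (sobolev_weight 1) (a s) / R ^ 8"
      by (simp add: D_def energy_def sum.distrib sum_distrib_left sum_divide_distrib)
    also have "\<dots> \<le> R * D s + M\<^sup>2 / R ^ 8"
      using E[OF s] R by (intro add_left_mono divide_right_mono) auto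
    finally show ?thesis by (simp add: R_def power_divide)
  qed
  \<comment> \<open>With cutoff R = (1+s)/3 the damping rate 2/R equals 6/(1+s), which makes (1+s)^6
    the integrating factor. The high modes then contribute 2 * 3^9 * M^2 / (1+s)^3, and the second
    summand of \<open>f\<close> compensates exactly this.\<close>
  define f where "f s = (1 + s) ^ 6 * y s + 3 ^ 9 * M\<^sup>2 * inverse ((1 + s)\<^sup>2)" for s
  have "f t \<le> f 0"
  proof (rule nonincreasing_from_zero[OF _ _ t])
    fix s assume s: "0 \<le> s" "s \<le> t"
    let ?d = "6 * (1 + s) ^ 5 * y s + (1 + s) ^ 6 * (- 2 * D s) - 2 * 3 ^ 9 * M\<^sup>2 / (1 + s) ^ 3"
    have "((\<lambda>u. inverse (u\<^sup>2)) has_real_derivative - 2 / (s + 1) ^ 3) (at (s + 1))"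
    proof -
      have "((\<lambda>u. inverse (u\<^sup>2)) has_real_derivative - 2 / u ^ 3) (at u)" if "0 < u" for u :: real
        using that by (auto intro!: derivative_eq_intros simp: field_simps eval_nat_numeral)
      with s show ?thesis by simp
    qed
    moreover define q where "q s = inverse ((1 + s)\<^sup>2)" for s :: real
    ultimately have "(q has_real_derivative - 2 / (1 + s) ^ 3) (at s within {0..})"
      unfolding DERIV_shift q_def[abs_def] by (simp add: add.commute has_field_derivative_at_within)
    then show "(f has_real_derivative ?d) (at s within {0..})"
      unfolding f_def q_def[symmetric] using s
      by (auto intro!: derivative_eq_intros y_der simp: algebra_simps)
    have "6 * (1 + s) ^ 5 * y s \<le> 6 * (1 + s) ^ 5 * ((1 + s) / 3 * D s + 3 ^ 8 / (1 + s) ^ 8 * M\<^sup>2)"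
      using D[OF s] s by (intro mult_left_mono) auto
    also have "\<dots> = 2 * (1 + s) ^ 6 * D s + 2 * 3 ^ 9 * M\<^sup>2 / (1 + s) ^ 3"
    proof -
      have "6 * u ^ 5 * (u / 3 * x + 3 ^ 8 / u ^ 8 * m) = 2 * u ^ 6 * x + 2 * 3 ^ 9 * m / u ^ 3"
        if "0 < u" for u x m :: real
        using that by (simp add: field_simps eval_nat_numeral)
      from this[of "1 + s" "D s" "M\<^sup>2"] s show ?thesis by simp
    qed
    finally show "?d \<le> 0" by simp
  qed
  moreover have "y 0 \<le> energy N (sobolev_weight 1) (a 0)"
    unfolding y_def energy_def
  proof (rule sum_mono)
    fix n
    show "1 * (cmod (a 0 n))\<^sup>2 \<le> sobolev_weight 1 n * (cmod (a 0 n))\<^sup>2"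
    proof (cases "n = 0")
      case True
      then show ?thesis using galerkin_properties(2)[OF g order_refl] by simp
    next
      case False
      then have "1 \<le> \<bar>real_of_int n\<bar>" by linarith
      then have "1 \<le> sobolev_weight 1 n"
        using one_le_power[of "\<bar>real_of_int n\<bar>" 8] by (simp add: sobolev_weight_one)
      then show ?thesis by (intro mult_right_mono) auto
    qed
  qed
  moreover have "energy N (sobolev_weight 1) (a 0) \<le> M\<^sup>2" using E[of 0] t by simp
  moreover have "(1 + t) ^ 6 * y t \<le> f t" "f 0 = y 0 + 19683 * M\<^sup>2" by (simp_all add: f_def)
  ultimately have "(1 + t) ^ 6 * y t \<le> 19684 * M\<^sup>2" by linarith
  then show ?thesis using t by (simp add: y_def pos_le_divide_eq mult.commute)
qed

text \<open>Two interpolations, each as Young's inequality with a tuned parameter: n^4 between 1 and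
  n^8, then |n| |a n| as the product of 1/|n| and n^2 |a n|, where the sum of 1/n^2 is at most
  4.\<close>

lemma galerkin_wiener_decay:
  assumes g: "galerkin_solution N a0 a" and N: "0 \<le> N" and M: "0 < M"
    and E: "\<And>s. 0 \<le> s \<Longrightarrow> s \<le> t \<Longrightarrow> energy N (sobolev_weight 1) (a s) \<le> M\<^sup>2" and t: "0 \<le> t"
  shows "(\<Sum>n\<in>{-N..N}. \<bar>of_int n\<bar> * cmod (a t n)) \<le> 5000 * M * (1 + t) powr (- 3 / 2)"
proof -
  let ?I = "{-N..N}"
  \<comment> \<open>Balances the L^2 energy of order (1+t)^(-6) against the merely bounded H^4
    energy.\<close>
  define L where "L = (1 + t) ^ 3"
  have L: "0 < L" using t by (simp add: L_def)
  \<comment> \<open>The expected size of the Wiener norm, used as the parameter of the second Young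
    inequality so that both of its terms are multiples of \<open>d\<close>.\<close>
  define d where "d = M * (1 + t) powr (- 3 / 2)"
  have d: "0 < d" using M t by (simp add: d_def)
  have "((1 + t) powr (- 3 / 2))\<^sup>2 = (1 + t) powr (- 3)"
    using t by (simp add: power2_eq_square flip: powr_add)
  also have "\<dots> = 1 / L" using t unfolding L_def by (simp add: powr_minus powr_numeral divide_inverse)
  finally have d2: "d\<^sup>2 = M\<^sup>2 / L" by (simp add: d_def power_mult_distrib)
  have "(\<Sum>n\<in>?I. of_int n ^ 4 * (cmod (a t n))\<^sup>2)
      \<le> (\<Sum>n\<in>?I. L / 2 * (1 * (cmod (a t n))\<^sup>2) + 1 / (2 * L) * (sobolev_weight 1 n * (cmod (a t n))\<^sup>2))"
  proof (rule sum_mono)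
    fix n :: int
    have "0 \<le> (of_int n ^ 4 - L)\<^sup>2 / (2 * L)" using L by simp
    then have "of_int n ^ 4 \<le> L / 2 + of_int n ^ 8 / (2 * L)"
      using L by (simp add: power2_eq_square field_simps)
    from mult_right_mono[OF this, of "(cmod (a t n))\<^sup>2"]
    show "of_int n ^ 4 * (cmod (a t n))\<^sup>2 \<le> L / 2 * (1 * (cmod (a t n))\<^sup>2) + 1 / (2 * L) * (sobolev_weight 1 n * (cmod (a t n))\<^sup>2)"
      by (simp add: sobolev_weight_one algebra_simps)
  qed
  also have "\<dots> = L / 2 * energy N (\<lambda>_. 1) (a t) + 1 / (2 * L) * energy N (sobolev_weight 1) (a t)"
    unfolding energy_def sum_distrib_left sum.distrib ..
  also have "\<dots> \<le> L / 2 * (19684 * M\<^sup>2 / (1 + t) ^ 6) + 1 / (2 * L) * M\<^sup>2"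
    using galerkin_L2_decay[OF g E t] E[OF t order_refl] L by (intro add_mono mult_left_mono) auto
  also have "(1 + t) ^ 6 = L * L" by (simp add: L_def flip: power_add)
  also have "L / 2 * (19684 * M\<^sup>2 / (L * L)) + 1 / (2 * L) * M\<^sup>2 = 19685 / 2 * d\<^sup>2"
    using L by (simp add: d2 field_simps)
  finally have X2: "(\<Sum>n\<in>?I. of_int n ^ 4 * (cmod (a t n))\<^sup>2) \<le> 19685 / 2 * d\<^sup>2" .
  have "(\<Sum>n\<in>?I. \<bar>of_int n\<bar> * cmod (a t n))
      \<le> (\<Sum>n\<in>?I. d / 2 * (1 / (of_int n)\<^sup>2) + 1 / (2 * d) * (of_int n ^ 4 * (cmod (a t n))\<^sup>2))"
  proof (rule sum_mono)
    fix n :: int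
    show "\<bar>of_int n\<bar> * cmod (a t n) \<le> d / 2 * (1 / (of_int n)\<^sup>2) + 1 / (2 * d) * (of_int n ^ 4 * (cmod (a t n))\<^sup>2)"
    proof (cases "n = 0")
      case False
      define k where "k = \<bar>real_of_int n\<bar>"
      have k: "0 < k" "k\<^sup>2 = (of_int n)\<^sup>2" "k ^ 4 = of_int n ^ 4" using False by (auto simp: k_def)
      have "0 \<le> (d / k - k\<^sup>2 * cmod (a t n))\<^sup>2 / (2 * d)" using d by simp
      also have "\<dots> = d / 2 * (1 / k\<^sup>2) + 1 / (2 * d) * (k ^ 4 * (cmod (a t n))\<^sup>2) - k * cmod (a t n)"
        using d k(1) by (simp add: field_simps power2_eq_square eval_nat_numeral)
      finally show ?thesis unfolding k(2,3)[symmetric] k_def[symmetric] by simp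
    qed simp
  qed
  also have "\<dots> = d / 2 * (\<Sum>n\<in>?I. 1 / (of_int n)\<^sup>2) + 1 / (2 * d) * (\<Sum>n\<in>?I. of_int n ^ 4 * (cmod (a t n))\<^sup>2)"
    unfolding sum_distrib_left sum.distrib ..
  also have "\<dots> \<le> d / 2 * 4 + 1 / (2 * d) * (19685 / 2 * d\<^sup>2)"
    using sum_inverse_squares_le_4[OF N] X2 d by (intro add_mono mult_left_mono) auto
  \<comment> \<open>The exact constant is 2 + 19685/4 = 4923.25.\<close>
  also have "\<dots> \<le> 5000 * d" using d by (simp add: power2_eq_square field_simps)
  finally show ?thesis by (simp add: d_def)
qed

text \<open>The smallness of \<open>M\<close> makes the Gronwall factor at most \<open>2\<close>, which closes the bootstrap below.\<close>

lemma galerkin_weighted_energy_bound: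
  assumes g: "galerkin_solution N a0 a" and N: "0 \<le> N" and M: "0 < M" "M \<le> 1 / 10 ^ 8" and m: "0 < m"
    and E: "\<And>s. 0 \<le> s \<Longrightarrow> s \<le> t \<Longrightarrow> energy N (sobolev_weight 1) (a s) \<le> M\<^sup>2" and t: "0 \<le> t"
  shows "energy N (sobolev_weight m) (a t) \<le> 2 * energy N (sobolev_weight m) a0"
proof -
  let ?I = "{-N..N}"
  \<comment> \<open>The constant of the cubic bound times that of the Wiener decay; for M <= 10^(-8)
    it is about 0.05.\<close>
  define K where "K = 1023 * 5000 * M"
  have K: "0 < K" "K \<le> 1 / 4" using M by (simp_all add: K_def)
  define e where "e s = energy N (sobolev_weight m) (a s)" for s
  have e0: "0 \<le> e s" for s
    unfolding e_def energy_def using weight_nonneg[OF m] by (intro sum_nonneg) auto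
  define e' where "e' s = (\<Sum>n\<in>?I. sobolev_weight m n * (2 * Re (cnj (a s n) * burgers_term N (a s) n)))
      - 2 * (\<Sum>n\<in>?I. sobolev_weight m n * ((cmod (a s n))\<^sup>2 / \<bar>of_int n\<bar>))" for s
  have e_der: "(e has_real_derivative e' s) (at s within {0..})" if "0 \<le> s" for s
    unfolding e_def e'_def by (rule galerkin_energy_derivative[OF g that])
  have e'_le: "e' s \<le> K * (1 + s) powr (- 3 / 2) * e s" if s: "0 \<le> s" "s \<le> t" for s
  proof -
    have "0 \<le> (\<Sum>n\<in>?I. sobolev_weight m n * ((cmod (a s n))\<^sup>2 / \<bar>of_int n\<bar>))"
      using weight_nonneg[OF m] by (intro sum_nonneg) auto
    then have "e' s \<le> \<bar>\<Sum>n\<in>?I. sobolev_weight m n * (2 * Re (cnj (a s n) * burgers_term N (a s) n))\<bar>"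
      unfolding e'_def by linarith
    also have "\<dots> \<le> 1023 * (\<Sum>n\<in>?I. \<bar>of_int n\<bar> * cmod (a s n)) * e s"
      unfolding e_def energy_def
      using cubic_energy_bound[of m N "a s"] m galerkin_properties(1,3)[OF g s(1)] by blast
    also have "\<dots> \<le> 1023 * (5000 * M * (1 + s) powr (- 3 / 2)) * e s"
      using galerkin_wiener_decay[OF g N M(1) E s(1)] s e0 by (intro mult_right_mono mult_left_mono) auto
    finally show ?thesis by (simp add: K_def mult_ac)
  qed
  \<comment> \<open>The exponent is a primitive of -K (1+s)^(-3/2), so \<open>f\<close> absorbs the
    growth of \<open>e\<close>. The factor is at least 1 at all times and starts at exp(2 K) <=
    exp(1/2) <= 2.\<close>
  define f where "f s = e s * exp (2 * K * (1 + s) powr (- 1 / 2))" for s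
  have "f t \<le> f 0"
  proof (rule nonincreasing_from_zero[OF _ _ t])
    fix s assume s: "0 \<le> s" "s \<le> t"
    let ?d = "(e' s - K * (1 + s) powr (- 3 / 2) * e s) * exp (2 * K * (1 + s) powr (- 1 / 2))"
    have "((\<lambda>s. (1 + s) powr (- 1 / 2)) has_real_derivative (- 1 / 2) * (1 + s) powr (- 3 / 2)) (at s within {0..})"
      using s by (auto intro!: derivative_eq_intros)
    then show "(f has_real_derivative ?d) (at s within {0..})"
      unfolding f_def using s
      by (auto intro!: derivative_eq_intros e_der simp: algebra_simps)
    show "?d \<le> 0" using e'_le[OF s] by (intro mult_nonpos_nonneg) auto
  qed
  moreover have "e t \<le> f t"
    unfolding f_def using mult_left_mono[of 1 "exp (2 * K * (1 + t) powr (- 1 / 2))" "e t"] e0 K by simp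
  moreover have "f 0 \<le> 2 * e 0"
  proof -
    have "exp (2 * K) \<le> exp (1 / 2)" using K by simp
    also have "exp (1 / 2 :: real) \<le> 2"
      using exp_bound_half[of "1/2 :: real"] by simp
    finally show ?thesis using mult_left_mono[OF _ e0[of 0]] by (fastforce simp: f_def mult.commute)
  qed
  ultimately show ?thesis
    unfolding e_def galerkin_initial_energy[OF g] by linarith
qed

text \<open>Bootstrap: at the first time when the energy reaches M^2 the weighted bound applies with
  m = 1 and gives at most 2 * M^2/4 < M^2, a contradiction.\<close>

lemma galerkin_sobolev_bound:
  assumes g: "galerkin_solution N a0 a" and N: "0 \<le> N" and M: "0 < M" "M \<le> 1 / 10 ^ 8"
    and init: "energy N (sobolev_weight 1) a0 \<le> M\<^sup>2 / 4" and t: "0 \<le> t"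
  shows "energy N (sobolev_weight 1) (a t) \<le> M\<^sup>2"
proof (rule ccontr)
  define e where "e s = energy N (sobolev_weight 1) (a s)" for s
  assume "\<not> ?thesis"
  then have et: "M\<^sup>2 < e t" by (simp add: e_def)
  have e0: "e 0 < M\<^sup>2"
  proof -
    have "0 < M\<^sup>2" using M by simp
    with init show ?thesis unfolding e_def galerkin_initial_energy[OF g] by linarith
  qed
  have cont: "continuous_on {0..t} e"
    unfolding continuous_on_eq_continuous_within e_def
    by (intro ballI DERIV_continuous[OF DERIV_subset[OF galerkin_energy_derivative[OF g]]]) auto
  define S where "S = {s\<in>{0..t}. e s = M\<^sup>2}"
  have "\<exists>x\<ge>0. x \<le> t \<and> e x = M\<^sup>2"
    by (rule IVT') (use e0 et t cont in auto)
  then have "S \<noteq> {}" by (auto simp: S_def)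
  moreover have "compact S"
  proof -
    have "closed S" unfolding S_def
      by (rule continuous_closed_preimage_constant[OF cont]) auto
    then have "compact ({0..t} \<inter> S)" by (intro compact_Int_closed) auto
    moreover have "{0..t} \<inter> S = S" by (auto simp: S_def)
    ultimately show ?thesis by simp
  qed
  ultimately obtain s0 where s0: "s0 \<in> S" "\<And>s. s \<in> S \<Longrightarrow> s0 \<le> s"
    by (metis compact_attains_inf)
  \<comment> \<open>Exceeding M^2 before \<open>s0\<close> would force a crossing of that level
    earlier still, by the intermediate value theorem.\<close>
  have le: "e s \<le> M\<^sup>2" if s: "0 \<le> s" "s \<le> s0" for s
  proof (rule ccontr)
    assume *: "\<not> ?thesis"
    have "continuous_on {0..s} e" using s s0(1) by (intro continuous_on_subset[OF cont]) (auto simp: S_def)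
    then have "\<exists>x\<ge>0. x \<le> s \<and> e x = M\<^sup>2" by (intro IVT') (use * e0 s in auto)
    then obtain x where x: "0 \<le> x" "x \<le> s" "e x = M\<^sup>2" by blast
    with s s0(1) have "x \<in> S" by (auto simp: S_def)
    with s0(2) x(2) s have "x = s" by force
    with x(3) * show False by simp
  qed
  have "e s0 \<le> 2 * energy N (sobolev_weight 1) a0"
    unfolding e_def
    by (rule galerkin_weighted_energy_bound[OF g N M]) (use le s0 in \<open>auto simp: e_def S_def\<close>)
  also have "\<dots> < M\<^sup>2"
  proof -
    have "0 < M\<^sup>2" using M by simp
    with init show ?thesis by linarith
  qed
  finally show False using s0(1) by (simp add: S_def)
qed

section \<open>Passage to the limit\<close>

no_notation Infinite_Set_Sum.abs_summable_on (infix \<open>abs'_summable'_on\<close> 50)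

lemma abs_summable_int_inverse_square: "(\<lambda>n::int. 1 / (real_of_int n)\<^sup>2) abs_summable_on UNIV"
  unfolding abs_summable_iff_bdd_above
proof (rule bdd_aboveI2)
  fix F :: "int set" assume "F \<in> {F. F \<subseteq> UNIV \<and> finite F}"
  then have F: "finite F" by simp
  define N where "N = Max (insert 0 (abs ` F))"
  have N: "0 \<le> N" "\<And>n. n \<in> F \<Longrightarrow> \<bar>n\<bar> \<le> N" using F by (auto simp: N_def)
  have "(\<Sum>n\<in>F. norm (1 / (real_of_int n)\<^sup>2)) \<le> (\<Sum>n\<in>{-N..N}. 1 / (real_of_int n)\<^sup>2)"
    using N(2) by (auto intro!: sum_mono2 simp: abs_le_iff minus_le_iff)
  also have "\<dots> \<le> 4" by (rule sum_inverse_squares_le_4[OF N(1)])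
  finally show "(\<Sum>n\<in>F. norm (1 / (real_of_int n)\<^sup>2)) \<le> 4" .
qed

lemma bij_int_decode: "bij int_decode"
  by (simp add: bij_def inj_int_decode surj_int_decode)

text \<open>Enumerating the integers makes theorems on series over the naturals available: Tannery's
  theorem, the Weierstrass M-test and termwise integration.\<close>

lemma sums_int_decode:
  fixes f :: "int \<Rightarrow> 'a::banach"
  assumes "f abs_summable_on UNIV"
  shows "(\<lambda>j. f (int_decode j)) sums infsum f UNIV" "summable (\<lambda>j. norm (f (int_decode j)))"
proof -
  have "(f has_sum infsum f UNIV) UNIV" by (rule has_sum_infsum[OF abs_summable_summable[OF assms]])
  then show "(\<lambda>j. f (int_decode j)) sums infsum f UNIV"
    by (intro has_sum_imp_sums) (simp add: has_sum_reindex_bij_betw[OF bij_int_decode])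
  have "((\<lambda>n. norm (f n)) has_sum infsum (\<lambda>n. norm (f n)) UNIV) UNIV" by (rule has_sum_infsum[OF assms])
  then have "(\<lambda>j. norm (f (int_decode j))) sums infsum (\<lambda>n. norm (f n)) UNIV"
    by (intro has_sum_imp_sums) (simp add: has_sum_reindex_bij_betw[OF bij_int_decode, of "\<lambda>n. norm (f n)"])
  then show "summable (\<lambda>j. norm (f (int_decode j)))" by (simp add: sums_iff)
qed

lemma infsum_int_decode:
  fixes f :: "int \<Rightarrow> 'a::banach"
  assumes "f abs_summable_on UNIV" shows "infsum f UNIV = (\<Sum>j. f (int_decode j))"
  using sums_int_decode(1)[OF assms] by (simp add: sums_iff)

lemma tendsto_infsum_dominated:
  fixes f :: "'b \<Rightarrow> int \<Rightarrow> 'a::{real_normed_algebra, banach}"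
  assumes lim: "\<And>k. ((\<lambda>j. f j k) \<longlongrightarrow> y k) F" and bound: "\<And>j k. norm (f j k) \<le> b k"
    and b: "b abs_summable_on UNIV" and F: "F \<noteq> bot"
  shows "((\<lambda>j. infsum (f j) UNIV) \<longlongrightarrow> infsum y UNIV) F"
proof -
  have fb: "f j abs_summable_on UNIV" for j
    by (intro Infinite_Sum.abs_summable_on_comparison_test[OF b] order.trans[OF bound]) simp
  have "norm (y k) \<le> b k" for k
    by (rule tendsto_upperbound[OF tendsto_norm[OF lim]]) (auto simp: bound F)
  then have yb: "y abs_summable_on UNIV"
    by (intro Infinite_Sum.abs_summable_on_comparison_test[OF b] order.trans[OF \<open>norm (y _) \<le> b _\<close>]) simp
  have b0: "0 \<le> b k" for k using bound norm_ge_zero order.trans by blast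
  have "((\<lambda>j. \<Sum>k. f j (int_decode k)) \<longlongrightarrow> (\<Sum>k. y (int_decode k))) F"
    using tannerys_theorem[where F = F and a = "\<lambda>k j. f j (int_decode k)" and b = "\<lambda>k. y (int_decode k)"
        and M = "\<lambda>k. b (int_decode k)"] lim bound F sums_int_decode(2)[OF b] b0
    by (simp add: always_eventually case_prod_beta)
  then show ?thesis by (simp add: infsum_int_decode fb yb)
qed

lemma abs_summable_of_inverse_square_bound:
  assumes "\<And>n::int. norm (f n) \<le> C * (1 / (real_of_int n)\<^sup>2)"
  shows "f abs_summable_on UNIV"
proof (rule Infinite_Sum.abs_summable_on_comparison_test)
  show "(\<lambda>n::int. C * (1 / (real_of_int n)\<^sup>2)) abs_summable_on UNIV"
    using summable_on_cmult_right[OF abs_summable_int_inverse_square, of "\<bar>C\<bar>"] by (simp add: abs_mult)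
  show "norm (f n) \<le> norm (C * (1 / (real_of_int n)\<^sup>2))" for n
    unfolding real_norm_def by (rule order.trans[OF assms abs_ge_self])
qed

definition convolution :: "(int \<Rightarrow> complex) \<Rightarrow> int \<Rightarrow> complex" where
  "convolution a n = (\<Sum>\<^sub>\<infinity>k. a k * a (n - k))"

text \<open>At n = 0 the quotients are 0. For the same reason a bound
  \<open>M / \<bar>of_int n\<bar> ^ 4\<close> on coefficients also says that the mean
  vanishes.\<close>

lemma inverse_fourth_le:
  "1 / \<bar>of_int n :: real\<bar> ^ 4 \<le> 1 / (of_int n)\<^sup>2" "1 / \<bar>of_int n :: real\<bar> ^ 4 \<le> 1"
proof -
  have "1 \<le> \<bar>real_of_int n\<bar>" if "n \<noteq> 0" using that by linarith
  then show "1 / \<bar>of_int n :: real\<bar> ^ 4 \<le> 1 / (of_int n)\<^sup>2"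
    using power_increasing[of 2 4 "\<bar>real_of_int n\<bar>"] by (cases "n = 0") (auto intro!: divide_left_mono)
  show "1 / \<bar>of_int n :: real\<bar> ^ 4 \<le> 1"
    using one_le_power[of "\<bar>real_of_int n\<bar>" 4] \<open>n \<noteq> 0 \<Longrightarrow> 1 \<le> \<bar>real_of_int n\<bar>\<close> by (cases "n = 0") auto
qed

lemma divide_fourth_le: "0 \<le> M \<Longrightarrow> M / \<bar>of_int n :: real\<bar> ^ 4 \<le> M"
  using mult_left_mono[OF inverse_fourth_le(2)[of n], of M] by simp

lemma abs_summable_inverse_square_mult: "(\<lambda>n::int. c * (1 / (real_of_int n)\<^sup>2)) abs_summable_on UNIV"
  using abs_summable_of_inverse_square_bound[of "\<lambda>n. \<bar>c\<bar> * (1 / (real_of_int n)\<^sup>2)" "\<bar>c\<bar>"] by (simp add: abs_mult)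

lemma convolution_terms_bound:
  assumes M: "0 \<le> M" and b: "\<And>k. cmod (a k) \<le> M / \<bar>of_int k\<bar> ^ 4"
  shows "cmod (a k * a (n - k)) \<le> M * M * (1 / (of_int k)\<^sup>2)"
proof -
  have "cmod (a k * a (n - k)) \<le> (M / \<bar>of_int k\<bar> ^ 4) * (M / \<bar>of_int (n - k)\<bar> ^ 4)"
    unfolding norm_mult by (intro mult_mono b) (auto simp: M)
  also have "\<dots> = M * M * ((1 / \<bar>of_int k\<bar> ^ 4) * (1 / \<bar>of_int (n - k)\<bar> ^ 4))" by simp
  also have "\<dots> \<le> M * M * ((1 / (of_int k)\<^sup>2) * 1)"
    by (intro mult_left_mono mult_mono inverse_fourth_le) (auto simp: M)
  finally show ?thesis by simp
qed

lemma tendsto_convolution: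
  assumes "\<And>k. ((\<lambda>j. x j k) \<longlongrightarrow> y k) F" "\<And>j k. cmod (x j k) \<le> M / \<bar>of_int k\<bar> ^ 4" "0 \<le> M" "F \<noteq> bot"
  shows "((\<lambda>j. convolution (x j) n) \<longlongrightarrow> convolution y n) F"
  unfolding convolution_def
  by (rule tendsto_infsum_dominated[where b = "\<lambda>k. M * M * (1 / (of_int k)\<^sup>2)"])
     (intro tendsto_mult assms(1) convolution_terms_bound[OF assms(3,2)] assms(4)
        abs_summable_inverse_square_mult)+

text \<open>Arzela-Ascoli for each mode: a diagonal subsequence converges at all pairs of a rational
  time and a mode, and the Lipschitz bound, uniform in the truncation, carries this to every
  time.\<close>

lemma equilipschitz_subsequence:
  fixes f :: "nat \<Rightarrow> real \<Rightarrow> int \<Rightarrow> complex"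
  assumes bound: "\<And>N t n. 0 \<le> t \<Longrightarrow> cmod (f N t n) \<le> M"
    and lip: "\<And>N s t n. 0 \<le> s \<Longrightarrow> 0 \<le> t \<Longrightarrow> cmod (f N s n - f N t n) \<le> K n * \<bar>s - t\<bar>"
  obtains k where "strict_mono (k :: nat \<Rightarrow> nat)" "\<And>t n. 0 \<le> t \<Longrightarrow> convergent (\<lambda>j. f (k j) t n)"
proof -
  define S where "S = {(q :: real, n :: int). q \<in> \<rat> \<and> 0 \<le> q}"
  have "countable S"
    by (rule countable_subset[of _ "\<rat> \<times> UNIV"]) (auto simp: S_def intro: countable_rat)
  then obtain k where k: "strict_mono k" "\<And>x. x \<in> S \<Longrightarrow> \<exists>l. (\<lambda>j. f (k j) (fst x) (snd x)) \<longlonglongrightarrow> l"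
    by (rule function_convergent_subsequence[of S "\<lambda>N x. f N (fst x) (snd x)" M])
       (auto simp: S_def bound)
  have "convergent (\<lambda>j. f (k j) t n)" if t: "0 \<le> t" for t n
  proof -
    have K0: "0 \<le> K n" using lip[of 0 1 0 n] by (simp add: order.trans[OF norm_ge_zero])
    have "Cauchy (\<lambda>j. f (k j) t n)"
    proof (rule metric_CauchyI)
      fix e :: real assume e: "0 < e"
      \<comment> \<open>The added 1 covers the case K n = 0.\<close>
      define d where "d = e / 3 / (K n + 1)"
      have d: "0 < d" using e K0 by (simp add: d_def)
      obtain q where q: "q \<in> \<rat>" "t < q" "q < t + d" using Rats_dense_in_real[of t "t + d"] d by auto
      have close: "cmod (f N t n - f N q n) < e / 3" for N
      proof -
        have "cmod (f N t n - f N q n) \<le> K n * \<bar>t - q\<bar>" by (rule lip) (use t q in auto)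
        also have "\<dots> \<le> K n * d" using q K0 by (intro mult_left_mono) auto
        also have "\<dots> < (K n + 1) * d" using d by simp
        also have "\<dots> = e / 3"
        proof -
          have "K n + 1 \<noteq> 0" using K0 by linarith
          then show ?thesis unfolding d_def by (metis nonzero_mult_div_cancel_left times_divide_eq_right)
        qed
        finally show ?thesis .
      qed
      have "(q, n) \<in> S" using q t by (simp add: S_def)
      from k(2)[OF this] have "Cauchy (\<lambda>j. f (k j) q n)"
        by (auto intro: convergent_Cauchy convergentI)
      then obtain J where J: "\<And>i j. J \<le> i \<Longrightarrow> J \<le> j \<Longrightarrow> dist (f (k i) q n) (f (k j) q n) < e / 3"
        using e by (meson divide_pos_pos metric_CauchyD zero_less_numeral)
      show "\<exists>J. \<forall>i\<ge>J. \<forall>j\<ge>J. dist (f (k i) t n) (f (k j) t n) < e"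
      proof (intro exI allI impI)
        fix i j assume "J \<le> i" "J \<le> j"
        then have "dist (f (k i) q n) (f (k j) q n) < e / 3" by (rule J)
        moreover have "dist (f (k i) t n) (f (k i) q n) < e / 3" "dist (f (k j) t n) (f (k j) q n) < e / 3"
          using close by (simp_all add: dist_norm)
        ultimately show "dist (f (k i) t n) (f (k j) t n) < e"
          using dist_triangle_third[of "f (k i) t n" "f (k i) q n" e "f (k j) q n" "f (k j) t n"]
          by (simp add: dist_commute)
      qed
    qed
    then show ?thesis by (simp add: Cauchy_convergent_iff)
  qed
  with k(1) that show ?thesis by blast
qed

lemma sum_support_le:
  fixes h :: "int \<Rightarrow> real"
  assumes "finite F" "\<And>n. 0 \<le> h n" "\<And>n. N < \<bar>n\<bar> \<Longrightarrow> h n = 0"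
  shows "sum h F \<le> sum h {-N..N}"
proof -
  have "h n = 0" if "n \<notin> {-N..N}" for n using that by (intro assms(3)) auto
  then have "sum h F = sum h (F \<inter> {-N..N})"
    using assms(1) by (intro sum.mono_neutral_right) auto
  also have "\<dots> \<le> sum h {-N..N}" using assms by (intro sum_mono2) auto
  finally show ?thesis .
qed

text \<open>For large \<open>m\<close> the ramp is small on any fixed finite set of modes, while
  outside a suitable set the total mass of \<open>h\<close> is small. The resulting bound is uniform
  over all finite \<open>F\<close>.\<close>

lemma weighted_tail_small:
  fixes h :: "int \<Rightarrow> real"
  assumes h: "\<And>n. 0 \<le> h n" and bdd: "\<And>F. finite F \<Longrightarrow> sum h F \<le> B" and e: "0 < e"
  obtains m :: real where "1 \<le> m" "\<And>F. finite F \<Longrightarrow> (\<Sum>n\<in>F. min 1 (\<bar>of_int n\<bar> / m) * h n) \<le> e"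
proof -
  have B: "0 \<le> B" using bdd[of "{}"] by simp
  have "h summable_on UNIV"
    using h bdd by (intro nonneg_bdd_above_summable_on) (auto simp: bdd_above_def)
  then obtain F0 where F0: "finite F0" "dist (sum h F0) (infsum h UNIV) \<le> e / 2"
    using infsum_finite_approximation[of h UNIV "e / 2"] e by auto
  have tail: "sum h F \<le> e / 2" if "finite F" "F \<inter> F0 = {}" for F
  proof -
    have "sum h F + sum h F0 = sum h (F \<union> F0)" using that F0 by (simp add: sum.union_disjoint)
    also have "\<dots> \<le> infsum h UNIV"
      using that F0 h \<open>h summable_on UNIV\<close> by (intro finite_sum_le_infsum) auto
    also have "\<dots> \<le> sum h F0 + e / 2" using F0(2) unfolding dist_real_def by linarith
    finally show ?thesis by simp
  qed
  define R where "R = real_of_int (Max (insert 0 (abs ` F0)))"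
  have "\<bar>n\<bar> \<le> Max (insert 0 (abs ` F0))" if "n \<in> F0" for n using F0 that by simp
  then have R: "\<bar>of_int n\<bar> \<le> R" if "n \<in> F0" for n using that by (fastforce simp: R_def simp flip: of_int_abs)
  have R0: "0 \<le> R" using F0 by (simp add: R_def)
  \<comment> \<open>Chosen so that R * B / m <= e / 2 on the modes of \<open>F0\<close>, where |n|
    <= R.\<close>
  define m where "m = 1 + 2 * R * B / e"
  have m: "1 \<le> m" using R0 B e by (simp add: m_def)
  have "(\<Sum>n\<in>F. min 1 (\<bar>of_int n\<bar> / m) * h n) \<le> e" if F: "finite F" for F
  proof -
    have "(\<Sum>n\<in>F. min 1 (\<bar>of_int n\<bar> / m) * h n)
        = (\<Sum>n\<in>F \<inter> F0. min 1 (\<bar>of_int n\<bar> / m) * h n) + (\<Sum>n\<in>F - F0. min 1 (\<bar>of_int n\<bar> / m) * h n)"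
      using F by (rule sum.Int_Diff)
    also have "(\<Sum>n\<in>F - F0. min 1 (\<bar>of_int n\<bar> / m) * h n) \<le> (\<Sum>n\<in>F - F0. 1 * h n)"
      using h by (intro sum_mono mult_right_mono) auto
    also have "\<dots> \<le> e / 2" using tail[of "F - F0"] F by auto
    also have "(\<Sum>n\<in>F \<inter> F0. min 1 (\<bar>of_int n\<bar> / m) * h n) \<le> (\<Sum>n\<in>F \<inter> F0. R / m * h n)"
      using h R m by (intro sum_mono mult_right_mono) (auto intro!: min.coboundedI2 divide_right_mono)
    also have "\<dots> = R / m * sum h (F \<inter> F0)" by (simp only: sum_distrib_left)
    also have "\<dots> \<le> R / m * B" using R0 m F by (intro mult_left_mono bdd) auto
    also have "\<dots> \<le> e / 2"
    proof -
      have "R * B * 2 \<le> e * m" using e R0 B by (simp add: m_def algebra_simps)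
      then show ?thesis using m by (simp add: field_simps)
    qed
    finally show ?thesis by simp
  qed
  with m that show ?thesis by blast
qed


text \<open>The limit is taken in the time-integrated equation by dominated convergence. The
  limiting integrand is continuous, so the integral equation can be differentiated again.\<close>

lemma fourier_limit_of_galerkin:
  fixes g :: "nat \<Rightarrow> real \<Rightarrow> int \<Rightarrow> complex"
  assumes g: "\<And>N. galerkin_solution (int N) a0 (g N)" and M: "0 \<le> M"
    and bound: "\<And>N t n. 0 \<le> t \<Longrightarrow> cmod (g N t n) \<le> M / \<bar>of_int n\<bar> ^ 4"
    and lip: "\<And>N s t n. 0 \<le> s \<Longrightarrow> 0 \<le> t \<Longrightarrow> cmod (g N s n - g N t n) \<le> K n * \<bar>s - t\<bar>"
    and k: "strict_mono (k :: nat \<Rightarrow> nat)"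
    and lim: "\<And>t n. 0 \<le> t \<Longrightarrow> (\<lambda>j. g (k j) t n) \<longlonglongrightarrow> a t n" and t: "0 \<le> t"
  shows "((\<lambda>s. a s n) has_vector_derivative
      - (\<i> * of_int n / 2) * convolution (a t) n - a t n / of_int \<bar>n\<bar>) (at t within {0..})"
proof -
  define V where "V x = - (\<i> * of_int n / 2) * convolution x n - x n / of_int \<bar>n\<bar>" for x
  have supp: "g N s m = 0" if "0 \<le> s" "int N < \<bar>m\<bar>" for N s m
    using galerkin_properties(1)[OF g that(1)] that by blast
  \<comment> \<open>The support of the truncation makes its finite sum the full convolution.\<close>
  have burgers: "burgers_term (int N) (g N s) n = - (\<i> * of_int n / 2) * convolution (g N s) n" if "0 \<le> s" for N s
  proof -
    have "convolution (g N s) n = (\<Sum>m\<in>{-int N..int N}. g N s m * g N s (n - m))"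
      unfolding convolution_def
    proof (rule infsumI, rule has_sum_finite_neutralI)
      fix m assume "m \<in> UNIV - {-int N..int N}"
      then have "int N < \<bar>m\<bar>" by auto
      then show "g N s m * g N s (n - m) = 0" using supp[OF that] by simp
    qed auto
    then show ?thesis by (simp only: burgers_term_def)
  qed
  have abound: "cmod (a s m) \<le> M / \<bar>of_int m\<bar> ^ 4" if "0 \<le> s" for s m
    by (rule tendsto_upperbound[OF tendsto_norm[OF lim[OF that]]]) (intro always_eventually allI bound that, simp)
  have alip: "cmod (a r m - a s m) \<le> K m * \<bar>r - s\<bar>" if "0 \<le> r" "0 \<le> s" for r s m
    by (rule tendsto_upperbound[OF tendsto_norm[OF tendsto_diff[OF lim[OF that(1)] lim[OF that(2)]]]])
       (intro always_eventually allI lip that, simp)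
  \<comment> \<open>Freezing the value at negative times gives functions on the whole line with the
    same Lipschitz constant.\<close>
  have acont: "continuous_on UNIV (\<lambda>s. a (max 0 s) m)" for m
  proof (rule lipschitz_on_continuous_on)
    have K0: "0 \<le> K m" using lip[of 0 1 0 m] by (simp add: order.trans[OF norm_ge_zero])
    show "(K m)-lipschitz_on UNIV (\<lambda>s. a (max 0 s) m)"
    proof (rule lipschitz_onI)
      fix r s :: real
      have "cmod (a (max 0 r) m - a (max 0 s) m) \<le> K m * \<bar>max 0 r - max 0 s\<bar>" by (rule alip) auto
      also have "\<dots> \<le> K m * \<bar>r - s\<bar>" using K0 by (intro mult_left_mono) auto
      finally show "dist (a (max 0 r) m) (a (max 0 s) m) \<le> K m * dist r s" by (simp add: dist_norm)
    qed (rule K0)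
  qed
  have Vcont: "continuous_on UNIV (\<lambda>s. V (a (max 0 s)))"
  proof -
    have "isCont (\<lambda>s. convolution (a (max 0 s)) n) s" for s
      unfolding continuous_at using acont
      by (intro tendsto_convolution[OF _ abound M]) (auto simp: continuous_on_eq_continuous_at continuous_at)
    then have "continuous_on UNIV (\<lambda>s. convolution (a (max 0 s)) n)"
      by (simp add: continuous_at_imp_continuous_on)
    then show ?thesis unfolding V_def divide_inverse by (intro continuous_intros acont)
  qed
  have gV: "((\<lambda>s. V (g N s)) has_integral g N u n - g N 0 n) {0..u}" if u: "0 \<le> u" and N: "\<bar>n\<bar> \<le> int N" for N u
  proof (rule fundamental_theorem_of_calculus[OF u])
    fix s assume s: "s \<in> {0..u}"
    have "((\<lambda>s. g N s n) has_vector_derivative burgers_term (int N) (g N s) n - g N s n / of_int \<bar>n\<bar>) (at s within {0..})"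
      using g[of N] s N unfolding galerkin_solution_def by (auto simp: abs_le_iff)
    then show "((\<lambda>s. g N s n) has_vector_derivative V (g N s)) (at s within {0..u})"
      using s burgers[of s N] unfolding V_def by (auto intro: has_vector_derivative_within_subset)
  qed
  have int_eq: "a u n - a 0 n = integral {0..u} (\<lambda>s. V (a s))" if u: "0 \<le> u" for u
  proof -
    \<comment> \<open>A mode obeys the truncated equation only if |n| <= N, so an initial piece of
      the subsequence is dropped.\<close>
    obtain J where J: "\<And>j. J \<le> j \<Longrightarrow> \<bar>n\<bar> \<le> int (k j)"
    proof
      fix j assume "nat \<bar>n\<bar> \<le> j"
      then show "\<bar>n\<bar> \<le> int (k j)" using seq_suble[OF k, of j] by linarith
    qed
    define S where "S = infsum (\<lambda>m. M * M * (1 / (real_of_int m)\<^sup>2)) UNIV"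
    define B where "B = \<bar>of_int n\<bar> / 2 * S + M"
    have sum: "(\<lambda>m::int. M * M * (1 / (real_of_int m)\<^sup>2)) summable_on UNIV"
      by (rule abs_summable_summable[OF abs_summable_inverse_square_mult])
    \<comment> \<open>The constant that dominates the integrands; it depends on neither the
      truncation nor the time.\<close>
    have VB: "cmod (V (g N s)) \<le> B" if "0 \<le> s" for N s
    proof -
      have "(\<lambda>m. g N s m * g N s (n - m)) abs_summable_on UNIV"
        by (rule abs_summable_of_inverse_square_bound, rule convolution_terms_bound[OF M bound[OF that]])
      then have "cmod (convolution (g N s) n) \<le> S"
        unfolding convolution_def S_def
        by (intro order.trans[OF norm_infsum_bound] infsum_mono sum convolution_terms_bound[OF M bound[OF that]])
      moreover have "cmod (g N s n / of_int \<bar>n\<bar>) \<le> M"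
        by (rule order.trans[OF norm_divide_abs_int_le order.trans[OF bound[OF that] divide_fourth_le[OF M]]])
      ultimately have "cmod (- (\<i> * of_int n / 2) * convolution (g N s) n) + cmod (g N s n / of_int \<bar>n\<bar>) \<le> B"
        unfolding B_def by (intro add_mono) (simp_all add: norm_mult norm_divide mult_left_mono)
      then show ?thesis unfolding V_def by (rule order.trans[OF norm_triangle_ineq4])
    qed
    have "((\<lambda>s. V (a s)) has_integral a u n - a 0 n) {0..u}"
    proof (rule has_integral_dominated_convergence)
      show "((\<lambda>s. V (g (k (j + J)) s)) has_integral g (k (j + J)) u n - g (k (j + J)) 0 n) {0..u}" for j
        using J[of "j + J"] by (intro gV u) auto
      show "(\<lambda>s. B) integrable_on {0..u}" by (rule integrable_const_ivl)
      show "\<forall>s\<in>{0..u}. cmod (V (g (k (j + J)) s)) \<le> B" for j by (auto intro: VB)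
      show "\<forall>s\<in>{0..u}. (\<lambda>j. V (g (k (j + J)) s)) \<longlonglongrightarrow> V (a s)"
      proof
        fix s assume s: "s \<in> {0..u}"
        then have s: "0 \<le> s" by simp
        have "(\<lambda>j. convolution (g (k j) s) n) \<longlonglongrightarrow> convolution (a s) n"
          by (rule tendsto_convolution[OF lim[OF s] bound[OF s] M]) simp
        then have "(\<lambda>j. V (g (k j) s)) \<longlonglongrightarrow> V (a s)"
          unfolding V_def divide_inverse by (intro tendsto_intros lim s)
        then show "(\<lambda>j. V (g (k (j + J)) s)) \<longlonglongrightarrow> V (a s)" by (rule LIMSEQ_ignore_initial_segment)
      qed
      show "(\<lambda>j. g (k (j + J)) u n - g (k (j + J)) 0 n) \<longlonglongrightarrow> a u n - a 0 n"
        by (intro tendsto_diff LIMSEQ_ignore_initial_segment[OF lim] u order_refl)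
    qed
    then show ?thesis by (simp add: integral_unique)
  qed
  have eq: "a u n = a 0 n + integral {0..u} (\<lambda>s. V (a (max 0 s)))" if u: "0 \<le> u" for u
  proof -
    have "integral {0..u} (\<lambda>s. V (a s)) = integral {0..u} (\<lambda>s. V (a (max 0 s)))"
      by (rule integral_cong) (simp add: max_absorb2)
    with int_eq[OF u] show ?thesis by (simp add: algebra_simps)
  qed
  have "((\<lambda>u. integral {0..u} (\<lambda>s. V (a (max 0 s)))) has_vector_derivative V (a (max 0 t))) (at t within {0..t+1})"
    by (rule integral_has_vector_derivative[OF continuous_on_subset[OF Vcont]]) (use t in auto)
  then have "((\<lambda>u. a 0 n + integral {0..u} (\<lambda>s. V (a (max 0 s)))) has_vector_derivative V (a t)) (at t within {0..t+1})"
    using t by (auto intro!: derivative_eq_intros simp: max_absorb2)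
  moreover have "at t within {0..t+1} = at t within {0..}"
    by (rule at_within_nhd[of _ "{..<t+1}"]) auto
  ultimately have "((\<lambda>u. a 0 n + integral {0..u} (\<lambda>s. V (a (max 0 s)))) has_vector_derivative V (a t)) (at t within {0..})"
    by simp
  then have "((\<lambda>s. a s n) has_vector_derivative V (a t)) (at t within {0..})"
  proof (rule has_vector_derivative_transform[rotated 2])
    show "a u n = a 0 n + integral {0..u} (\<lambda>s. V (a (max 0 s)))" if "u \<in> {0..}" for u
      using that by (intro eq) simp
  qed (use t in simp)
  then show ?thesis by (simp only: V_def)
qed

definition fourier_solution :: "(int \<Rightarrow> complex) \<Rightarrow> (real \<Rightarrow> int \<Rightarrow> complex) \<Rightarrow> bool" where
  "fourier_solution a0 a \<longleftrightarrow> a 0 = a0 \<and>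
     (\<forall>t\<ge>0. a t 0 = 0 \<and> hermitian (a t)) \<and>
     (\<forall>t\<ge>0. \<forall>n. ((\<lambda>s. a s n) has_vector_derivative
        - (\<i> * of_int n / 2) * convolution (a t) n - a t n / of_int \<bar>n\<bar>) (at t within {0..}))"

text \<open>The quadratic bounds are stated over finite sets of modes, so they pass to the limit
  from convergence of single coefficients.\<close>

lemma fourier_solution_exists:
  assumes herm: "hermitian a0" and zero: "a0 0 = 0" and M: "0 < M" "M \<le> 1 / 10 ^ 8"
    and init: "\<And>F. finite F \<Longrightarrow> (\<Sum>n\<in>F. of_int n ^ 8 * (cmod (a0 n))\<^sup>2) \<le> M\<^sup>2 / 4"
  obtains a where "fourier_solution a0 a"
    "\<And>t n. 0 \<le> t \<Longrightarrow> cmod (a t n) \<le> M / \<bar>of_int n\<bar> ^ 4"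
    "\<And>t F. 0 \<le> t \<Longrightarrow> finite F \<Longrightarrow> (\<Sum>n\<in>F. (cmod (a t n))\<^sup>2) \<le> 19684 * M\<^sup>2 / (1 + t) ^ 6"
    "\<And>t F. 0 \<le> t \<Longrightarrow> finite F \<Longrightarrow> (\<Sum>n\<in>F. of_int n ^ 8 * (cmod (a t n))\<^sup>2) \<le> M\<^sup>2"
    "\<And>e. 0 < e \<Longrightarrow> \<exists>m::real. \<forall>t\<ge>0. \<forall>F. finite F \<longrightarrow> (\<forall>n\<in>F. m \<le> \<bar>of_int n\<bar>) \<longrightarrow>
        (\<Sum>n\<in>F. of_int n ^ 8 * (cmod (a t n))\<^sup>2) \<le> e"
proof -
  have "\<forall>N. \<exists>a. galerkin_solution (int N) a0 a"
    using galerkin_solution_exists[OF _ herm zero] by (metis of_nat_0_le_iff)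
  then obtain g where g: "\<And>N. galerkin_solution (int N) a0 (g N)" by metis
  have supp: "g N t n = 0" if "0 \<le> t" "int N < \<bar>n\<bar>" for N t n
    using galerkin_properties(1)[OF g that(1)] that by blast
  have E0: "energy (int N) (sobolev_weight 1) a0 \<le> M\<^sup>2 / 4" for N
    using init[of "{- int N..int N}"] by (simp add: energy_def sobolev_weight_one)
  have E: "energy (int N) (sobolev_weight 1) (g N t) \<le> M\<^sup>2" if "0 \<le> t" for N t
    by (rule galerkin_sobolev_bound[OF g _ M E0 that]) simp
  have Y: "energy (int N) (\<lambda>_. 1) (g N t) \<le> 19684 * M\<^sup>2 / (1 + t) ^ 6" if "0 \<le> t" for N t
    by (rule galerkin_L2_decay[OF g E that])
  have W: "energy (int N) (sobolev_weight m) (g N t) \<le> 2 * energy (int N) (sobolev_weight m) a0" if "0 < m" "0 \<le> t" for N m t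
    by (rule galerkin_weighted_energy_bound[OF g _ M that(1) E that(2)]) simp_all
  have fin: "(\<Sum>n\<in>F. G n * (cmod (g N t n))\<^sup>2) \<le> energy (int N) G (g N t)"
    if "finite F" "0 \<le> t" "\<And>n. 0 \<le> G n" for F G N t
    unfolding energy_def using that supp by (intro sum_support_le) auto
  have bound: "cmod (g N t n) \<le> M / \<bar>of_int n\<bar> ^ 4" if t: "0 \<le> t" for N t n
  proof (cases "n = 0")
    case True
    then show ?thesis using galerkin_properties(2)[OF g t, of N] by simp
  next
    case False
    have "of_int n ^ 8 * (cmod (g N t n))\<^sup>2 \<le> M\<^sup>2"
      using order.trans[OF fin[of "{n}" t "sobolev_weight 1" N] E[OF t, of N]] weight_nonneg[of 1] t
      by (simp add: sobolev_weight_one)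
    then have "(\<bar>of_int n\<bar> ^ 4 * cmod (g N t n))\<^sup>2 \<le> M\<^sup>2"
      by (simp add: power_mult_distrib flip: power_mult)
    then have "\<bar>of_int n\<bar> ^ 4 * cmod (g N t n) \<le> M" by (rule power2_le_imp_le) (use M(1) in simp)
    then show ?thesis using False by (simp add: pos_le_divide_eq mult.commute)
  qed
  \<comment> \<open>Young's inequality bounds the convolution by the L^2 energy, at most 19684 M^2;
    the last \<open>M\<close> bounds the damping. Nothing depends on the truncation.\<close>
  define K where "K n = \<bar>of_int n\<bar> / 2 * (19684 * M\<^sup>2) + M" for n :: int
  have lip: "cmod (g N s n - g N t n) \<le> K n * \<bar>s - t\<bar>" if st: "0 \<le> s" "0 \<le> t" for N s t n
  proof (cases "\<bar>n\<bar> \<le> int N")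
    case True
    let ?d = "\<lambda>r. burgers_term (int N) (g N r) n - g N r n / of_int \<bar>n\<bar>"
    have "norm (g N s n - g N t n) \<le> K n * norm (s - t)"
    proof (rule differentiable_bound[of "{0..}"])
      show "((\<lambda>r. g N r n) has_derivative (\<lambda>h. h *\<^sub>R ?d r)) (at r within {0..})" if "r \<in> {0..}" for r
        using g[of N] that True unfolding galerkin_solution_def
        by (auto simp: abs_le_iff simp flip: has_vector_derivative_def)
      show "onorm (\<lambda>h. h *\<^sub>R ?d r) \<le> K n" if "r \<in> {0..}" for r
      proof -
        from that have r: "0 \<le> r" by simp
        let ?I = "{- int N..int N}"
        let ?x = "\<lambda>m. cmod (g N r m)"
        have "cmod (\<Sum>m\<in>?I. g N r m * g N r (n - m)) \<le> (\<Sum>m\<in>?I. ((?x m)\<^sup>2 + (?x (n - m))\<^sup>2) / 2)"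
        proof (intro sum_norm_le)
          fix m
          show "cmod (g N r m * g N r (n - m)) \<le> ((?x m)\<^sup>2 + (?x (n - m))\<^sup>2) / 2"
            using sum_squares_bound[of "?x m" "?x (n - m)"] by (simp add: norm_mult)
        qed
        also have "\<dots> = ((\<Sum>m\<in>?I. (?x m)\<^sup>2) + (\<Sum>m\<in>?I. (?x (n - m))\<^sup>2)) / 2"
          by (simp add: sum_divide_distrib sum.distrib add_divide_distrib)
        also have "(\<Sum>m\<in>?I. (?x (n - m))\<^sup>2) \<le> (\<Sum>m\<in>?I. (?x m)\<^sup>2)"
          using sum_reflect_le[of "int N" "\<lambda>m. (?x m)\<^sup>2" n] supp[OF r] by simp
        also have "((\<Sum>m\<in>?I. (?x m)\<^sup>2) + (\<Sum>m\<in>?I. (?x m)\<^sup>2)) / 2 = energy (int N) (\<lambda>_. 1) (g N r)"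
          by (simp add: energy_def)
        also have "\<dots> \<le> 19684 * M\<^sup>2 / (1 + r) ^ 6" by (rule Y[OF r])
        also have "\<dots> \<le> 19684 * M\<^sup>2 / 1"
          using r one_le_power[of "1 + r" 6] by (intro divide_left_mono) auto
        finally have 1: "cmod (\<Sum>m\<in>?I. g N r m * g N r (n - m)) \<le> 19684 * M\<^sup>2" by simp
        have 2: "cmod (g N r n / of_int \<bar>n\<bar>) \<le> M"
          using order.trans[OF norm_divide_abs_int_le order.trans[OF bound[OF r] divide_fourth_le]] M by simp
        have "cmod (?d r) \<le> cmod (burgers_term (int N) (g N r) n) + cmod (g N r n / of_int \<bar>n\<bar>)"
          by (rule norm_triangle_ineq4)
        also have "\<dots> \<le> \<bar>of_int n\<bar> / 2 * (19684 * M\<^sup>2) + M"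
        proof (rule add_mono[OF _ 2])
          show "cmod (burgers_term (int N) (g N r) n) \<le> \<bar>of_int n\<bar> / 2 * (19684 * M\<^sup>2)"
            using mult_left_mono[OF 1, of "\<bar>of_int n\<bar> / 2"]
            by (simp only: burgers_term_def norm_mult norm_minus_cancel norm_divide) simp
        qed
        finally have "cmod (?d r) \<le> K n" by (simp only: K_def)
        then show ?thesis
          by (intro onorm_le) (simp only: norm_scaleR real_norm_def mult.commute[of "K n"] mult_left_mono abs_ge_zero)
      qed
    qed (use st in auto)
    then show ?thesis by simp
  next
    case False
    then show ?thesis using supp[OF st(1), of N n] supp[OF st(2), of N n] M by (simp add: K_def)
  qed
  have "cmod (g N t n) \<le> M" if "0 \<le> t" for N t n
    using order.trans[OF bound[OF that] divide_fourth_le] M by simp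
  then obtain k where k: "strict_mono (k :: nat \<Rightarrow> nat)" "\<And>t n. 0 \<le> t \<Longrightarrow> convergent (\<lambda>j. g (k j) t n)"
    using equilipschitz_subsequence[of g M K] lip by metis
  define a where "a t n = lim (\<lambda>j. g (k j) t n)" for t n
  have lim: "(\<lambda>j. g (k j) t n) \<longlonglongrightarrow> a t n" if "0 \<le> t" for t n
    using k(2)[OF that] by (simp add: a_def convergent_LIMSEQ_iff)
  show ?thesis
  proof (rule that)
    show "fourier_solution a0 a"
      unfolding fourier_solution_def
    proof (intro conjI allI impI)
      show "a 0 = a0"
      proof
        fix n
        have "eventually (\<lambda>j. g (k j) 0 n = a0 n) sequentially"
          unfolding eventually_sequentially
        proof (intro exI allI impI)
          fix j assume "nat \<bar>n\<bar> \<le> j"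
          then have "\<bar>n\<bar> \<le> int (k j)" using seq_suble[OF k(1), of j] by linarith
          then show "g (k j) 0 n = a0 n" using g[of "k j"] by (simp add: galerkin_solution_def)
        qed
        then have "(\<lambda>j. g (k j) 0 n) \<longlonglongrightarrow> a0 n" by (rule tendsto_eventually)
        with lim[of 0 n] show "a 0 n = a0 n" by (auto intro: LIMSEQ_unique)
      qed
      fix t :: real assume t: "0 \<le> t"
      show "a t 0 = 0" using lim[OF t, of 0] galerkin_properties(2)[OF g t]
        by (simp add: LIMSEQ_const_iff)
      show "hermitian (a t)"
        unfolding hermitian_def
      proof
        fix n
        have "(\<lambda>j. g (k j) t (- n)) \<longlonglongrightarrow> cnj (a t n)"
          using tendsto_cnj[OF lim[OF t, of n]] galerkin_properties(3)[OF g t] by simp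
        with lim[OF t, of "- n"] show "a t (- n) = cnj (a t n)" by (rule LIMSEQ_unique)
      qed
      show "((\<lambda>s. a s n) has_vector_derivative
        - (\<i> * of_int n / 2) * convolution (a t) n - a t n / of_int \<bar>n\<bar>) (at t within {0..})" for n
        using fourier_limit_of_galerkin[OF g _ bound lip k(1) lim t] M(1) by simp
    qed
    show "cmod (a t n) \<le> M / \<bar>of_int n\<bar> ^ 4" if "0 \<le> t" for t n
      by (rule tendsto_upperbound[OF tendsto_norm[OF lim[OF that]]]) (intro always_eventually allI bound that, simp)
    have sumlim: "(\<Sum>n\<in>F. G n * (cmod (a t n))\<^sup>2) \<le> B"
      if "0 \<le> t" "\<And>N. (\<Sum>n\<in>F. G n * (cmod (g N t n))\<^sup>2) \<le> B" for F t G B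
    proof (rule tendsto_upperbound)
      show "(\<lambda>j. \<Sum>n\<in>F. G n * (cmod (g (k j) t n))\<^sup>2) \<longlonglongrightarrow> (\<Sum>n\<in>F. G n * (cmod (a t n))\<^sup>2)"
        by (intro tendsto_intros lim that(1))
    qed (use that(2) in simp_all)
    show "(\<Sum>n\<in>F. (cmod (a t n))\<^sup>2) \<le> 19684 * M\<^sup>2 / (1 + t) ^ 6" if "0 \<le> t" "finite F" for t F
      using sumlim[where t = t and F = F and G = "\<lambda>_. 1", OF that(1) order.trans[OF fin[OF that(2,1)] Y[OF that(1)]]]
      by simp
    show "(\<Sum>n\<in>F. of_int n ^ 8 * (cmod (a t n))\<^sup>2) \<le> M\<^sup>2" if "0 \<le> t" "finite F" for t F
    proof (rule sumlim[OF that(1)])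
      show "(\<Sum>n\<in>F. of_int n ^ 8 * (cmod (g N t n))\<^sup>2) \<le> M\<^sup>2" for N
        using order.trans[OF fin[where G = "sobolev_weight 1", OF that(2,1) weight_nonneg] E[OF that(1)]]
        by (simp add: sobolev_weight_one)
    qed
    show "\<exists>m::real. \<forall>t\<ge>0. \<forall>F. finite F \<longrightarrow> (\<forall>n\<in>F. m \<le> \<bar>of_int n\<bar>) \<longrightarrow>
        (\<Sum>n\<in>F. of_int n ^ 8 * (cmod (a t n))\<^sup>2) \<le> e" if e: "0 < e" for e
    proof -
      \<comment> \<open>The cutoff is chosen from the initial data alone. The factor 2 of the
        weighted energy bound then turns e/2 into e for all times and truncations.\<close>
      obtain m :: real where m: "1 \<le> m"
        "\<And>F. finite F \<Longrightarrow> (\<Sum>n\<in>F. min 1 (\<bar>of_int n\<bar> / m) * (of_int n ^ 8 * (cmod (a0 n))\<^sup>2)) \<le> e / 2"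
        using weighted_tail_small[of "\<lambda>n. of_int n ^ 8 * (cmod (a0 n))\<^sup>2" "M\<^sup>2 / 4" "e / 2"] init e by auto
      have "(\<Sum>n\<in>F. of_int n ^ 8 * (cmod (a t n))\<^sup>2) \<le> e"
        if t: "0 \<le> t" and F: "finite F" "\<forall>n\<in>F. m \<le> \<bar>of_int n\<bar>" for t F
      proof (rule sumlim[OF t])
        fix N
        have "(\<Sum>n\<in>F. of_int n ^ 8 * (cmod (g N t n))\<^sup>2) = (\<Sum>n\<in>F. sobolev_weight m n * (cmod (g N t n))\<^sup>2)"
          using F(2) m(1) by (intro sum.cong) (auto simp: weight_def min_absorb1)
        also have "\<dots> \<le> energy (int N) (sobolev_weight m) (g N t)"
          using m(1) by (intro fin F t weight_nonneg) auto
        also have "\<dots> \<le> 2 * energy (int N) (sobolev_weight m) a0" using m(1) t by (intro W) auto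
        also have "\<dots> \<le> 2 * (e / 2)"
          using m(2)[of "{- int N..int N}"] by (simp add: energy_def weight_def mult.assoc)
        finally show "(\<Sum>n\<in>F. of_int n ^ 8 * (cmod (g N t n))\<^sup>2) \<le> e" by simp
      qed
      then show ?thesis by blast
    qed
  qed
qed

section \<open>Fourier coefficients on the torus\<close>

abbreviation torus :: "real measure" where
  "torus \<equiv> lebesgue_on {-pi..pi}"

lemma torus_sets: "{-pi..pi} \<in> sets lebesgue" "{-pi..pi} \<inter> space lebesgue \<in> sets lebesgue"
  by auto

lemma set_integral_torus:
  fixes f :: "real \<Rightarrow> 'a::{banach, second_countable_topology}"
  shows "(LINT x:{-pi..pi}|lebesgue. f x) = (LINT x|torus. f x)"
  unfolding set_lebesgue_integral_def by (rule integral_restrict_space[OF torus_sets(2), symmetric])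

lemma set_integrable_torus:
  fixes f :: "real \<Rightarrow> 'a::{banach, second_countable_topology}"
  shows "set_integrable lebesgue {-pi..pi} f \<longleftrightarrow> integrable torus f"
  unfolding set_integrable_def by (rule integrable_restrict_space[OF torus_sets(2), symmetric])

lemma finite_measure_torus: "finite_measure torus"
  by (rule finite_measure_lebesgue_on) simp

lemma continuous_measurable_lebesgue:
  fixes f :: "real \<Rightarrow> 'a::real_normed_vector"
  shows "continuous_on UNIV f \<Longrightarrow> f \<in> borel_measurable lebesgue"
  by (intro measurable_completion) (simp add: borel_measurable_continuous_onI)

lemma measurable_torus: "f \<in> borel_measurable lebesgue \<Longrightarrow> f \<in> borel_measurable torus"
  by (rule measurable_restrict_space1)

lemma integrable_torus_continuous:
  fixes f :: "real \<Rightarrow> 'a::euclidean_space"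
  assumes "continuous_on UNIV f" shows "integrable torus f"
  by (rule continuous_imp_integrable_real[OF continuous_on_subset[OF assms]]) simp

lemma L2_torusD:
  assumes "u \<in> L2_torus"
  shows "u \<in> borel_measurable lebesgue" "integrable torus (\<lambda>x. (u x)\<^sup>2)" "integrable torus u"
    "\<And>x. u (x + 2 * pi) = u x"
proof -
  show m: "u \<in> borel_measurable lebesgue" and i: "integrable torus (\<lambda>x. (u x)\<^sup>2)"
    and "\<And>x. u (x + 2 * pi) = u x"
    using assms by (auto simp: L2_torus_def set_integrable_torus)
  interpret finite_measure torus by (rule finite_measure_torus)
  show "integrable torus u"
  proof (rule Bochner_Integration.integrable_bound)
    show "integrable torus (\<lambda>x. 1 + (u x)\<^sup>2)" using i by simp
    have "\<bar>y\<bar> \<le> 1 + y\<^sup>2" for y :: real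
    proof -
      have "2 * \<bar>y\<bar> \<le> y\<^sup>2 + 1" using sum_squares_bound[of "\<bar>y\<bar>" 1] by simp
      then show ?thesis by linarith
    qed
    then show "AE x in torus. norm (u x) \<le> norm (1 + (u x)\<^sup>2)" by (intro AE_I2) (simp add: abs_le_iff)
  qed (rule measurable_torus[OF m])
qed

lemma L2_norm_torus: "L2_norm u = sqrt (LINT x|torus. (u x)\<^sup>2)"
  by (simp add: L2_norm_def set_integral_torus)

lemma fourier_coeff_torus:
  "fourier_coeff u n = (LINT x|torus. complex_of_real (u x) * cis (- (of_int n * x))) / (2 * pi)"
  by (simp add: fourier_coeff_def set_integral_torus)

lemma integrable_mult_bounded_continuous:
  fixes h :: "real \<Rightarrow> complex" and u :: "real \<Rightarrow> complex"
  assumes u: "integrable torus u" and h: "continuous_on UNIV h" "\<And>x. cmod (h x) \<le> B"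
  shows "integrable torus (\<lambda>x. u x * h x)"
proof (rule Bochner_Integration.integrable_bound)
  show "integrable torus (\<lambda>x. B * norm (u x))" using u by simp
  have "norm (u x * h x) \<le> norm (B * norm (u x))" for x
  proof -
    have "norm (u x * h x) \<le> norm (u x) * B" unfolding norm_mult using h(2) by (intro mult_left_mono) auto
    also have "\<dots> \<le> norm (B * norm (u x))" by (simp add: mult.commute[of _ B] abs_mult mult_right_mono)
    finally show ?thesis .
  qed
  then show "AE x in torus. norm (u x * h x) \<le> norm (B * norm (u x))" by simp
  show "(\<lambda>x. u x * h x) \<in> borel_measurable torus"
    using u measurable_torus[OF continuous_measurable_lebesgue[OF h(1)]] by measurable
qed

lemma integrable_mult_cis:
  fixes u :: "real \<Rightarrow> complex"
  shows "integrable torus u \<Longrightarrow> integrable torus (\<lambda>x. u x * cis (c * x))"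
  by (rule integrable_mult_bounded_continuous[where B = 1]) (auto intro!: continuous_intros)

lemma has_vector_derivative_cis:
  "((\<lambda>x. cis (c * x)) has_vector_derivative (\<i> * of_real c * cis (c * x))) (at x within S)"
  unfolding has_vector_derivative_def
  by (rule has_derivative_eq_rhs[OF has_derivative_cis])
     (auto intro!: derivative_eq_intros simp: fun_eq_iff scaleR_conv_of_real)

lemma cis_periodic: "cis (of_int n * (x + 2 * pi)) = cis (of_int n * x)"
proof -
  have "cis (of_int n * (x + 2 * pi)) = cis (of_int n * x) * cis (2 * pi * of_int n)"
    by (simp add: cis_mult algebra_simps)
  then show ?thesis by (simp add: cis_multiple_2pi)
qed

lemma has_integral_cis_period:
  "((\<lambda>x. cis (of_int k * x)) has_integral (if k = 0 then of_real (2 * pi) else 0)) {a..a + 2 * pi}"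
proof (cases "k = 0")
  case True
  then show ?thesis
    using has_integral_const_real[of "1::complex" a "a + 2 * pi"] by (simp add: scaleR_conv_of_real)
next
  case False
  have "((\<lambda>x. cis (of_int k * x)) has_integral
      cis (of_int k * (a + 2 * pi)) / (\<i> * of_int k) - cis (of_int k * a) / (\<i> * of_int k)) {a..a + 2 * pi}"
    using False by (intro fundamental_theorem_of_calculus)
      (auto intro!: derivative_eq_intros has_vector_derivative_cis)
  then show ?thesis using False by (simp only: cis_periodic) simp
qed

lemma integral_cis:
  "(LINT x|torus. cis (of_int k * x)) = (if k = 0 then 2 * of_real pi else 0)"
proof -
  have i: "integrable torus (\<lambda>x. cis (of_int k * x))"
    by (intro integrable_torus_continuous continuous_intros)
  show ?thesis
    using has_integral_cis_period[of k "- pi"]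
    by (simp add: lebesgue_integral_eq_integral[OF i torus_sets(1)] integral_unique)
qed

section \<open>Trigonometric sums and Bessel's inequality\<close>

definition trig_sum :: "int set \<Rightarrow> (int \<Rightarrow> complex) \<Rightarrow> real \<Rightarrow> complex" where
  "trig_sum F c x = (\<Sum>n\<in>F. c n * cis (of_int n * x))"

lemma continuous_trig_sum: "continuous_on UNIV (trig_sum F c)"
  unfolding trig_sum_def[abs_def] by (intro continuous_intros)

lemma trig_sum_periodic: "trig_sum F c (x + 2 * pi) = trig_sum F c x"
  by (simp only: trig_sum_def cis_periodic)

lemma norm_trig_sum_le: "cmod (trig_sum F c x) \<le> (\<Sum>n\<in>F. cmod (c n))"
  unfolding trig_sum_def by (rule order.trans[OF norm_sum]) (simp add: norm_mult)

lemma complex_of_real_norm_square: "(complex_of_real (cmod z))\<^sup>2 = z * cnj z"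
  using complex_norm_square[of z] by simp

lemma integral_mult_cnj_trig_sum:
  fixes u :: "real \<Rightarrow> complex"
  assumes u: "integrable torus u"
  shows "(LINT x|torus. u x * cnj (trig_sum F c x)) = (\<Sum>n\<in>F. cnj (c n) * (LINT x|torus. u x * cis (- (of_int n * x))))"
proof -
  have "(\<lambda>x. u x * cnj (trig_sum F c x)) = (\<lambda>x. \<Sum>n\<in>F. cnj (c n) * (u x * cis (- (of_int n * x))))"
    by (simp add: trig_sum_def sum_distrib_left cis_cnj mult_ac fun_eq_iff)
  then show ?thesis
    using integrable_mult_cis[OF u, of "- of_int _"] by (simp add: Bochner_Integration.integral_sum)
qed

lemma integral_trig_sum_cis:
  "finite F \<Longrightarrow> (LINT x|torus. trig_sum F c x * cis (- (of_int n * x))) = (if n \<in> F then 2 * of_real pi * c n else 0)"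
proof -
  assume F: "finite F"
  have "(LINT x|torus. trig_sum F c x * cis (- (of_int n * x)))
      = (LINT x|torus. (\<Sum>m\<in>F. c m * cis (of_int (m - n) * x)))"
    by (intro Bochner_Integration.integral_cong refl)
       (simp add: trig_sum_def sum_distrib_right cis_mult mult.assoc left_diff_distrib)
  also have "\<dots> = (\<Sum>m\<in>F. LINT x|torus. c m * cis (of_int (m - n) * x))"
    by (intro Bochner_Integration.integral_sum integrable_torus_continuous continuous_intros)
  also have "\<dots> = (\<Sum>m\<in>F. if m = n then c m * (2 * of_real pi) else 0)"
    by (intro sum.cong refl) (simp only: integral_mult_right_zero integral_cis, simp)
  also have "\<dots> = (if n \<in> F then 2 * of_real pi * c n else 0)"
    using F by (simp add: mult.commute)
  finally show ?thesis .
qed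

lemma integral_trig_sum_norm_square:
  assumes F: "finite F"
  shows "(LINT x|torus. (cmod (trig_sum F c x))\<^sup>2) = 2 * pi * (\<Sum>n\<in>F. (cmod (c n))\<^sup>2)"
proof -
  have "complex_of_real (LINT x|torus. (cmod (trig_sum F c x))\<^sup>2) = (LINT x|torus. trig_sum F c x * cnj (trig_sum F c x))"
    unfolding integral_complex_of_real[symmetric] by (simp only: complex_norm_square)
  also have "\<dots> = (\<Sum>n\<in>F. cnj (c n) * (2 * of_real pi * c n))"
    by (subst integral_mult_cnj_trig_sum[OF integrable_torus_continuous[OF continuous_trig_sum]])
       (simp add: integral_trig_sum_cis[OF F])
  also have "\<dots> = of_real (2 * pi * (\<Sum>n\<in>F. (cmod (c n))\<^sup>2))"
    by (simp add: sum_distrib_left complex_of_real_norm_square mult_ac)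
  finally show ?thesis by (simp only: of_real_eq_iff)
qed

lemma bessel_identity:
  assumes u: "u \<in> L2_torus" and F: "finite F"
  shows "(LINT x|torus. (cmod (u x - trig_sum F (fourier_coeff u) x))\<^sup>2)
     = (LINT x|torus. (u x)\<^sup>2) - 2 * pi * (\<Sum>n\<in>F. (cmod (fourier_coeff u n))\<^sup>2)"
proof -
  define S where "S = trig_sum F (fourier_coeff u)"
  have iu: "integrable torus (\<lambda>x. complex_of_real (u x))" using L2_torusD(3)[OF u] by simp
  have contS: "continuous_on UNIV S" unfolding S_def by (rule continuous_trig_sum)
  have iuS: "integrable torus (\<lambda>x. complex_of_real (u x) * cnj (S x))"
  proof (rule integrable_mult_bounded_continuous[OF iu])
    show "continuous_on UNIV (\<lambda>x. cnj (S x))" by (intro continuous_intros contS)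
    show "cmod (cnj (S x)) \<le> (\<Sum>n\<in>F. cmod (fourier_coeff u n))" for x
      unfolding complex_mod_cnj S_def by (rule norm_trig_sum_le)
  qed
  have iS: "integrable torus (\<lambda>x. (cmod (S x))\<^sup>2)"
    by (intro integrable_torus_continuous continuous_intros contS)
  have "(LINT x|torus. complex_of_real (u x) * cnj (S x))
      = (\<Sum>n\<in>F. cnj (fourier_coeff u n) * (2 * of_real pi * fourier_coeff u n))"
    unfolding S_def integral_mult_cnj_trig_sum[OF iu] by (simp add: fourier_coeff_torus)
  also have "\<dots> = of_real (2 * pi * (\<Sum>n\<in>F. (cmod (fourier_coeff u n))\<^sup>2))"
    by (simp add: sum_distrib_left complex_of_real_norm_square mult_ac)
  finally have 1: "(LINT x|torus. complex_of_real (u x) * cnj (S x))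
      = of_real (2 * pi * (\<Sum>n\<in>F. (cmod (fourier_coeff u n))\<^sup>2))" .
  have "(LINT x|torus. Re (complex_of_real (u x) * cnj (S x))) = 2 * pi * (\<Sum>n\<in>F. (cmod (fourier_coeff u n))\<^sup>2)"
    using integral_Re[OF iuS] 1 by simp
  moreover have "(\<lambda>x. (cmod (u x - S x))\<^sup>2) = (\<lambda>x. (u x)\<^sup>2 - 2 * Re (complex_of_real (u x) * cnj (S x)) + (cmod (S x))\<^sup>2)"
    by (rule ext, unfold cmod_power2) (simp add: power2_eq_square algebra_simps)
  moreover have "integrable torus (\<lambda>x. Re (complex_of_real (u x) * cnj (S x)))"
    using iuS by (rule integrable_Re)
  ultimately have "(LINT x|torus. (cmod (u x - S x))\<^sup>2)
     = (LINT x|torus. (u x)\<^sup>2) - 2 * (2 * pi * (\<Sum>n\<in>F. (cmod (fourier_coeff u n))\<^sup>2)) + (LINT x|torus. (cmod (S x))\<^sup>2)"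
    using L2_torusD(2)[OF u] iS by simp
  then show ?thesis
    using integral_trig_sum_norm_square[OF F, of "fourier_coeff u"] by (simp add: S_def)
qed

lemma bessel_inequality:
  assumes u: "u \<in> L2_torus" and F: "finite F"
  shows "2 * pi * (\<Sum>n\<in>F. (cmod (fourier_coeff u n))\<^sup>2) \<le> (LINT x|torus. (u x)\<^sup>2)"
proof -
  have "0 \<le> (LINT x|torus. (cmod (u x - trig_sum F (fourier_coeff u) x))\<^sup>2)"
    by (rule integral_nonneg_AE) simp
  then show ?thesis by (simp add: bessel_identity[OF u F])
qed

lemma fourier_coeff_hermitian: "hermitian (fourier_coeff u)"
  unfolding hermitian_def
proof
  fix n
  have "cnj (LINT x|torus. complex_of_real (u x) * cis (- (of_int n * x)))
      = (LINT x|torus. cnj (complex_of_real (u x) * cis (- (of_int n * x))))"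
    by (rule Bochner_Integration.integral_cnj[symmetric])
  then show "fourier_coeff u (- n) = cnj (fourier_coeff u n)"
    by (simp add: fourier_coeff_torus cis_cnj)
qed

lemma fourier_coeff_diff:
  assumes "integrable torus u" "integrable torus v"
  shows "fourier_coeff (\<lambda>x. u x - v x) n = fourier_coeff u n - fourier_coeff v n"
proof -
  have "integrable torus (\<lambda>x. complex_of_real (w x) * cis (- (of_int n * x)))" if "integrable torus w" for w
    using integrable_mult_cis[of "\<lambda>x. complex_of_real (w x)" "- of_int n"] that by simp
  then show ?thesis using assms
    by (simp add: fourier_coeff_torus left_diff_distrib diff_divide_distrib)
qed

lemma L2_torus_continuous:
  assumes "continuous_on UNIV u" "\<And>x. u (x + 2 * pi) = u x"
  shows "u \<in> L2_torus"
  using assms integrable_torus_continuous[of "\<lambda>x. (u x)\<^sup>2"]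
  by (auto simp: L2_torus_def set_integrable_torus continuous_measurable_lebesgue intro!: continuous_intros)

lemma L2_torus_diff:
  assumes "u \<in> L2_torus" "v \<in> L2_torus" shows "(\<lambda>x. u x - v x) \<in> L2_torus"
proof -
  have m: "u \<in> borel_measurable lebesgue" "v \<in> borel_measurable lebesgue" using assms L2_torusD(1) by auto
  have "integrable torus (\<lambda>x. (u x - v x)\<^sup>2)"
  proof (rule Bochner_Integration.integrable_bound)
    show "integrable torus (\<lambda>x. 2 * (u x)\<^sup>2 + 2 * (v x)\<^sup>2)"
      using L2_torusD(2)[OF assms(1)] L2_torusD(2)[OF assms(2)] by simp
    have "(u x - v x)\<^sup>2 \<le> 2 * (u x)\<^sup>2 + 2 * (v x)\<^sup>2" for x
      using zero_le_power2[of "u x + v x"] by (simp add: power2_eq_square algebra_simps)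
    then show "AE x in torus. norm ((u x - v x)\<^sup>2) \<le> norm (2 * (u x)\<^sup>2 + 2 * (v x)\<^sup>2)"
      by (intro AE_I2) simp
    show "(\<lambda>x. (u x - v x)\<^sup>2) \<in> borel_measurable torus"
      using m[THEN measurable_torus] by measurable
  qed
  then show ?thesis using m L2_torusD(4)[OF assms(1)] L2_torusD(4)[OF assms(2)]
    by (auto simp: L2_torus_def set_integrable_torus)
qed

text \<open>Fatou's lemma for real integrals; it gives square integrability and norm bounds for
  almost everywhere limits of partial sums.\<close>

lemma fatou_bounded:
  fixes f :: "nat \<Rightarrow> 'a \<Rightarrow> real"
  assumes f: "\<And>i. integrable M (f i)" "\<And>i x. 0 \<le> f i x" "\<And>i. (LINT x|M. f i x) \<le> B"
    and g: "g \<in> borel_measurable M" "AE x in M. (\<lambda>i. f i x) \<longlonglongrightarrow> g x"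
  shows "integrable M g" "(LINT x|M. g x) \<le> B"
proof -
  have g0: "AE x in M. 0 \<le> g x"
    using g(2) by eventually_elim (rule LIMSEQ_le_const, auto intro: f(2))
  have "0 \<le> (LINT x|M. f 0 x)" by (rule integral_nonneg_AE) (simp add: f(2))
  then have B: "0 \<le> B" using f(3)[of 0] by simp
  have "(\<integral>\<^sup>+x. ennreal (g x) \<partial>M) = (\<integral>\<^sup>+x. liminf (\<lambda>i. ennreal (f i x)) \<partial>M)"
  proof (rule nn_integral_cong_AE)
    show "AE x in M. ennreal (g x) = liminf (\<lambda>i. ennreal (f i x))"
      using g(2) by eventually_elim (rule lim_imp_Liminf[symmetric], auto intro: tendsto_ennrealI)
  qed
  also have "\<dots> \<le> liminf (\<lambda>i. \<integral>\<^sup>+x. ennreal (f i x) \<partial>M)"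
    using f(1) by (intro nn_integral_liminf) auto
  also have "\<dots> \<le> ennreal B"
  proof (rule Liminf_le)
    show "\<forall>\<^sub>F i in sequentially. (\<integral>\<^sup>+x. ennreal (f i x) \<partial>M) \<le> ennreal B"
      using f by (intro always_eventually allI) (simp add: nn_integral_eq_integral ennreal_leI)
  qed simp
  finally have le: "(\<integral>\<^sup>+x. ennreal (g x) \<partial>M) \<le> ennreal B" .
  show i: "integrable M g"
  proof (rule integrableI_nonneg[OF g(1) g0])
    show "(\<integral>\<^sup>+x. ennreal (g x) \<partial>M) < \<infinity>" using le by (rule order.strict_trans1) simp
  qed
  have "ennreal (LINT x|M. g x) \<le> ennreal B" using nn_integral_eq_integral[OF i g0] le by simp
  then show "(LINT x|M. g x) \<le> B" using B by (simp add: ennreal_le_iff)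
qed

text \<open>The indicator of an arc centred at \<open>m\<close> is a limit of functions of \<open>cos (x - m)\<close>, so the
  one-variable Weierstrass theorem suffices for uniqueness.\<close>

lemma trig_moments_vanish:
  fixes g :: "real \<Rightarrow> real"
  assumes g: "integrable torus g"
    and zero: "\<And>n. (LINT x|torus. complex_of_real (g x) * cis (- (of_int n * x))) = 0"
  shows "integrable torus (\<lambda>x. complex_of_real (g x * cos (x - m) ^ k))
    \<and> (\<forall>n. (LINT x|torus. complex_of_real (g x * cos (x - m) ^ k) * cis (of_int n * x)) = 0)"
proof (induction k)
  case 0
  have "(LINT x|torus. complex_of_real (g x) * cis (of_int n * x)) = 0" for n
    using zero[of "-n"] by simp
  then show ?case using g by simp
next
  case (Suc k)
  define G where "G x = complex_of_real (g x * cos (x - m) ^ k)" for x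
  have G: "integrable torus G" "\<And>n. (LINT x|torus. G x * cis (of_int n * x)) = 0"
    using Suc by (simp_all add: G_def[abs_def])
  have eq: "complex_of_real (g x * cos (x - m) ^ Suc k) = G x * complex_of_real (cos (x - m))" for x
    by (simp add: G_def)
  \<comment> \<open>Multiplication by the cosine shifts frequencies by 1 and -1, hence the induction
    treats all \<open>n\<close> at once.\<close>
  have cos: "complex_of_real (cos (x - m)) * cis (of_int n * x)
      = cis (- m) / 2 * cis (of_int (n + 1) * x) + cis m / 2 * cis (of_int (n - 1) * x)" for x n
  proof -
    have "complex_of_real (cos y) = (cis y + cis (- y)) / 2" for y
      by (simp add: complex_eq_iff)
    then have "complex_of_real (cos (x - m)) * cis (of_int n * x)
        = (cis ((x - m) + of_int n * x) + cis (- (x - m) + of_int n * x)) / 2"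
      by (simp only: times_divide_eq_left distrib_right cis_mult)
    also have "(x - m) + of_int n * x = - m + of_int (n + 1) * x" by (simp add: algebra_simps)
    also have "- (x - m) + of_int n * x = m + of_int (n - 1) * x" by (simp add: algebra_simps)
    finally show ?thesis by (simp only: cis_mult[symmetric] add_divide_distrib times_divide_eq_left)
  qed
  show ?case
    unfolding eq
  proof (intro conjI allI)
    show "integrable torus (\<lambda>x. G x * complex_of_real (cos (x - m)))"
      by (rule integrable_mult_bounded_continuous[OF G(1), where B = 1]) (auto intro!: continuous_intros)
    fix n
    have "(\<lambda>x. G x * complex_of_real (cos (x - m)) * cis (of_int n * x))
        = (\<lambda>x. cis (- m) / 2 * (G x * cis (of_int (n + 1) * x)) + cis m / 2 * (G x * cis (of_int (n - 1) * x)))"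
      unfolding mult.assoc cos by (simp add: algebra_simps fun_eq_iff)
    then have "(LINT x|torus. G x * complex_of_real (cos (x - m)) * cis (of_int n * x))
        = (LINT x|torus. cis (- m) / 2 * (G x * cis (of_int (n + 1) * x)) + cis m / 2 * (G x * cis (of_int (n - 1) * x)))"
      by (simp only:)
    also have "\<dots> = (LINT x|torus. cis (- m) / 2 * (G x * cis (of_int (n + 1) * x)))
         + (LINT x|torus. cis m / 2 * (G x * cis (of_int (n - 1) * x)))"
      by (intro Bochner_Integration.integral_add integrable_mult_right integrable_mult_cis G)
    also have "\<dots> = 0" by (simp only: integral_mult_right_zero G(2) mult_zero_right add_0)
    finally show "(LINT x|torus. G x * complex_of_real (cos (x - m)) * cis (of_int n * x)) = 0" .
  qed
qed

text \<open>Polynomials in cos (x - m) integrate to zero against \<open>g\<close> by linearity.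
  Uniform approximation on [-1, 1] costs at most e times the integral of |g|.\<close>

lemma cos_function_moments_vanish:
  fixes g :: "real \<Rightarrow> real"
  assumes g: "integrable torus g"
    and zero: "\<And>n. (LINT x|torus. complex_of_real (g x) * cis (- (of_int n * x))) = 0"
    and f: "continuous_on UNIV f"
  shows "(LINT x|torus. g x * f (cos (x - m))) = 0"
proof -
  have int: "integrable torus (\<lambda>x. g x * h (cos (x - m)))" if "continuous_on UNIV h" for h :: "real \<Rightarrow> real"
  proof -
    have "compact (h ` {-1..1})"
      using that by (intro compact_continuous_image continuous_on_subset[OF that]) auto
    then have "bounded (h ` {-1..1})" by (rule compact_imp_bounded)
    then obtain B where "\<forall>z\<in>h ` {-1..1}. norm z \<le> B" unfolding bounded_iff by (rule exE)
    then have B: "norm (h y) \<le> B" if "y \<in> {-1..1}" for y using that by (rule bspec[OF _ imageI])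
    have "integrable torus (\<lambda>x. complex_of_real (g x) * complex_of_real (h (cos (x - m))))"
      using g B by (intro integrable_mult_bounded_continuous[where B = B])
        (auto intro!: continuous_intros continuous_on_compose2[OF that])
    then have "integrable torus (\<lambda>x. complex_of_real (g x * h (cos (x - m))))" by simp
    then show ?thesis by (simp only: complex_of_real_integrable_eq)
  qed
  have pow: "(LINT x|torus. g x * cos (x - m) ^ k) = 0" for k
  proof -
    have "(LINT x|torus. complex_of_real (g x * cos (x - m) ^ k) * cis (of_int 0 * x)) = 0"
      using trig_moments_vanish[OF g zero, of m k] by blast
    then have "(LINT x|torus. complex_of_real (g x * cos (x - m) ^ k)) = 0" by simp
    then show ?thesis unfolding integral_complex_of_real by (simp only: of_real_eq_0_iff)
  qed
  define A where "A = (LINT x|torus. \<bar>g x\<bar>)"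
  have A: "0 \<le> A" unfolding A_def by (rule integral_nonneg_AE) simp
  have small: "\<bar>LINT x|torus. g x * f (cos (x - m))\<bar> \<le> e * (A + 1)" if e: "0 < e" for e
  proof -
    obtain p where p: "real_polynomial_function p" "\<And>y. y \<in> {-1..1} \<Longrightarrow> \<bar>f y - p y\<bar> < e"
      using Stone_Weierstrass_real_polynomial_function[of "{-1..1}" f e] continuous_on_subset[OF f] e by auto
    obtain a N where pa: "p = (\<lambda>y. \<Sum>i\<le>N. a i * y ^ i)"
      using p(1) unfolding real_polynomial_function_iff_sum by blast
    have contp: "continuous_on UNIV p" unfolding pa by (intro continuous_intros)
    have "(LINT x|torus. g x * p (cos (x - m))) = (LINT x|torus. (\<Sum>i\<le>N. a i * (g x * cos (x - m) ^ i)))"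
      unfolding pa by (intro Bochner_Integration.integral_cong refl) (simp add: sum_distrib_left mult_ac)
    also have "\<dots> = (\<Sum>i\<le>N. LINT x|torus. a i * (g x * cos (x - m) ^ i))"
      by (intro Bochner_Integration.integral_sum integrable_mult_right int continuous_intros)
    also have "\<dots> = 0" by (simp add: pow)
    finally have "(LINT x|torus. g x * f (cos (x - m))) = (LINT x|torus. g x * f (cos (x - m))) - (LINT x|torus. g x * p (cos (x - m)))"
      by simp
    also have "\<dots> = (LINT x|torus. g x * f (cos (x - m)) - g x * p (cos (x - m)))"
      by (rule Bochner_Integration.integral_diff[symmetric]) (intro int f contp)+
    also have "\<bar>\<dots>\<bar> \<le> (LINT x|torus. e * \<bar>g x\<bar>)"
    proof -
      have "\<bar>g x * f (cos (x - m)) - g x * p (cos (x - m))\<bar> \<le> e * \<bar>g x\<bar>" for x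
        unfolding right_diff_distrib[symmetric] abs_mult
        using p(2)[of "cos (x - m)"] by (subst mult.commute) (auto intro: mult_right_mono less_imp_le)
      then have "(LINT x|torus. \<bar>g x * f (cos (x - m)) - g x * p (cos (x - m))\<bar>) \<le> (LINT x|torus. e * \<bar>g x\<bar>)"
        using g by (intro integral_mono integrable_abs Bochner_Integration.integrable_diff int f contp) auto
      then show ?thesis by (rule order.trans[OF integral_abs_bound])
    qed
    also have "\<dots> = e * A" by (simp add: A_def)
    also have "\<dots> \<le> e * (A + 1)" using e by simp
    finally show ?thesis .
  qed
  have "\<bar>LINT x|torus. g x * f (cos (x - m))\<bar> \<le> 0"
  proof (rule field_le_epsilon)
    fix d :: real assume "0 < d"
    with A have "0 < d / (A + 1)" "d / (A + 1) * (A + 1) = d" by auto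
    with small[of "d / (A + 1)"] show "\<bar>LINT x|torus. g x * f (cos (x - m))\<bar> \<le> 0 + d" by simp
  qed
  then show ?thesis by simp
qed

text \<open>The distance \<open>d\<close> may exceed pi, where the cosine increases again, but d <=
  2 pi - h because the arc lies in [-pi, pi]; the reflection 2 pi - d then settles that
  case.\<close>

lemma arc_iff_cos_gt:
  assumes h: "0 < h" and ab: "- pi \<le> m - h" "m + h \<le> pi" and x: "x \<in> {-pi..pi}"
  shows "cos h < cos (x - m) \<longleftrightarrow> x \<in> {m - h<..<m + h}"
proof -
  define d where "d = \<bar>x - m\<bar>"
  have hp: "h \<le> pi" using ab by simp
  have d: "0 \<le> d" "d \<le> 2 * pi - h" using ab x by (auto simp: d_def)
  have cd: "cos (x - m) = cos d" by (simp add: d_def)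
  have "x \<in> {m - h<..<m + h} \<longleftrightarrow> d < h" by (auto simp: d_def)
  moreover have "cos h < cos d" if "d < h" by (rule cos_monotone_0_pi) (use that d hp in auto)
  moreover have "cos d \<le> cos h" if "h \<le> d"
  proof (cases "d \<le> pi")
    case True
    then show ?thesis using that h by (intro cos_monotone_0_pi_le) auto
  next
    case False
    have "cos (2 * pi - d) \<le> cos h" using False d h by (intro cos_monotone_0_pi_le) auto
    then show ?thesis by (simp add: cos_diff)
  qed
  ultimately show ?thesis unfolding cd by (meson not_le)
qed

lemma arc_integral_vanishes:
  fixes g :: "real \<Rightarrow> real"
  assumes g: "integrable torus g"
    and zero: "\<And>n. (LINT x|torus. complex_of_real (g x) * cis (- (of_int n * x))) = 0"
    and ab: "- pi \<le> a" "a < b" "b \<le> pi"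
  shows "integral {a..b} g = 0"
proof -
  define m h where "m = (a + b) / 2" and "h = (b - a) / 2"
  have mh: "m - h = a" "m + h = b" "0 < h" using ab by (simp_all add: m_def h_def field_simps)
  \<comment> \<open>Continuous ramps in y that converge to the indicator of y > cos h, hence along y
    = cos (x - m) to that of the open arc.\<close>
  define \<phi> where "\<phi> j y = min 1 (max 0 (real j * (y - cos h)))" for j y
  have \<phi>: "(\<lambda>j. \<phi> j (cos (x - m))) \<longlonglongrightarrow> indicat_real {a<..<b} x" if x: "x \<in> {-pi..pi}" for x
  proof (cases "cos h < cos (x - m)")
    case True
    then have ind: "indicat_real {a<..<b} x = 1"
      using arc_iff_cos_gt[of h m x] mh ab x by (simp add: indicator_def)
    have "eventually (\<lambda>j. \<phi> j (cos (x - m)) = 1) sequentially"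
    proof -
      obtain J where J: "1 < real J * (cos (x - m) - cos h)"
        using reals_Archimedean3[of "cos (x - m) - cos h"] True by auto
      show ?thesis unfolding eventually_sequentially
      proof (intro exI allI impI)
        fix j assume "J \<le> j"
        then have "real J * (cos (x - m) - cos h) \<le> real j * (cos (x - m) - cos h)"
          using True by (intro mult_right_mono) auto
        with J show "\<phi> j (cos (x - m)) = 1" by (simp add: \<phi>_def)
      qed
    qed
    then show ?thesis unfolding ind by (rule tendsto_eventually)
  next
    case False
    then have "real j * (cos (x - m) - cos h) \<le> 0" for j by (intro mult_nonneg_nonpos) auto
    then have "\<phi> j (cos (x - m)) = 0" for j by (simp add: \<phi>_def max_absorb1)
    moreover have "indicat_real {a<..<b} x = 0"
      using False arc_iff_cos_gt[of h m x] mh ab x by (simp add: indicator_def)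
    ultimately show ?thesis by simp
  qed
  have cont: "continuous_on UNIV (\<phi> j)" for j
    unfolding \<phi>_def[abs_def] by (intro continuous_intros)
  have "(\<lambda>j. LINT x|torus. g x * \<phi> j (cos (x - m))) \<longlonglongrightarrow> (LINT x|torus. g x * indicat_real {a<..<b} x)"
  proof (rule integral_dominated_convergence[where w = "\<lambda>x. \<bar>g x\<bar>"])
    have "indicat_real {a<..<b} \<in> borel_measurable lebesgue" by (intro borel_measurable_indicator) simp
    then show "(\<lambda>x. g x * indicat_real {a<..<b} x) \<in> borel_measurable torus"
      by (intro borel_measurable_times borel_measurable_integrable[OF g] measurable_torus)
    have "(\<lambda>x. \<phi> j (cos (x - m))) \<in> borel_measurable torus" for j
      by (intro measurable_torus continuous_measurable_lebesgue continuous_on_compose2[OF cont] continuous_intros) auto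
    then show "(\<lambda>x. g x * \<phi> j (cos (x - m))) \<in> borel_measurable torus" for j
      by (intro borel_measurable_times borel_measurable_integrable[OF g])
    show "integrable torus (\<lambda>x. \<bar>g x\<bar>)" using g by simp
    show "AE x in torus. (\<lambda>j. g x * \<phi> j (cos (x - m))) \<longlonglongrightarrow> g x * indicat_real {a<..<b} x"
      by (intro AE_I2 tendsto_intros \<phi>) simp
    have "\<bar>\<phi> j y\<bar> \<le> 1" for j y by (simp add: \<phi>_def)
    then have "\<bar>g x\<bar> * \<bar>\<phi> j y\<bar> \<le> \<bar>g x\<bar>" for x j y by (intro mult_left_le) auto
    then show "AE x in torus. norm (g x * \<phi> j (cos (x - m))) \<le> \<bar>g x\<bar>" for j
      by (intro AE_I2) (simp add: abs_mult)
  qed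
  moreover have "(LINT x|torus. g x * \<phi> j (cos (x - m))) = 0" for j
    by (rule cos_function_moments_vanish[OF g zero cont])
  ultimately have "(LINT x|torus. g x * indicat_real {a<..<b} x) = 0"
    by (simp add: LIMSEQ_const_iff)
  moreover have "(LINT x|torus. g x * indicat_real {a<..<b} x) = integral {-pi..pi} (\<lambda>x. g x * indicat_real {a<..<b} x)"
  proof (rule lebesgue_integral_eq_integral[OF _ torus_sets(1)])
    have "indicat_real {a<..<b} \<in> borel_measurable torus"
      by (intro measurable_torus borel_measurable_indicator) simp
    then have "(\<lambda>x. g x * indicat_real {a<..<b} x) \<in> borel_measurable torus"
      by (intro borel_measurable_times borel_measurable_integrable[OF g])
    then show "integrable torus (\<lambda>x. g x * indicat_real {a<..<b} x)"
      by (rule Bochner_Integration.integrable_bound[OF g]) (auto simp: indicator_def)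
  qed
  moreover have "integral {-pi..pi} (\<lambda>x. g x * indicat_real {a<..<b} x) = integral ({a<..<b} \<inter> {-pi..pi}) g"
    by (subst integral_restrict_Int[symmetric]) (auto intro!: integral_cong simp: indicator_def)
  moreover have "{a<..<b} \<inter> {-pi..pi} = {a<..<b}" using ab by auto
  ultimately show ?thesis by (simp add: integral_open_interval_real)
qed

text \<open>Lebesgue differentiation: almost every value of \<open>g\<close> is a limit of averages
  over short intervals, and all these averages vanish.\<close>

lemma vanishing_fourier_coefficients:
  fixes g :: "real \<Rightarrow> real"
  assumes g: "integrable torus g"
    and zero: "\<And>n. (LINT x|torus. complex_of_real (g x) * cis (- (of_int n * x))) = 0"
  shows "negligible {x \<in> {-pi..pi}. g x \<noteq> 0}"
proof -
  define f where "f x = (if x \<in> {-pi..pi} then g x else 0)" for x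
  have "g integrable_on {-pi..pi}" by (rule integrable_on_lebesgue_on[OF g torus_sets(1)])
  then have "f integrable_on UNIV" unfolding f_def integrable_restrict_UNIV .
  then have "\<And>a b. f integrable_on cbox a b"
    by (rule integrable_on_subcbox) auto
  then obtain N where N: "negligible N"
    "\<And>x e. \<lbrakk>x \<notin> N; 0 < e\<rbrakk> \<Longrightarrow> \<exists>d>0. \<forall>h. 0 < h \<and> h < d \<longrightarrow>
        norm (integral (cbox x (x + h *\<^sub>R One)) f /\<^sub>R h ^ DIM(real) - f x) < e"
    using integrable_ccontinuous_explicit[of f] by blast
  have "f x = 0" if x: "x \<notin> N" "-pi < x" "x < pi" for x
  proof (rule ccontr)
    assume "f x \<noteq> 0"
    then obtain d where d: "0 < d" "\<And>h. 0 < h \<Longrightarrow> h < d \<Longrightarrow> norm (integral {x..x + h} f /\<^sub>R h - f x) < \<bar>f x\<bar>"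
      using N(2)[OF x(1), of "\<bar>f x\<bar>"] by auto
    \<comment> \<open>Keeps the interval inside the period cell, where \<open>f\<close> agrees with
      \<open>g\<close>.\<close>
    define h where "h = min (d / 2) (pi - x)"
    have h: "0 < h" "h < d" "x + h \<le> pi" using d x by (auto simp: h_def)
    have "integral {x..x + h} f = integral {x..x + h} g"
      using h x by (intro integral_cong) (auto simp: f_def)
    also have "\<dots> = 0" using h x by (intro arc_integral_vanishes[OF g zero]) auto
    finally show False using d(2)[OF h(1,2)] by simp
  qed
  then have "{x \<in> {-pi..pi}. g x \<noteq> 0} \<subseteq> N \<union> {-pi, pi}"
    unfolding f_def by force
  moreover have "negligible (N \<union> {-pi, pi})" using N(1) by (intro negligible_Un) auto
  ultimately show ?thesis by (rule negligible_subset[rotated])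
qed

lemma periodic_int:
  fixes u :: "real \<Rightarrow> real"
  assumes "\<And>x. u (x + 2 * pi) = u x" shows "u (x + 2 * pi * of_int k) = u x"
proof -
  have nat: "u (x + 2 * pi * real n) = u x" for n x
  proof (induction n)
    case (Suc n)
    have "u (x + 2 * pi * real (Suc n)) = u (x + 2 * pi * real n + 2 * pi)" by (simp add: algebra_simps)
    then show ?case using assms Suc by simp
  qed simp
  show ?thesis
  proof (cases "0 \<le> k")
    case True
    then show ?thesis using nat[of x "nat k"] by simp
  next
    case False
    then show ?thesis using nat[of "x + 2 * pi * of_int k" "nat (- k)"] by simp
  qed
qed

lemma fourier_coeff_unique:
  assumes u: "u \<in> L2_torus" and v: "v \<in> L2_torus" and eq: "\<And>n. fourier_coeff u n = fourier_coeff v n"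
  shows "AE x in lebesgue. u x = v x"
proof -
  define g where "g x = u x - v x" for x
  have per: "g (x + 2 * pi) = g x" for x using L2_torusD(4)[OF u] L2_torusD(4)[OF v] by (simp add: g_def)
  have int: "integrable torus g" unfolding g_def[abs_def] using L2_torusD(3)[OF u] L2_torusD(3)[OF v] by simp
  have "fourier_coeff g n = 0" for n
    unfolding g_def[abs_def] using fourier_coeff_diff[OF L2_torusD(3)[OF u] L2_torusD(3)[OF v]] eq by simp
  then have neg: "negligible {x \<in> {-pi..pi}. g x \<noteq> 0}"
    by (intro vanishing_fourier_coefficients[OF int]) (simp add: fourier_coeff_torus)
  \<comment> \<open>Periodicity covers the exceptional set by countably many translates of a null
    set in one period.\<close>
  have "{x. u x \<noteq> v x} \<subseteq> (\<Union>k::int. (+) (2 * pi * of_int k) ` {x \<in> {-pi..pi}. g x \<noteq> 0})"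
  proof
    fix x assume "x \<in> {x. u x \<noteq> v x}"
    then have x: "g x \<noteq> 0" by (simp add: g_def)
    define k where "k = \<lfloor>(x + pi) / (2 * pi)\<rfloor>"
    define y where "y = x - 2 * pi * of_int k"
    have "of_int k \<le> (x + pi) / (2 * pi)" "(x + pi) / (2 * pi) < of_int k + 1"
      unfolding k_def by linarith+
    then have "of_int k * (2 * pi) \<le> x + pi" "x + pi < (of_int k + 1) * (2 * pi)"
      by (simp_all add: pos_le_divide_eq pos_divide_less_eq)
    then have "y \<in> {-pi..pi}" by (simp add: y_def algebra_simps)
    moreover have "g y = g x" using periodic_int[of g y k, OF per] by (simp add: y_def)
    ultimately have "y \<in> {x \<in> {-pi..pi}. g x \<noteq> 0}" using x by simp
    moreover have "x = 2 * pi * of_int k + y" by (simp add: y_def)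
    ultimately show "x \<in> (\<Union>k::int. (+) (2 * pi * of_int k) ` {x \<in> {-pi..pi}. g x \<noteq> 0})" by blast
  qed
  moreover have "negligible (\<Union>k::int. (+) (2 * pi * of_int k) ` {x \<in> {-pi..pi}. g x \<noteq> 0})"
    by (rule negligible_countable_Union) (auto simp del: mem_Collect_eq intro!: negligible_translation neg[simplified])
  ultimately have "negligible {x. u x \<noteq> v x}" by (rule negligible_subset[rotated])
  then have "{x. u x \<noteq> v x} \<in> null_sets lebesgue" by (simp add: negligible_iff_null_sets)
  then show ?thesis by (rule AE_I') auto
qed

section \<open>Riesz-Fischer and the converse of Bessel's inequality\<close>

lemma summable_tail_bound:
  fixes h :: "int \<Rightarrow> real"
  assumes h: "\<And>n. 0 \<le> h n" and bdd: "\<And>F. finite F \<Longrightarrow> sum h F \<le> B" and e: "0 < e"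
  obtains N :: int where "1 \<le> N" "\<And>F. finite F \<Longrightarrow> (\<And>n. n \<in> F \<Longrightarrow> N < \<bar>n\<bar>) \<Longrightarrow> sum h F \<le> e"
proof -
  obtain m :: real where m: "1 \<le> m" "\<And>F. finite F \<Longrightarrow> (\<Sum>n\<in>F. min 1 (\<bar>of_int n\<bar> / m) * h n) \<le> e"
    using weighted_tail_small[OF h bdd e] by blast
  show ?thesis
  proof (rule that[of "\<lceil>m\<rceil>"])
    show "1 \<le> \<lceil>m\<rceil>" using m(1) by linarith
    fix F :: "int set" assume F: "finite F" "\<And>n. n \<in> F \<Longrightarrow> \<lceil>m\<rceil> < \<bar>n\<bar>"
    have "min 1 (\<bar>of_int n\<bar> / m) = 1" if "n \<in> F" for n
    proof -
      have "m \<le> \<bar>of_int n\<bar>" using F(2)[OF that] by linarith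
      then show ?thesis using m(1) by simp
    qed
    then have "sum h F = (\<Sum>n\<in>F. min 1 (\<bar>of_int n\<bar> / m) * h n)" by (intro sum.cong) auto
    then show "sum h F \<le> e" using m(2)[OF F(1)] by simp
  qed
qed

lemma AE_summable_of_summable_integrals:
  fixes f :: "nat \<Rightarrow> 'a \<Rightarrow> real"
  assumes f: "\<And>i. integrable M (f i)" and s: "summable (\<lambda>i. LINT x|M. \<bar>f i x\<bar>)"
  shows "AE x in M. summable (\<lambda>i. \<bar>f i x\<bar>)"
proof -
  have m: "(\<lambda>x. ennreal \<bar>f i x\<bar>) \<in> borel_measurable M" for i
    using f[of i] by measurable
  have "(\<integral>\<^sup>+x. (\<Sum>i. ennreal \<bar>f i x\<bar>) \<partial>M) = (\<Sum>i. \<integral>\<^sup>+x. ennreal \<bar>f i x\<bar> \<partial>M)"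
    by (rule nn_integral_suminf[OF m])
  also have "\<dots> = (\<Sum>i. ennreal (LINT x|M. \<bar>f i x\<bar>))"
    using f by (intro suminf_cong nn_integral_eq_integral) auto
  also have "\<dots> \<noteq> \<infinity>"
    unfolding infinity_ennreal_def by (rule ennreal_suminf_neq_top[OF s]) (rule integral_nonneg_AE, simp)
  finally have "AE x in M. (\<Sum>i. ennreal \<bar>f i x\<bar>) \<noteq> \<infinity>"
    using m by (intro nn_integral_PInf_AE borel_measurable_suminf) auto
  then show ?thesis
    by eventually_elim (rule summable_suminf_not_top, auto)
qed

lemma trig_sum_hermitian_real:
  assumes "hermitian c" shows "trig_sum {-N..N} c x = complex_of_real (Re (trig_sum {-N..N} c x))"
proof -
  have "cnj (trig_sum {-N..N} c x) = (\<Sum>n\<in>{-N..N}. c (- n) * cis (of_int (- n) * x))"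
    using assms by (simp add: trig_sum_def hermitian_def cis_cnj cnj_sum)
  also have "\<dots> = trig_sum {-N..N} c x"
    unfolding trig_sum_def by (rule sum.reindex_bij_witness[of _ uminus uminus]) auto
  finally show ?thesis by (simp add: complex_eq_iff)
qed

text \<open>Windows are chosen so that consecutive partial sums differ by at most 2 pi 4^(-j) in
  squared L^2 norm. Then the L^1 norms of the increments are summable, the partial sums converge
  almost everywhere, and Fatou transfers the bounds.\<close>

theorem riesz_fischer:
  assumes herm: "hermitian c" and bdd: "\<And>F. finite F \<Longrightarrow> (\<Sum>n\<in>F. (cmod (c n))\<^sup>2) \<le> B"
  obtains w where "w \<in> L2_torus" "\<And>n. fourier_coeff w n = c n" "(LINT x|torus. (w x)\<^sup>2) \<le> 2 * pi * B"
proof -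
  define h where "h n = (cmod (c n))\<^sup>2" for n
  have "\<exists>N::int. 1 \<le> N \<and> (\<forall>F. finite F \<longrightarrow> (\<forall>n\<in>F. N < \<bar>n\<bar>) \<longrightarrow> sum h F \<le> (1/4) ^ j)" for j :: nat
    using summable_tail_bound[of h B "(1/4) ^ j"] bdd by (auto simp: h_def) metis
  then obtain N0 :: "nat \<Rightarrow> int" where N0: "\<And>j. 1 \<le> N0 j"
    "\<And>j F. finite F \<Longrightarrow> (\<forall>n\<in>F. N0 j < \<bar>n\<bar>) \<Longrightarrow> sum h F \<le> (1/4) ^ j" by metis
  \<comment> \<open>Cumulative sums make the windows nested and, since each \<open>N0 i\<close> is
    at least 1, exhausting.\<close>
  define N where "N j = (\<Sum>i\<le>j. N0 i)" for j
  have N_ge: "N0 j \<le> N j" for j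
    unfolding N_def using N0(1) by (intro member_le_sum) (auto intro: order.trans[OF zero_le_one])
  have N_mono: "N i \<le> N j" if "i \<le> j" for i j
    unfolding N_def using N0(1) that by (intro sum_mono2) (auto intro: order.trans[OF zero_le_one])
  have N_large: "int j \<le> N j" for j
  proof -
    have "(\<Sum>i\<le>j. 1) \<le> N j" unfolding N_def using N0(1) by (intro sum_mono) auto
    then show ?thesis by simp
  qed
  define I where "I j = {- N j..N j}" for j
  define s where "s j x = Re (trig_sum (I j) c x)" for j x
  have s: "complex_of_real (s j x) = trig_sum (I j) c x" for j x
    unfolding s_def I_def by (rule trig_sum_hermitian_real[OF herm, symmetric])
  have s_cont: "continuous_on UNIV (s j)" for j
    unfolding s_def[abs_def] by (intro continuous_intros continuous_trig_sum)
  have s_per: "s j (x + 2 * pi) = s j x" for j x by (simp add: s_def trig_sum_periodic)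
  have s_int: "(LINT x|torus. (s j x)\<^sup>2) \<le> 2 * pi * B" for j
  proof -
    have "(s j x)\<^sup>2 = (cmod (trig_sum (I j) c x))\<^sup>2" for x
      unfolding s[symmetric] by simp
    then have "(LINT x|torus. (s j x)\<^sup>2) = 2 * pi * (\<Sum>n\<in>I j. (cmod (c n))\<^sup>2)"
      using integral_trig_sum_norm_square[of "I j" c] by (simp add: I_def)
    also have "\<dots> \<le> 2 * pi * B" using bdd[of "I j"] by (intro mult_left_mono) (auto simp: I_def)
    finally show ?thesis .
  qed
  have d_int: "(LINT x|torus. (s i x - s j x)\<^sup>2) \<le> 2 * pi * (1/4) ^ j" if "j \<le> i" for i j
  proof -
    have sub: "I j \<subseteq> I i" using N_mono[OF that] by (auto simp: I_def)
    have "(s i x - s j x)\<^sup>2 = (cmod (trig_sum (I i - I j) c x))\<^sup>2" for x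
    proof -
      have "complex_of_real (s i x - s j x) = trig_sum (I i - I j) c x"
        unfolding of_real_diff s trig_sum_def using sub by (subst sum_diff) (auto simp: I_def)
      then show ?thesis by (metis norm_of_real power2_abs)
    qed
    then have "(LINT x|torus. (s i x - s j x)\<^sup>2) = 2 * pi * sum h (I i - I j)"
      using integral_trig_sum_norm_square[of "I i - I j" c] by (simp add: I_def h_def)
    also have "\<dots> \<le> 2 * pi * (1/4) ^ j"
    proof (intro mult_left_mono N0(2) ballI)
      fix n assume "n \<in> I i - I j"
      then show "N0 j < \<bar>n\<bar>" using N_ge[of j] by (auto simp: I_def)
    qed (auto simp: I_def)
    finally show ?thesis .
  qed
  define d where "d j x = s (Suc j) x - s j x" for j x
  have d_cont: "continuous_on UNIV (d j)" for j unfolding d_def[abs_def] by (intro continuous_intros s_cont)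
  have d_abs: "(LINT x|torus. \<bar>d j x\<bar>) \<le> 2 * pi * (1/2) ^ j" for j
  proof -
    \<comment> \<open>Young's inequality with parameter 2^j, which turns the L^2 bound of order
      4^(-j) into an L^1 bound of order 2^(-j).\<close>
    have "\<bar>y\<bar> \<le> 2 ^ j / 2 * y\<^sup>2 + (1/2) ^ j / 2" for y :: real
    proof -
      have "0 \<le> (2 ^ j * \<bar>y\<bar> - 1)\<^sup>2 / (2 * 2 ^ j)" by simp
      also have "\<dots> = 2 ^ j / 2 * y\<^sup>2 + (1/2) ^ j / 2 - \<bar>y\<bar>"
        by (simp add: power2_eq_square field_simps)
      finally show ?thesis by simp
    qed
    then have "(LINT x|torus. \<bar>d j x\<bar>) \<le> (LINT x|torus. 2 ^ j / 2 * (d j x)\<^sup>2 + (1/2) ^ j / 2)"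
      by (intro integral_mono integrable_torus_continuous continuous_intros d_cont)
    also have "\<dots> = (LINT x|torus. 2 ^ j / 2 * (d j x)\<^sup>2) + (LINT x|torus. (1/2) ^ j / 2)"
      by (intro Bochner_Integration.integral_add integrable_torus_continuous continuous_intros d_cont)
    also have "(LINT x|torus. 2 ^ j / 2 * (d j x)\<^sup>2) \<le> 2 ^ j / 2 * (2 * pi * (1/4) ^ j)"
      using d_int[of j "Suc j"] by (simp add: d_def)
    also have "(LINT x|torus. (1/2) ^ j / 2) = 2 * pi * ((1/2::real) ^ j / 2)"
      by (simp add: measure_restrict_space torus_sets)
    also have "2 ^ j / 2 * (2 * pi * (1/4) ^ j) + 2 * pi * ((1/2) ^ j / 2) = 2 * pi * (1/2) ^ j"
    proof -
      have "(2::real) ^ j * (1/4) ^ j = (1/2) ^ j" by (simp flip: power_mult_distrib)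
      then show ?thesis by (simp add: algebra_simps)
    qed
    finally show ?thesis by simp
  qed
  have d_summable: "AE x in torus. summable (\<lambda>j. \<bar>d j x\<bar>)"
  proof (rule AE_summable_of_summable_integrals)
    show "integrable torus (d j)" for j by (rule integrable_torus_continuous[OF d_cont])
    show "summable (\<lambda>j. LINT x|torus. \<bar>d j x\<bar>)"
    proof (rule summable_comparison_test')
      show "summable (\<lambda>j. 2 * pi * (1/2::real) ^ j)" by (intro summable_mult summable_geometric) simp
      show "norm (LINT x|torus. \<bar>d j x\<bar>) \<le> 2 * pi * (1/2) ^ j" if "0 \<le> j" for j
        using d_abs[of j] by (simp add: integral_nonneg_AE)
    qed
  qed
  \<comment> \<open>Taken at every point, with an unspecified value where the limit fails to exist.
    Thus \<open>w\<close> is exactly periodic, as every \<open>s j\<close> is.\<close>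
  define w where "w x = lim (\<lambda>j. s j x)" for x
  have lim: "AE x in torus. (\<lambda>j. s j x) \<longlonglongrightarrow> w x"
    using d_summable
  proof eventually_elim
    case (elim x)
    then have "summable (\<lambda>j. d j x)" by (rule summable_rabs_cancel)
    then have "(\<lambda>j. \<Sum>i<j. d i x) \<longlonglongrightarrow> (\<Sum>i. d i x)" by (rule summable_LIMSEQ)
    moreover have "(\<Sum>i<j. d i x) = s j x - s 0 x" for j
      unfolding d_def by (rule sum_lessThan_telescope)
    ultimately have "(\<lambda>j. s j x - s 0 x + s 0 x) \<longlonglongrightarrow> (\<Sum>i. d i x) + s 0 x"
      by (intro tendsto_add) auto
    then show ?case by (simp add: w_def limI)
  qed
  have w_meas: "w \<in> borel_measurable lebesgue"
    unfolding w_def[abs_def] by (intro borel_measurable_lim_metric continuous_measurable_lebesgue s_cont)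
  have w_meas': "w \<in> borel_measurable torus" by (rule measurable_torus[OF w_meas])
  have s_meas: "s j \<in> borel_measurable torus" for j
    by (intro measurable_torus continuous_measurable_lebesgue s_cont)
  note F1 = fatou_bounded[where f = "\<lambda>j x. (s j x)\<^sup>2" and g = "\<lambda>x. (w x)\<^sup>2" and M = torus and B = "2 * pi * B"]
  have w2: "integrable torus (\<lambda>x. (w x)\<^sup>2)" "(LINT x|torus. (w x)\<^sup>2) \<le> 2 * pi * B"
  proof -
    have l: "AE x in torus. (\<lambda>j. (s j x)\<^sup>2) \<longlonglongrightarrow> (w x)\<^sup>2"
      using lim by eventually_elim (intro tendsto_intros)
    have m: "(\<lambda>x. (w x)\<^sup>2) \<in> borel_measurable torus" using w_meas' by measurable
    have i: "integrable torus (\<lambda>x. (s j x)\<^sup>2)" for j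
      by (intro integrable_torus_continuous continuous_intros s_cont)
    show "integrable torus (\<lambda>x. (w x)\<^sup>2)" by (rule F1(1)[OF i zero_le_power2 s_int m l])
    show "(LINT x|torus. (w x)\<^sup>2) \<le> 2 * pi * B" by (rule F1(2)[OF i zero_le_power2 s_int m l])
  qed
  have w_L2: "w \<in> L2_torus"
    using w_meas w2(1) by (simp add: L2_torus_def set_integrable_torus w_def s_per)
  have s_L2: "s j \<in> L2_torus" for j by (rule L2_torus_continuous[OF s_cont s_per])
  have diff: "(LINT x|torus. (w x - s j x)\<^sup>2) \<le> 2 * pi * (1/4) ^ j" for j
  proof (rule fatou_bounded(2)[where f = "\<lambda>i x. (s (i + j) x - s j x)\<^sup>2"])
    show "(\<lambda>x. (w x - s j x)\<^sup>2) \<in> borel_measurable torus" using w_meas' s_meas[of j] by measurable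
    show "AE x in torus. (\<lambda>i. (s (i + j) x - s j x)\<^sup>2) \<longlonglongrightarrow> (w x - s j x)\<^sup>2"
      using lim by eventually_elim (intro tendsto_intros LIMSEQ_ignore_initial_segment)
  qed (auto intro!: integrable_torus_continuous continuous_intros s_cont d_int)
  have "fourier_coeff w n = c n" for n
  proof -
    \<comment> \<open>Bessel's inequality for the single mode \<open>n\<close> of
      \<open>w - s j\<close>.\<close>
    have le: "(cmod (fourier_coeff w n - c n))\<^sup>2 \<le> (1/4) ^ j" if j: "nat \<bar>n\<bar> \<le> j" for j
    proof -
      have "fourier_coeff (s j) n = (LINT x|torus. trig_sum (I j) c x * cis (- (of_int n * x))) / (2 * pi)"
        by (simp add: fourier_coeff_torus s)
      also have "\<dots> = c n"
        using j N_large[of j] by (subst integral_trig_sum_cis) (auto simp: I_def)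
      finally have "fourier_coeff (\<lambda>x. w x - s j x) n = fourier_coeff w n - c n"
        using fourier_coeff_diff[OF L2_torusD(3)[OF w_L2] L2_torusD(3)[OF s_L2]] by simp
      moreover have "2 * pi * (\<Sum>n\<in>{n}. (cmod (fourier_coeff (\<lambda>x. w x - s j x) n))\<^sup>2) \<le> 2 * pi * (1/4) ^ j"
        by (rule order.trans[OF bessel_inequality[OF L2_torus_diff[OF w_L2 s_L2]] diff]) simp
      ultimately show ?thesis by simp
    qed
    have "(\<lambda>j. (1/4::real) ^ j) \<longlonglongrightarrow> 0" by (rule LIMSEQ_power_zero) simp
    then have "(cmod (fourier_coeff w n - c n))\<^sup>2 \<le> 0"
      by (rule LIMSEQ_le_const) (use le in blast)
    then show ?thesis by simp
  qed
  with w_L2 w2(2) that show ?thesis by blast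
qed

text \<open>The converse of Bessel's inequality: by uniqueness \<open>u\<close> agrees almost
  everywhere with the Riesz-Fischer function of its own coefficients, for which the bound is
  known.\<close>

lemma L2_bound_of_coefficients:
  assumes u: "u \<in> L2_torus" and bdd: "\<And>F. finite F \<Longrightarrow> (\<Sum>n\<in>F. (cmod (fourier_coeff u n))\<^sup>2) \<le> B"
  shows "(LINT x|torus. (u x)\<^sup>2) \<le> 2 * pi * B"
proof -
  obtain w where w: "w \<in> L2_torus" "\<And>n. fourier_coeff w n = fourier_coeff u n" "(LINT x|torus. (w x)\<^sup>2) \<le> 2 * pi * B"
    using riesz_fischer[OF fourier_coeff_hermitian bdd] by blast
  have "AE x in lebesgue. u x = w x" by (rule fourier_coeff_unique[OF u w(1)]) (simp add: w(2))
  then have "AE x in torus. u x = w x"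
    by (simp add: AE_restrict_space_iff torus_sets) (auto elim: eventually_mono)
  then have "AE x in torus. (u x)\<^sup>2 = (w x)\<^sup>2" by eventually_elim simp
  then have "(LINT x|torus. (u x)\<^sup>2) = (LINT x|torus. (w x)\<^sup>2)"
    by (intro integral_cong_AE borel_measurable_power measurable_torus L2_torusD(1) u w(1))
  with w(3) show ?thesis by simp
qed

section \<open>The logarithmic kernel\<close>

definition log_kernel :: "real \<Rightarrow> real" where
  "log_kernel y = ln (4 * (sin (y / 2))\<^sup>2)"

text \<open>One factor of the sine removes the logarithmic singularity; at 0 the value
  \<open>ln 0 * 0 = 0\<close> is the limit.\<close>

lemma continuous_mult_ln_square: "continuous_on UNIV (\<lambda>s::real. ln (4 * s\<^sup>2) * s)"
proof -
  have "isCont (\<lambda>s::real. ln (4 * s\<^sup>2) * s) s" for s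
  proof (cases "s = 0")
    case True
    have "((\<lambda>s::real. ln (4 * s\<^sup>2) * s) \<longlongrightarrow> 0) (at_right 0)" by real_asymp
    moreover have "((\<lambda>s::real. ln (4 * s\<^sup>2) * s) \<longlongrightarrow> 0) (at_left 0)" by real_asymp
    ultimately show ?thesis using True by (simp add: isCont_def filterlim_split_at)
  next
    case False
    then show ?thesis by (intro continuous_intros) auto
  qed
  then show ?thesis by (simp add: continuous_at_imp_continuous_on)
qed

lemma log_kernel_minus: "log_kernel (- y) = log_kernel y"
  by (simp add: log_kernel_def)

lemma log_kernel_periodic: "log_kernel (y + 2 * pi) = log_kernel y"
proof -
  have "sin ((y + 2 * pi) / 2) = - sin (y / 2)" by (simp add: add_divide_distrib)
  then show ?thesis by (simp only: log_kernel_def power2_minus)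
qed

lemma finite_sin_half_zeros:
  fixes a b :: real
  shows "finite {y \<in> {a..b}. sin (y / 2) = 0}"
proof -
  have "{y \<in> {a..b}. sin (y / 2) = 0} \<subseteq> (\<lambda>k. 2 * pi * of_int k) ` {\<lceil>a / (2 * pi)\<rceil>..\<lfloor>b / (2 * pi)\<rfloor>}"
  proof
    fix y assume "y \<in> {y \<in> {a..b}. sin (y / 2) = 0}"
    then have y: "a \<le> y" "y \<le> b" "sin (y / 2) = 0" by auto
    then obtain k :: int where "y / 2 = of_int k * pi" by (auto simp: sin_zero_iff_int2)
    then have k: "y = 2 * pi * of_int k" by simp
    have "a / (2 * pi) \<le> of_int k" "of_int k \<le> b / (2 * pi)"
      using y k by (simp_all add: pos_divide_le_eq pos_le_divide_eq mult.commute)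
    then have "k \<in> {\<lceil>a / (2 * pi)\<rceil>..\<lfloor>b / (2 * pi)\<rfloor>}" by (simp add: ceiling_le_iff le_floor_iff)
    with k show "y \<in> (\<lambda>k. 2 * pi * of_int k) ` {\<lceil>a / (2 * pi)\<rceil>..\<lfloor>b / (2 * pi)\<rfloor>}" by blast
  qed
  then show ?thesis by (rule finite_subset) simp
qed

lemma cis_minus_one: "cis y - 1 = 2 * \<i> * of_real (sin (y / 2)) * cis (y / 2)"
proof -
  have "cis y = cis (y / 2) * cis (y / 2)" by (simp add: cis_mult)
  moreover have "1 = cis (y / 2) * cis (- (y / 2))" by (simp add: cis_mult)
  moreover have "cis (y / 2) - cis (- (y / 2)) = 2 * \<i> * of_real (sin (y / 2))" by (simp add: complex_eq_iff)
  ultimately show ?thesis by (metis mult.commute right_diff_distrib)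
qed

lemma cis_plus_one: "cis y + 1 = 2 * of_real (cos (y / 2)) * cis (y / 2)"
proof -
  have "cis y = cis (y / 2) * cis (y / 2)" by (simp add: cis_mult)
  moreover have "1 = cis (y / 2) * cis (- (y / 2))" by (simp add: cis_mult)
  moreover have "cis (y / 2) + cis (- (y / 2)) = 2 * of_real (cos (y / 2))" by (simp add: complex_eq_iff)
  ultimately show ?thesis by (metis mult.commute distrib_left)
qed

lemma cis_power_minus_one: "cis (real m * y) - 1 = (cis y - 1) * (\<Sum>k<m. cis (real k * y))"
  unfolding Complex.DeMoivre[symmetric] by (rule power_diff_1_eq)

lemma log_kernel_derivative:
  assumes "sin (y / 2) \<noteq> 0"
  shows "(log_kernel has_real_derivative cos (y / 2) / sin (y / 2)) (at y)"
proof -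
  have "0 < 4 * (sin (y / 2))\<^sup>2" using assms by simp
  moreover have "((\<lambda>y. 4 * (sin (y / 2))\<^sup>2) has_real_derivative 4 * (sin (y / 2) * cos (y / 2))) (at y)"
    by (auto intro!: derivative_eq_intros)
  ultimately have "((\<lambda>y. ln (4 * (sin (y / 2))\<^sup>2)) has_real_derivative
      inverse (4 * (sin (y / 2))\<^sup>2) * (4 * (sin (y / 2) * cos (y / 2)))) (at y)"
    by (rule DERIV_chain2[OF DERIV_ln])
  moreover have "inverse (4 * (sin (y / 2))\<^sup>2) * (4 * (sin (y / 2) * cos (y / 2))) = cos (y / 2) / sin (y / 2)"
  proof -
    have "inverse (4 * s\<^sup>2) * (4 * (s * c)) = c / s" if "s \<noteq> 0" for s c :: real
      using that by (simp add: field_simps power2_eq_square)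
    from this[OF assms] show ?thesis .
  qed
  ultimately show ?thesis by (simp add: log_kernel_def[abs_def])
qed

text \<open>The factor \<open>cis (m y) - 1\<close> in the primitive cancels the singularity of the kernel, and
  \<open>cot (y/2) (cis (m y) - 1)\<close> is a trigonometric polynomial.\<close>

lemma log_kernel_has_integral:
  assumes m: "0 < m"
  shows "((\<lambda>y. of_real (log_kernel y) * cis (real m * y)) has_integral - of_real (2 * pi / real m)) {a..a + 2 * pi}"
proof -
  define E where "E y = (\<Sum>k<m. cis (real k * y))" for y
  define G where "G y = of_real (log_kernel y) * (cis (real m * y) - 1) / (\<i> * of_nat m)" for y
  have Gcont: "continuous_on UNIV G"
  proof -
    define Q where "Q y = ln (4 * (sin (y / 2))\<^sup>2) * sin (y / 2)" for y :: real
    have "G = (\<lambda>y. of_real (Q y) * (2 * \<i> * cis (y / 2) * E y) / (\<i> * of_nat m))"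
      unfolding G_def[abs_def] cis_power_minus_one[of m] E_def[symmetric]
      by (simp add: Q_def log_kernel_def cis_minus_one fun_eq_iff)
    moreover have "continuous_on UNIV Q"
      unfolding Q_def[abs_def]
      by (rule continuous_on_compose2[OF continuous_mult_ln_square]) (auto intro!: continuous_intros)
    moreover have "continuous_on UNIV E" unfolding E_def[abs_def] by (intro continuous_intros)
    ultimately show ?thesis using m by (simp only:) (intro continuous_intros, auto)
  qed
  have Gper: "G (y + 2 * pi) = G y" for y
    using cis_periodic[of "int m" y] by (simp add: G_def log_kernel_periodic)
  have Gder: "(G has_vector_derivative of_real (log_kernel y) * cis (real m * y) + (cis y + 1) * E y / of_nat m) (at y)"
    if y: "sin (y / 2) \<noteq> 0" for y
  proof -
    have 1: "((\<lambda>y. complex_of_real (log_kernel y)) has_vector_derivative complex_of_real (cos (y / 2) / sin (y / 2))) (at y)"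
      using log_kernel_derivative[OF y] by (intro has_vector_derivative_of_real) (simp add: has_real_derivative_iff_has_vector_derivative)
    have 2: "((\<lambda>y. (cis (real m * y) - 1) / (\<i> * of_nat m)) has_vector_derivative cis (real m * y)) (at y)"
      using m by (auto intro!: derivative_eq_intros has_vector_derivative_cis)
    have "((\<lambda>y. complex_of_real (log_kernel y) * ((cis (real m * y) - 1) / (\<i> * of_nat m))) has_vector_derivative
        (complex_of_real (log_kernel y) * cis (real m * y)
          + complex_of_real (cos (y / 2) / sin (y / 2)) * ((cis (real m * y) - 1) / (\<i> * of_nat m)))) (at y)"
      by (rule has_vector_derivative_mult[OF 1 2])
    moreover have "complex_of_real (cos (y / 2) / sin (y / 2)) * ((cis (real m * y) - 1) / (\<i> * of_nat m)) = (cis y + 1) * E y / of_nat m"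
    proof -
      have "complex_of_real (cos (y / 2) / sin (y / 2)) * (cis (real m * y) - 1) = \<i> * ((cis y + 1) * E y)"
        using y unfolding cis_power_minus_one[of m y] cis_plus_one[of y] E_def[symmetric] by (simp add: cis_minus_one[of y])
      then show ?thesis using m unfolding times_divide_eq_right by (simp only:) simp
    qed
    ultimately show ?thesis by (simp add: G_def[abs_def])
  qed
  \<comment> \<open>The primitive is continuous everywhere and differentiable off the finitely many
    zeros of the sine. By periodicity its increment over a period is 0.\<close>
  have "((\<lambda>y. of_real (log_kernel y) * cis (real m * y) + (cis y + 1) * E y / of_nat m) has_integral G (a + 2 * pi) - G a) {a..a + 2 * pi}"
    by (rule fundamental_theorem_of_calculus_interior_strong[OF finite_sin_half_zeros[of a "a + 2 * pi"]])
       (auto intro: Gder continuous_on_subset[OF Gcont])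
  then have 1: "((\<lambda>y. of_real (log_kernel y) * cis (real m * y) + (cis y + 1) * E y / of_nat m) has_integral 0) {a..a + 2 * pi}"
    by (simp add: Gper)
  have cis_int: "((\<lambda>y. cis (real k * y)) has_integral (if k = 0 then of_real (2 * pi) else 0)) {a..a + 2 * pi}" for k
    using has_integral_cis_period[of "int k" a] by simp
  \<comment> \<open>Of all these modes only k = 0 in the second sum has nonzero mean; it yields 2
    pi.\<close>
  have "(cis y + 1) * E y = (\<Sum>k<m. cis (real (Suc k) * y)) + (\<Sum>k<m. cis (real k * y))" for y
    by (simp add: E_def distrib_right sum_distrib_left cis_mult algebra_simps sum.distrib)
  moreover have "((\<lambda>y. (\<Sum>k<m. cis (real (Suc k) * y)) + (\<Sum>k<m. cis (real k * y))) has_integral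
      (\<Sum>k<m. 0) + (\<Sum>k<m. (if k = 0 then of_real (2 * pi) else 0))) {a..a + 2 * pi}"
    using cis_int[of "Suc _"] by (intro has_integral_add has_integral_sum cis_int) auto
  ultimately have "((\<lambda>y. (cis y + 1) * E y) has_integral of_real (2 * pi)) {a..a + 2 * pi}"
    using m by simp
  then have "((\<lambda>y. (cis y + 1) * E y / of_nat m) has_integral of_real (2 * pi) / of_nat m) {a..a + 2 * pi}"
    by (rule has_integral_divide)
  from has_integral_diff[OF 1 this] show ?thesis by simp
qed

lemma log_kernel_shift_integral:
  assumes m: "0 < m"
  shows "((\<lambda>\<beta>. of_real (log_kernel (\<beta> - \<alpha>)) * cis (real m * (\<beta> - \<alpha>))) has_integral - of_real (2 * pi / real m)) {-pi..pi}"
proof -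
  have "((\<lambda>y. of_real (log_kernel y) * cis (real m * y)) has_integral - of_real (2 * pi / real m)) (cbox (- pi + - \<alpha>) (pi + - \<alpha>))"
    using log_kernel_has_integral[OF m, of "- pi - \<alpha>"] by (simp add: algebra_simps)
  from has_integral_shift_cbox[OF this, of "- \<alpha>"]
  show ?thesis by (simp add: o_def algebra_simps)
qed

text \<open>Multiplied by the cosine \<open>h\<close>, the kernel has a gauge integral by the
  preceding computation and is bounded above, hence is absolutely integrable. The remainder with
  factor 1 - h is continuous.\<close>

lemma integrable_log_kernel: "integrable torus (\<lambda>\<beta>. log_kernel (\<alpha> - \<beta>))"
proof -
  define k where "k \<beta> = log_kernel (\<beta> - \<alpha>)" for \<beta>
  define h where "h \<beta> = cos (\<beta> - \<alpha>)" for \<beta>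
  have "((\<lambda>\<beta>. Re (of_real (log_kernel (\<beta> - \<alpha>)) * cis (real 1 * (\<beta> - \<alpha>)))) has_integral Re (- of_real (2 * pi / real 1))) {-pi..pi}"
    by (rule has_integral_Re[OF log_kernel_shift_integral]) simp
  then have HK: "(\<lambda>\<beta>. k \<beta> * h \<beta>) integrable_on {-pi..pi}"
    by (auto simp: k_def h_def)
  \<comment> \<open>With s the squared sine, h = 1 - 2 s. Where h >= 0 the logarithm is at most ln
    4; where h < 0 one has 4 s > 2, so the logarithm is positive and the product negative.\<close>
  have le: "k \<beta> * h \<beta> \<le> ln 4" for \<beta>
  proof (cases "sin ((\<beta> - \<alpha>) / 2) = 0")
    case True
    then show ?thesis by (simp add: k_def log_kernel_def)
  next
    case False
    define s where "s = (sin ((\<beta> - \<alpha>) / 2))\<^sup>2"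
    have s: "0 < s" "s \<le> 1" using False by (simp_all add: s_def power_le_one_iff abs_square_le_1)
    have h: "h \<beta> = 1 - 2 * s"
    proof -
      have "h \<beta> = cos (2 * ((\<beta> - \<alpha>) / 2))" unfolding h_def by (rule arg_cong[where f = cos]) simp
      then show ?thesis unfolding cos_double_sin s_def .
    qed
    have k: "k \<beta> = ln (4 * s)" by (simp add: k_def log_kernel_def s_def)
    show ?thesis
    proof (cases "2 * s \<le> 1")
      case True
      have "ln (4 * s) * (1 - 2 * s) \<le> ln 4 * (1 - 2 * s)"
        using True s by (intro mult_right_mono) auto
      also have "\<dots> \<le> ln 4" using s True by (intro mult_left_le) auto
      finally show ?thesis by (simp add: h k)
    next
      case False
      then have "0 \<le> ln (4 * s)" by simp
      then have "ln (4 * s) * (1 - 2 * s) \<le> 0" using False by (intro mult_nonneg_nonpos) auto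
      also have "\<dots> \<le> ln (4::real)" by simp
      finally show ?thesis by (simp add: h k)
    qed
  qed
  have "(\<lambda>\<beta>. k \<beta> * h \<beta>) absolutely_integrable_on {-pi..pi}"
    by (rule absolutely_integrable_absolutely_integrable_ubound[OF HK, of "\<lambda>_. ln 4"])
       (auto intro: le absolutely_integrable_continuous_real)
  then have 1: "integrable torus (\<lambda>\<beta>. k \<beta> * h \<beta>)" by (simp only: set_integrable_torus)
  define Q where "Q \<beta> = ln (4 * (sin ((\<beta> - \<alpha>) / 2))\<^sup>2) * sin ((\<beta> - \<alpha>) / 2)" for \<beta>
  have "k \<beta> * (1 - h \<beta>) = 2 * Q \<beta> * sin ((\<beta> - \<alpha>) / 2)" for \<beta>
  proof -
    have "h \<beta> = cos (2 * ((\<beta> - \<alpha>) / 2))" unfolding h_def by (rule arg_cong[where f = cos]) simp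
    also have "\<dots> = 1 - 2 * (sin ((\<beta> - \<alpha>) / 2))\<^sup>2" by (rule cos_double_sin)
    finally show ?thesis by (simp add: Q_def k_def log_kernel_def power2_eq_square)
  qed
  moreover have "continuous_on UNIV Q"
    unfolding Q_def[abs_def]
    by (rule continuous_on_compose2[OF continuous_mult_ln_square]) (auto intro!: continuous_intros)
  ultimately have 2: "integrable torus (\<lambda>\<beta>. k \<beta> * (1 - h \<beta>))"
    by (simp only:) (intro integrable_torus_continuous continuous_intros, auto)
  have "(\<lambda>\<beta>. k \<beta> * h \<beta> + k \<beta> * (1 - h \<beta>)) = (\<lambda>\<beta>. log_kernel (\<alpha> - \<beta>))"
    using log_kernel_minus[of "\<alpha> - _"] by (simp add: k_def fun_eq_iff algebra_simps)
  with Bochner_Integration.integrable_add[OF 1 2] show ?thesis by simp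
qed

lemma log_kernel_fourier:
  assumes n: "n \<noteq> 0"
  shows "(LINT \<beta>|torus. complex_of_real (log_kernel (\<alpha> - \<beta>)) * cis (of_int n * \<beta>))
     = - of_real (2 * pi / \<bar>of_int n\<bar>) * cis (of_int n * \<alpha>)"
proof -
  have int: "integrable torus (\<lambda>\<beta>. complex_of_real (log_kernel (\<alpha> - \<beta>)) * cis (c * \<beta>))" for c
    using integrable_log_kernel by (intro integrable_mult_cis) simp
  have pos: "(LINT \<beta>|torus. complex_of_real (log_kernel (\<alpha> - \<beta>)) * cis (real m * \<beta>))
     = - of_real (2 * pi / real m) * cis (real m * \<alpha>)" if m: "0 < m" for m :: nat
  proof -
    have "((\<lambda>\<beta>. of_real (log_kernel (\<beta> - \<alpha>)) * cis (real m * (\<beta> - \<alpha>)) * cis (real m * \<alpha>)) has_integral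
        - of_real (2 * pi / real m) * cis (real m * \<alpha>)) {-pi..pi}"
      by (intro has_integral_mult_left log_kernel_shift_integral m)
    moreover have "of_real (log_kernel (\<beta> - \<alpha>)) * cis (real m * (\<beta> - \<alpha>)) * cis (real m * \<alpha>)
        = of_real (log_kernel (\<alpha> - \<beta>)) * cis (real m * \<beta>)" for \<beta>
      using log_kernel_minus[of "\<alpha> - \<beta>"] by (simp add: mult.assoc cis_mult algebra_simps)
    ultimately show ?thesis
      unfolding lebesgue_integral_eq_integral[OF int torus_sets(1)] by (simp add: integral_unique)
  qed
  show ?thesis
  proof (cases "0 < n")
    case True
    then show ?thesis using pos[of "nat n"] by simp
  next
    case False
    with n have "n < 0" by simp
    have "(LINT \<beta>|torus. complex_of_real (log_kernel (\<alpha> - \<beta>)) * cis (of_int n * \<beta>))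
        = (LINT \<beta>|torus. cnj (complex_of_real (log_kernel (\<alpha> - \<beta>)) * cis (real (nat (- n)) * \<beta>)))"
      using \<open>n < 0\<close> by (simp add: cis_cnj)
    also have "\<dots> = cnj (- of_real (2 * pi / real (nat (- n))) * cis (real (nat (- n)) * \<alpha>))"
      using \<open>n < 0\<close> by (subst Bochner_Integration.integral_cnj, subst pos) auto
    also have "\<dots> = - of_real (2 * pi / \<bar>of_int n\<bar>) * cis (of_int n * \<alpha>)"
      using \<open>n < 0\<close> by (simp add: cis_cnj)
    finally show ?thesis .
  qed
qed

section \<open>Reconstruction of the solution\<close>

definition fourier_series :: "(int \<Rightarrow> complex) \<Rightarrow> real \<Rightarrow> complex" where
  "fourier_series c x = (\<Sum>\<^sub>\<infinity>n. c n * cis (of_int n * x))"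

lemma abs_summable_mult_cis:
  "c abs_summable_on UNIV \<Longrightarrow> (\<lambda>n::int. c n * cis (f n)) abs_summable_on UNIV"
  by (simp add: norm_mult)

lemma bij_int_shift: "bij (\<lambda>n::int. n - k)"
  by (rule bij_betw_byWitness[where f' = "\<lambda>n. n + k"]) auto

text \<open>The Cauchy product: absolute summability of the double family allows the exchange of
  sums after shifting each row by \<open>k\<close>.\<close>

lemma fourier_series_square:
  assumes c: "c abs_summable_on UNIV"
  shows "(fourier_series c x)\<^sup>2 = fourier_series (convolution c) x"
proof -
  define e where "e n = c n * cis (of_int n * x)" for n :: int
  have e: "e abs_summable_on UNIV" unfolding e_def by (rule abs_summable_mult_cis[OF c])
  have shift: "(\<lambda>n. e (n - k)) abs_summable_on UNIV" "infsum (\<lambda>n. e (n - k)) UNIV = infsum e UNIV"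
    "infsum (\<lambda>n. norm (e (n - k))) UNIV = infsum (\<lambda>n. norm (e n)) UNIV" for k
    using summable_on_reindex_bij_betw[OF bij_int_shift, of "\<lambda>n. norm (e n)" k] e
      infsum_reindex_bij_betw[OF bij_int_shift, of e k]
      infsum_reindex_bij_betw[OF bij_int_shift, of "\<lambda>n. norm (e n)" k] by simp_all
  define g where "g k n = e k * e (n - k)" for k n
  have "(\<lambda>p. g (fst p) (snd p)) abs_summable_on (UNIV \<times> UNIV)"
    unfolding Infinite_Sum.abs_summable_on_Sigma_iff
  proof (intro conjI ballI)
    show "(\<lambda>n. g (fst (k, n)) (snd (k, n))) abs_summable_on UNIV" for k
      using summable_on_cmult_right[OF shift(1)[of k], of "norm (e k)"] by (simp add: g_def norm_mult)
    have "infsum (\<lambda>n. norm (g (fst (k, n)) (snd (k, n)))) UNIV = norm (e k) * infsum (\<lambda>n. norm (e n)) UNIV" for k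
      unfolding g_def norm_mult fst_conv snd_conv infsum_cmult_right' shift(3) ..
    then show "(\<lambda>k. infsum (\<lambda>n. norm (g (fst (k, n)) (snd (k, n)))) UNIV) abs_summable_on UNIV"
      using summable_on_cmult_left[OF e, of "infsum (\<lambda>n. norm (e n)) UNIV"] by (simp add: infsum_nonneg)
  qed
  then have "(\<lambda>(k, n). g k n) summable_on (UNIV \<times> UNIV)"
    by (simp add: case_prod_beta abs_summable_summable)
  then have "infsum (\<lambda>k. infsum (\<lambda>n. g k n) UNIV) UNIV = infsum (\<lambda>n. infsum (\<lambda>k. g k n) UNIV) UNIV"
    by (rule infsum_swap_banach)
  moreover have "infsum (\<lambda>n. g k n) UNIV = e k * infsum e UNIV" for k
    unfolding g_def infsum_cmult_right' shift(2) ..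
  moreover have "infsum (\<lambda>k. g k n) UNIV = convolution c n * cis (of_int n * x)" for n
  proof -
    have "g k n = c k * c (n - k) * cis (of_int n * x)" for k
    proof -
      have "cis (of_int n * x) = cis (of_int k * x) * cis (of_int (n - k) * x)"
        by (simp add: cis_mult algebra_simps)
      then show ?thesis by (simp add: g_def e_def)
    qed
    then show ?thesis by (simp add: convolution_def infsum_cmult_left')
  qed
  ultimately have "infsum e UNIV * infsum e UNIV = fourier_series (convolution c) x"
    by (simp add: fourier_series_def infsum_cmult_left')
  moreover have "fourier_series c x = infsum e UNIV" unfolding fourier_series_def e_def ..
  ultimately show ?thesis by (simp only: power2_eq_square)
qed

lemma fourier_series_real:
  assumes "hermitian c" shows "fourier_series c x = complex_of_real (Re (fourier_series c x))"
proof -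
  have "cnj (fourier_series c x) = (\<Sum>\<^sub>\<infinity>n. c (- n) * cis (of_int (- n) * x))"
    using assms by (simp add: fourier_series_def hermitian_def cis_cnj flip: infsum_cnj)
  also have "\<dots> = fourier_series c x"
    unfolding fourier_series_def
    by (rule infsum_reindex_bij_betw) (auto intro!: bij_betw_byWitness[where f' = uminus])
  finally show ?thesis by (simp add: complex_eq_iff)
qed

lemma fourier_series_periodic: "fourier_series c (x + 2 * pi) = fourier_series c x"
  by (simp only: fourier_series_def cis_periodic)

lemma integral_mult_fourier_series:
  assumes c: "c abs_summable_on UNIV" and k: "integrable torus k"
  shows "(LINT x|torus. k x * fourier_series c x) = (\<Sum>\<^sub>\<infinity>n. c n * (LINT x|torus. k x * cis (of_int n * x)))"
proof -
  define f where "f j x = c (int_decode j) * (k x * cis (of_int (int_decode j) * x))" for j x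
  have f: "integrable torus (f j)" for j
    unfolding f_def using integrable_mult_cis[OF k] by simp
  have nf: "norm (f j x) = norm (c (int_decode j)) * norm (k x)" for j x by (simp add: f_def norm_mult)
  have sc: "summable (\<lambda>j. norm (c (int_decode j)))" by (rule sums_int_decode(2)[OF c])
  have "(LINT x|torus. (\<Sum>j. f j x)) = (\<Sum>j. LINT x|torus. f j x)"
    by (rule integral_suminf[OF f]) (simp_all add: nf sc summable_mult2)
  moreover have "(\<Sum>j. f j x) = k x * fourier_series c x" for x
  proof -
    have "(\<lambda>j. c (int_decode j) * cis (of_int (int_decode j) * x)) sums fourier_series c x"
      unfolding fourier_series_def by (rule sums_int_decode(1)[OF abs_summable_mult_cis[OF c]])
    then have "(\<lambda>j. k x * (c (int_decode j) * cis (of_int (int_decode j) * x))) sums (k x * fourier_series c x)"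
      by (rule sums_mult)
    then show ?thesis by (simp add: f_def sums_iff mult_ac)
  qed
  moreover have "(\<Sum>j. LINT x|torus. f j x) = (\<Sum>\<^sub>\<infinity>n. c n * (LINT x|torus. k x * cis (of_int n * x)))"
  proof -
    define A where "A = (LINT x|torus. norm (k x))"
    define L where "L n = (LINT x|torus. k x * cis (of_int n * x))" for n :: int
    have L: "norm (L n) \<le> A" for n
    proof -
      have "norm (L n) \<le> (LINT x|torus. norm (k x * cis (of_int n * x)))"
        unfolding L_def by (rule integral_norm_bound)
      then show ?thesis by (simp add: A_def norm_mult)
    qed
    have A: "0 \<le> A" by (rule order.trans[OF norm_ge_zero L[of 0]])
    have "(\<lambda>n. c n * L n) abs_summable_on UNIV"
    proof (rule Infinite_Sum.abs_summable_on_comparison_test)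
      show "(\<lambda>n. norm (c n) * A) abs_summable_on UNIV"
        using summable_on_cmult_left[OF c, of A] A by (simp add: abs_mult)
      show "norm (c n * L n) \<le> norm (norm (c n) * A)" for n
        using mult_left_mono[OF L[of n] norm_ge_zero[of "c n"]] A by (simp add: norm_mult abs_mult)
    qed
    then have "(\<lambda>n. c n * (LINT x|torus. k x * cis (of_int n * x))) abs_summable_on UNIV"
      by (simp only: L_def)
    from infsum_int_decode[OF this] show ?thesis by (simp add: f_def)
  qed
  ultimately show ?thesis by simp
qed

text \<open>Termwise differentiation relative to a convex set, which is the whole line for the space
  derivative and \<open>{0..}\<close> for the time derivative, one-sided at 0.\<close>

lemma infsum_has_vector_derivative:
  fixes f :: "int \<Rightarrow> real \<Rightarrow> complex"
  assumes S: "convex S" and der: "\<And>n s. s \<in> S \<Longrightarrow> (f n has_vector_derivative f' n s) (at s within S)"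
    and bound: "\<And>n s. s \<in> S \<Longrightarrow> norm (f' n s) \<le> b n" and b: "b abs_summable_on UNIV"
    and f: "\<And>s. s \<in> S \<Longrightarrow> (\<lambda>n. f n s) abs_summable_on UNIV" and t: "t \<in> S"
  shows "((\<lambda>s. \<Sum>\<^sub>\<infinity>n. f n s) has_vector_derivative (\<Sum>\<^sub>\<infinity>n. f' n t)) (at t within S)"
proof -
  have f': "(\<lambda>n. f' n s) abs_summable_on UNIV" if "s \<in> S" for s
    by (intro Infinite_Sum.abs_summable_on_comparison_test[OF b] order.trans[OF bound[OF that]]) simp
  have sb: "summable (\<lambda>j. b (int_decode j))"
    using sums_int_decode(2)[OF b] by (rule summable_norm_cancel)
  have unif: "uniform_limit S (\<lambda>N s. \<Sum>j<N. f' (int_decode j) s) (\<lambda>s. \<Sum>j. f' (int_decode j) s) sequentially"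
    by (rule Weierstrass_m_test[OF _ sb]) (rule bound)
  have "\<exists>g. \<forall>s\<in>S. (\<lambda>j. f (int_decode j) s) sums g s \<and>
      (g has_derivative (\<lambda>h. h *\<^sub>R (\<Sum>j. f' (int_decode j) s))) (at s within S)"
  proof (rule has_derivative_series[OF S])
    show "(f (int_decode j) has_derivative (\<lambda>h. h *\<^sub>R f' (int_decode j) s)) (at s within S)" if "s \<in> S" for j s
      using der[OF that] by (simp add: has_vector_derivative_def)
    show "(\<lambda>j. f (int_decode j) t) sums (\<Sum>\<^sub>\<infinity>n. f n t)" by (rule sums_int_decode(1)[OF f[OF t]])
    fix e :: real assume "0 < e"
    with unif have "\<forall>\<^sub>F N in sequentially. \<forall>s\<in>S. dist (\<Sum>j<N. f' (int_decode j) s) (\<Sum>j. f' (int_decode j) s) < e"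
      by (rule uniform_limitD)
    then show "\<forall>\<^sub>F N in sequentially. \<forall>s\<in>S. \<forall>h::real. norm ((\<Sum>j<N. h *\<^sub>R f' (int_decode j) s) - h *\<^sub>R (\<Sum>j. f' (int_decode j) s)) \<le> e * norm h"
    proof eventually_elim
      case (elim N)
      show ?case
      proof (intro ballI allI)
        fix s and h :: real assume "s \<in> S"
        with elim have "norm ((\<Sum>j<N. f' (int_decode j) s) - (\<Sum>j. f' (int_decode j) s)) \<le> e"
          by (auto simp: dist_norm intro: less_imp_le)
        then have "norm h * norm ((\<Sum>j<N. f' (int_decode j) s) - (\<Sum>j. f' (int_decode j) s)) \<le> norm h * e"
          by (rule mult_left_mono) simp
        then show "norm ((\<Sum>j<N. h *\<^sub>R f' (int_decode j) s) - h *\<^sub>R (\<Sum>j. f' (int_decode j) s)) \<le> e * norm h"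
          by (simp add: scaleR_sum_right[symmetric] scaleR_diff_right[symmetric] mult.commute)
      qed
    qed
  qed (rule t)
  then obtain g where g: "\<And>s. s \<in> S \<Longrightarrow> (\<lambda>j. f (int_decode j) s) sums g s"
    "\<And>s. s \<in> S \<Longrightarrow> (g has_derivative (\<lambda>h. h *\<^sub>R (\<Sum>j. f' (int_decode j) s))) (at s within S)" by blast
  have "(g has_vector_derivative (\<Sum>\<^sub>\<infinity>n. f' n t)) (at t within S)"
    using g(2)[OF t] by (simp add: has_vector_derivative_def infsum_int_decode[OF f'[OF t]])
  then show ?thesis
  proof (rule has_vector_derivative_transform[OF t, rotated])
    show "(\<Sum>\<^sub>\<infinity>n. f n s) = g s" if "s \<in> S" for s
      using g(1)[OF that] infsum_int_decode[OF f[OF that]] by (simp add: sums_iff)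
  qed
qed

lemma fourier_series_has_vector_derivative:
  assumes c: "c abs_summable_on UNIV" and nc: "(\<lambda>n. of_int n * c n) abs_summable_on UNIV"
  shows "(fourier_series c has_vector_derivative fourier_series (\<lambda>n. \<i> * of_int n * c n) x) (at x)"
proof -
  have "((\<lambda>s. \<Sum>\<^sub>\<infinity>n. c n * cis (of_int n * s)) has_vector_derivative
      (\<Sum>\<^sub>\<infinity>n. \<i> * of_int n * c n * cis (of_int n * x))) (at x within UNIV)"
  proof (rule infsum_has_vector_derivative[where b = "\<lambda>n. norm (of_int n * c n)"])
    show "((\<lambda>s. c n * cis (of_int n * s)) has_vector_derivative \<i> * of_int n * c n * cis (of_int n * s)) (at s within UNIV)" for n s
      by (rule has_vector_derivative_eq_rhs[OF has_vector_derivative_mult_right[OF has_vector_derivative_cis]]) simp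
    show "(\<lambda>n. c n * cis (of_int n * s)) abs_summable_on UNIV" for s by (rule abs_summable_mult_cis[OF c])
  qed (use nc in \<open>auto simp: norm_mult\<close>)
  then show ?thesis by (simp add: fourier_series_def[abs_def])
qed

lemma fourier_coeff_fourier_series:
  assumes c: "c abs_summable_on UNIV" and herm: "hermitian c"
  shows "fourier_coeff (\<lambda>x. Re (fourier_series c x)) n = c n"
proof -
  have "(LINT x|torus. cis (- (of_int n * x)) * fourier_series c x)
      = (\<Sum>\<^sub>\<infinity>m. c m * (LINT x|torus. cis (- (of_int n * x)) * cis (of_int m * x)))"
    by (intro integral_mult_fourier_series[OF c] integrable_torus_continuous continuous_intros)
  also have "\<dots> = (\<Sum>\<^sub>\<infinity>m. if m = n then 2 * of_real pi * c n else 0)"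
  proof (rule infsum_cong)
    fix m
    have "(LINT x|torus. cis (- (of_int n * x)) * cis (of_int m * x)) = (LINT x|torus. cis (of_int (m - n) * x))"
      by (intro Bochner_Integration.integral_cong refl) (simp add: cis_mult algebra_simps)
    then show "c m * (LINT x|torus. cis (- (of_int n * x)) * cis (of_int m * x)) = (if m = n then 2 * of_real pi * c n else 0)"
      by (simp only: integral_cis) simp
  qed
  also have "\<dots> = 2 * of_real pi * c n"
    by (rule infsumI, rule has_sum_finite_neutralI[of "{n}"]) auto
  finally show ?thesis
    by (simp add: fourier_coeff_torus fourier_series_real[OF herm, symmetric] mult.commute)
qed

lemma L2_torus_fourier_series:
  assumes c: "c abs_summable_on UNIV" and nc: "(\<lambda>n. of_int n * c n) abs_summable_on UNIV"
  shows "(\<lambda>x. Re (fourier_series c x)) \<in> L2_torus"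
proof (rule L2_torus_continuous)
  have "continuous (at x) (fourier_series c)" for x
    by (rule has_vector_derivative_continuous[OF fourier_series_has_vector_derivative[OF c nc]])
  then show "continuous_on UNIV (\<lambda>x. Re (fourier_series c x))"
    by (intro continuous_intros continuous_at_imp_continuous_on) auto
qed (simp add: fourier_series_periodic)

lemma Lambda_inv_fourier_series:
  assumes c: "c abs_summable_on UNIV" and herm: "hermitian c" and zero: "c 0 = 0"
  shows "complex_of_real (Lambda_inv (\<lambda>x. Re (fourier_series c x)) \<alpha>) = fourier_series (\<lambda>n. c n / of_int \<bar>n\<bar>) \<alpha>"
proof -
  have "complex_of_real (LINT \<beta>|torus. log_kernel (\<alpha> - \<beta>) * Re (fourier_series c \<beta>))
      = (LINT \<beta>|torus. complex_of_real (log_kernel (\<alpha> - \<beta>)) * fourier_series c \<beta>)"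
    unfolding integral_complex_of_real[symmetric] by (simp add: fourier_series_real[OF herm, symmetric])
  also have "\<dots> = (\<Sum>\<^sub>\<infinity>n. c n * (LINT \<beta>|torus. complex_of_real (log_kernel (\<alpha> - \<beta>)) * cis (of_int n * \<beta>)))"
    using integrable_log_kernel by (intro integral_mult_fourier_series[OF c]) simp
  also have "\<dots> = (\<Sum>\<^sub>\<infinity>n. - (2 * of_real pi) * (c n / of_int \<bar>n\<bar> * cis (of_int n * \<alpha>)))"
  proof (rule infsum_cong)
    fix n
    show "c n * (LINT \<beta>|torus. complex_of_real (log_kernel (\<alpha> - \<beta>)) * cis (of_int n * \<beta>))
        = - (2 * of_real pi) * (c n / of_int \<bar>n\<bar> * cis (of_int n * \<alpha>))"
    \<comment> \<open>For n = 0 both sides vanish because \<open>c 0 = 0\<close>.\<close>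
    proof (cases "n = 0")
      case False
      have "complex_of_real (2 * pi / \<bar>of_int n\<bar>) = 2 * of_real pi / of_int \<bar>n\<bar>"
        unfolding of_int_abs[symmetric] by (simp only: of_real_divide of_real_mult of_real_numeral of_real_of_int_eq)
      then show ?thesis unfolding log_kernel_fourier[OF False] by (simp only:) simp
    qed (simp add: zero)
  qed
  also have "\<dots> = - (2 * of_real pi) * fourier_series (\<lambda>n. c n / of_int \<bar>n\<bar>) \<alpha>"
    unfolding infsum_cmult_right' fourier_series_def ..
  finally have *: "complex_of_real (LINT \<beta>|torus. log_kernel (\<alpha> - \<beta>) * Re (fourier_series c \<beta>))
      = - (2 * of_real pi) * fourier_series (\<lambda>n. c n / of_int \<bar>n\<bar>) \<alpha>" .
  have "complex_of_real (Lambda_inv (\<lambda>x. Re (fourier_series c x)) \<alpha>)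
      = - (1 / (2 * of_real pi)) * complex_of_real (LINT \<beta>|torus. log_kernel (\<alpha> - \<beta>) * Re (fourier_series c \<beta>))"
    by (simp add: Lambda_inv_def set_integral_torus log_kernel_def)
  then show ?thesis unfolding * by simp
qed

section \<open>Decay of the convolution and the equation in physical space\<close>

lemma fourth_power_sum_le:
  fixes x y :: real shows "(x + y) ^ 4 \<le> 8 * (x ^ 4 + y ^ 4)"
proof -
  have sq: "(p + q)\<^sup>2 \<le> 2 * (p\<^sup>2 + q\<^sup>2)" for p q :: real
    using zero_le_power2[of "p - q"] by (simp add: power2_eq_square algebra_simps)
  have "(x + y) ^ 4 = ((x + y)\<^sup>2)\<^sup>2" by simp
  also have "\<dots> \<le> (2 * (x\<^sup>2 + y\<^sup>2))\<^sup>2" by (intro power_mono sq) auto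
  also have "\<dots> = 4 * (x\<^sup>2 + y\<^sup>2)\<^sup>2" by (simp only: power_mult_distrib) simp
  also have "\<dots> \<le> 4 * (2 * ((x\<^sup>2)\<^sup>2 + (y\<^sup>2)\<^sup>2))" by (intro mult_left_mono sq) auto
  finally show ?thesis by simp
qed

lemma inverse_third_le: "1 / \<bar>of_int n :: real\<bar> ^ 3 \<le> 1 / (of_int n)\<^sup>2"
proof (cases "n = 0")
  case False
  then have "1 \<le> \<bar>real_of_int n\<bar>" by linarith
  then have "\<bar>real_of_int n\<bar>\<^sup>2 \<le> \<bar>real_of_int n\<bar> ^ 3" by (intro power_increasing) auto
  then show ?thesis using False by (intro divide_left_mono) auto
qed simp

lemma coefficient_bounds:
  assumes M: "0 \<le> M" and b: "\<And>k. cmod (c k) \<le> M / \<bar>of_int k\<bar> ^ 4"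
  shows "cmod (c n) \<le> M * (1 / (of_int n)\<^sup>2)" "cmod (of_int n * c n) \<le> M * (1 / (of_int n)\<^sup>2)"
proof -
  have "cmod (c n) \<le> M * (1 / \<bar>of_int n\<bar> ^ 4)" using b[of n] by simp
  also have "\<dots> \<le> M * (1 / (of_int n)\<^sup>2)" by (intro mult_left_mono inverse_fourth_le M)
  finally show "cmod (c n) \<le> M * (1 / (of_int n)\<^sup>2)" .
  have "cmod (of_int n * c n) \<le> \<bar>of_int n\<bar> * (M / \<bar>of_int n\<bar> ^ 4)"
    unfolding norm_mult norm_of_int by (intro mult_left_mono b) auto
  also have "\<dots> = M * (1 / \<bar>of_int n\<bar> ^ 3)"
    by (cases "n = 0") (simp_all add: eval_nat_numeral)
  also have "\<dots> \<le> M * (1 / (of_int n)\<^sup>2)" by (intro mult_left_mono inverse_third_le M)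
  finally show "cmod (of_int n * c n) \<le> M * (1 / (of_int n)\<^sup>2)" .
qed

lemma abs_summable_coefficients:
  assumes M: "0 \<le> M" and b: "\<And>k. cmod (c k) \<le> M / \<bar>of_int k\<bar> ^ 4"
  shows "c abs_summable_on UNIV" "(\<lambda>n. of_int n * c n) abs_summable_on UNIV"
  by (rule abs_summable_of_inverse_square_bound, rule coefficient_bounds[OF M b])+

text \<open>The fourth power of n is distributed over k and n - k; each time the weighted factor is
  at most \<open>M\<close> and the other one is summable. The power stands on the left because the
  mode n = 0 need not vanish, whereas a quotient there would be 0.\<close>

lemma convolution_decay:
  assumes M: "0 \<le> M" and b: "\<And>k. cmod (c k) \<le> M / \<bar>of_int k\<bar> ^ 4"
    and S: "S = infsum (\<lambda>k. M * (1 / (real_of_int k)\<^sup>2)) UNIV"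
  shows "cmod (convolution c n) * \<bar>of_int n\<bar> ^ 4 \<le> 16 * M * S"
proof -
  define x where "x k = cmod (c k)" for k
  define s where "s = infsum x UNIV"
  have x: "x summable_on UNIV"
    using abs_summable_coefficients(1)[OF M b] by (simp add: x_def[abs_def])
  have bij: "bij (\<lambda>k::int. n - k)"
    by (rule bij_betw_byWitness[where f' = "\<lambda>k. n - k"]) auto
  have xr: "(\<lambda>k. x (n - k)) summable_on UNIV" "infsum (\<lambda>k. x (n - k)) UNIV = s"
    using summable_on_reindex_bij_betw[OF bij, of x] infsum_reindex_bij_betw[OF bij, of x] x by (simp_all add: s_def)
  have "s \<le> S"
    unfolding s_def S
  proof (rule infsum_mono[OF x])
    show "(\<lambda>k. M * (1 / (real_of_int k)\<^sup>2)) summable_on UNIV"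
      by (rule abs_summable_summable[OF abs_summable_inverse_square_mult])
    show "x k \<le> M * (1 / (of_int k)\<^sup>2)" for k unfolding x_def by (rule coefficient_bounds(1)[OF M b])
  qed
  have xb: "\<bar>of_int k\<bar> ^ 4 * x k \<le> M" for k
  proof (cases "k = 0")
    case False
    then show ?thesis using b[of k] by (simp add: x_def pos_le_divide_eq mult.commute)
  qed (simp add: M)
  have x0: "0 \<le> x k" for k by (simp add: x_def)
  have terms: "x k * x (n - k) * \<bar>of_int n\<bar> ^ 4 \<le> 8 * M * (x (n - k) + x k)" for k
  proof -
    have "\<bar>of_int n :: real\<bar> ^ 4 \<le> 8 * (\<bar>of_int k\<bar> ^ 4 + \<bar>of_int (n - k)\<bar> ^ 4)"
      using fourth_power_sum_le[of "of_int k" "of_int (n - k)"] by simp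
    then have "x k * x (n - k) * \<bar>of_int n\<bar> ^ 4 \<le> x k * x (n - k) * (8 * (\<bar>of_int k\<bar> ^ 4 + \<bar>of_int (n - k)\<bar> ^ 4))"
      using x0 by (intro mult_left_mono) auto
    also have "\<dots> = 8 * (x (n - k) * (\<bar>of_int k\<bar> ^ 4 * x k) + x k * (\<bar>of_int (n - k)\<bar> ^ 4 * x (n - k)))"
      by (simp add: algebra_simps)
    also have "\<dots> \<le> 8 * (x (n - k) * M + x k * M)"
      by (intro mult_left_mono add_mono xb x0) simp
    finally show ?thesis by (simp add: algebra_simps)
  qed
  have sum1: "(\<lambda>k. c k * c (n - k)) abs_summable_on UNIV"
    by (rule abs_summable_of_inverse_square_bound, rule convolution_terms_bound[OF M b])
  then have sum2: "(\<lambda>k. x k * x (n - k)) summable_on UNIV" by (simp add: x_def norm_mult)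
  have "cmod (convolution c n) \<le> infsum (\<lambda>k. x k * x (n - k)) UNIV"
    unfolding convolution_def using norm_infsum_bound[OF sum1] by (simp add: x_def norm_mult)
  then have "cmod (convolution c n) * \<bar>of_int n\<bar> ^ 4 \<le> infsum (\<lambda>k. x k * x (n - k)) UNIV * \<bar>of_int n\<bar> ^ 4"
    by (rule mult_right_mono) simp
  also have "\<dots> = infsum (\<lambda>k. x k * x (n - k) * \<bar>of_int n\<bar> ^ 4) UNIV" by (rule infsum_cmult_left'[symmetric])
  also have "\<dots> \<le> infsum (\<lambda>k. 8 * M * (x (n - k) + x k)) UNIV"
    by (intro infsum_mono summable_on_cmult_left summable_on_cmult_right summable_on_add sum2 xr x terms)
  also have "\<dots> = 8 * M * (s + s)"
    unfolding infsum_cmult_right' by (subst infsum_add[OF xr(1) x]) (simp add: xr(2) s_def)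
  also have "\<dots> \<le> 16 * M * S" using \<open>s \<le> S\<close> M by (simp add: mult_left_mono)
  finally show ?thesis .
qed

lemma convolution_bounds:
  assumes M: "0 \<le> M" and b: "\<And>k. cmod (c k) \<le> M / \<bar>of_int k\<bar> ^ 4"
    and S: "S = infsum (\<lambda>k. M * (1 / (real_of_int k)\<^sup>2)) UNIV"
  shows "cmod (of_int n * convolution c n) \<le> 16 * M * S * (1 / (of_int n)\<^sup>2)"
proof (cases "n = 0")
  case False
  have "cmod (convolution c n) \<le> 16 * M * S / \<bar>of_int n\<bar> ^ 4"
    using convolution_decay[OF M b S, of n] False by (simp add: pos_le_divide_eq)
  then have "cmod (of_int n * convolution c n) \<le> \<bar>of_int n\<bar> * (16 * M * S / \<bar>of_int n\<bar> ^ 4)"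
    unfolding norm_mult norm_of_int by (intro mult_left_mono) auto
  also have "\<dots> = 16 * M * S * (1 / \<bar>of_int n\<bar> ^ 3)" using False by (simp add: eval_nat_numeral)
  also have "\<dots> \<le> 16 * M * S * (1 / (of_int n)\<^sup>2)"
  proof (intro mult_left_mono inverse_third_le)
    have "0 \<le> S" unfolding S using M by (intro infsum_nonneg) auto
    then show "0 \<le> 16 * M * S" using M by simp
  qed
  finally show ?thesis .
qed simp

lemma abs_summable_convolution:
  assumes M: "0 \<le> M" and b: "\<And>k. cmod (c k) \<le> M / \<bar>of_int k\<bar> ^ 4"
  shows "convolution c abs_summable_on UNIV" "(\<lambda>n. of_int n * convolution c n) abs_summable_on UNIV"
proof -
  define S where "S = infsum (\<lambda>k. M * (1 / (real_of_int k)\<^sup>2)) UNIV"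
  note B = convolution_bounds[OF M b S_def]
  show 1: "(\<lambda>n. of_int n * convolution c n) abs_summable_on UNIV"
    by (rule abs_summable_of_inverse_square_bound, rule B)
  \<comment> \<open>The factor n hides the zero mode, which is therefore added separately.\<close>
  have "(\<lambda>n. cmod (of_int n * convolution c n) + (if n = 0 then cmod (convolution c 0) else 0)) summable_on UNIV"
  proof (rule summable_on_add[OF 1])
    show "(\<lambda>n::int. if n = 0 then cmod (convolution c 0) else 0) summable_on UNIV"
      by (rule finite_nonzero_values_imp_summable_on, rule finite_subset[of _ "{0}"]) auto
  qed
  then show "convolution c abs_summable_on UNIV"
  proof (rule summable_on_comparison_test)
    show "cmod (convolution c n) \<le> cmod (of_int n * convolution c n) + (if n = 0 then cmod (convolution c 0) else 0)" for n
    proof (cases "n = 0")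
      case False
      then have "1 \<le> \<bar>real_of_int n\<bar>" by linarith
      from mult_right_mono[OF this, of "cmod (convolution c n)"] False show ?thesis by (simp add: norm_mult)
    qed simp
  qed simp
qed

lemma fourier_series_linear_combination:
  assumes "p abs_summable_on UNIV" "q abs_summable_on UNIV"
  shows "fourier_series (\<lambda>n. r * p n - q n) x = r * fourier_series p x - fourier_series q x"
proof -
  have s: "(\<lambda>n. p n * cis (of_int n * x)) summable_on UNIV" "(\<lambda>n. q n * cis (of_int n * x)) summable_on UNIV"
    using abs_summable_summable[OF abs_summable_mult_cis[OF assms(1)]]
      abs_summable_summable[OF abs_summable_mult_cis[OF assms(2)]] by this+
  have "fourier_series (\<lambda>n. r * p n - q n) x = (\<Sum>\<^sub>\<infinity>n. r * (p n * cis (of_int n * x)) - q n * cis (of_int n * x))"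
    unfolding fourier_series_def by (intro infsum_cong) (simp add: algebra_simps)
  also have "\<dots> = (\<Sum>\<^sub>\<infinity>n. r * (p n * cis (of_int n * x))) - (\<Sum>\<^sub>\<infinity>n. q n * cis (of_int n * x))"
    using infsum_add[OF summable_on_cmult_right[OF s(1), of r] summable_on_uminus[THEN iffD2, OF s(2)]]
    by (simp add: infsum_uminus)
  finally show ?thesis by (simp add: fourier_series_def infsum_cmult_right')
qed

lemma fourier_solution_solves_pde:
  assumes sol: "fourier_solution a0 a" and M: "0 \<le> M"
    and b: "\<And>t n. 0 \<le> t \<Longrightarrow> cmod (a t n) \<le> M / \<bar>of_int n\<bar> ^ 4" and t: "0 \<le> t"
  shows "\<exists>u_t u_\<alpha>. ((\<lambda>r. Re (fourier_series (a r) \<alpha>)) has_real_derivative u_t) (at t within {0..}) \<and>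
        ((\<lambda>x. Re (fourier_series (a t) x)) has_real_derivative u_\<alpha>) (at \<alpha>) \<and>
        u_t + Re (fourier_series (a t) \<alpha>) * u_\<alpha> = - Lambda_inv (\<lambda>x. Re (fourier_series (a t) x)) \<alpha>"
proof -
  define S where "S = infsum (\<lambda>k. M * (1 / (real_of_int k)\<^sup>2)) UNIV"
  define p where "p s n = \<i> * of_int n * convolution (a s) n" for s n
  define q where "q s n = a s n / of_int \<bar>n\<bar>" for s n
  define d where "d s n = - (1 / 2) * p s n - q s n" for s n
  define U where "U = fourier_series (a t) \<alpha>"
  define U\<^sub>x where "U\<^sub>x = fourier_series (\<lambda>n. \<i> * of_int n * a t n) \<alpha>"
  note asum = abs_summable_coefficients[OF M b[OF t]]
  note csum = abs_summable_convolution[OF M b[OF t]]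
  have herm: "hermitian (a t)" and zero: "a t 0 = 0" using sol t by (auto simp: fourier_solution_def)
  have qb: "cmod (q s n) \<le> M * (1 / (of_int n)\<^sup>2)" if "0 \<le> s" for s n
    unfolding q_def by (rule order.trans[OF norm_divide_abs_int_le coefficient_bounds(1)[OF M b[OF that]]])
  have qsum: "q t abs_summable_on UNIV"
    by (rule abs_summable_of_inverse_square_bound, rule qb[OF t])
  have psum: "p t abs_summable_on UNIV" using csum(2) by (simp add: p_def[abs_def] norm_mult mult.assoc)
  have x_der: "(fourier_series (a t) has_vector_derivative U\<^sub>x) (at \<alpha>)"
    unfolding U\<^sub>x_def by (rule fourier_series_has_vector_derivative[OF asum])
  \<comment> \<open>The square is differentiated twice over: by the product rule, and termwise as
    the series of the convolution. Uniqueness of derivatives identifies the nonlinearity.\<close>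
  have "((\<lambda>x. (fourier_series (a t) x)\<^sup>2) has_vector_derivative (U * U\<^sub>x + U\<^sub>x * U)) (at \<alpha>)"
    unfolding power2_eq_square U_def by (rule has_vector_derivative_mult[OF x_der x_der])
  then have "(fourier_series (convolution (a t)) has_vector_derivative (U * U\<^sub>x + U\<^sub>x * U)) (at \<alpha>)"
    unfolding fourier_series_square[OF asum(1)] .
  moreover have "(fourier_series (convolution (a t)) has_vector_derivative fourier_series (p t) \<alpha>) (at \<alpha>)"
    unfolding p_def by (rule fourier_series_has_vector_derivative[OF csum])
  ultimately have "U * U\<^sub>x + U\<^sub>x * U = fourier_series (p t) \<alpha>" by (rule vector_derivative_unique_at)
  then have UU: "fourier_series (p t) \<alpha> = 2 * (U * U\<^sub>x)" by (simp add: mult.commute[of U\<^sub>x U])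
  have "((\<lambda>s. \<Sum>\<^sub>\<infinity>n. a s n * cis (of_int n * \<alpha>)) has_vector_derivative (\<Sum>\<^sub>\<infinity>n. d t n * cis (of_int n * \<alpha>))) (at t within {0..})"
  \<comment> \<open>The dominating sequence is uniform in time: 8 M S is half of the constant 16 M S
    of \<open>convolution_bounds\<close>, and \<open>M\<close> bounds the damping.\<close>
  proof (rule infsum_has_vector_derivative[where b = "\<lambda>n. (8 * M * S + M) * (1 / (of_int n)\<^sup>2)"])
    fix n and s :: real assume "s \<in> {0..}"
    then have s: "0 \<le> s" by simp
    have "((\<lambda>s. a s n) has_vector_derivative d s n) (at s within {0..})"
      using sol s unfolding fourier_solution_def d_def p_def q_def by simp
    then show "((\<lambda>s. a s n * cis (of_int n * \<alpha>)) has_vector_derivative d s n * cis (of_int n * \<alpha>)) (at s within {0..})"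
      by (rule has_vector_derivative_mult_left)
    have "cmod (d s n * cis (of_int n * \<alpha>)) \<le> cmod (- (1 / 2) * p s n) + cmod (q s n)"
      unfolding norm_mult norm_cis mult_1_right d_def using norm_triangle_ineq4[of "- (1 / 2) * p s n" "q s n"]
      by (simp only: norm_mult)
    also have "cmod (- (1 / 2) * p s n) = 1 / 2 * cmod (of_int n * convolution (a s) n)"
      by (simp add: p_def norm_mult)
    also have "\<dots> \<le> 1 / 2 * (16 * M * S * (1 / (of_int n)\<^sup>2))"
      by (intro mult_left_mono convolution_bounds[OF M b[OF s] S_def]) simp
    also have "1 / 2 * (16 * M * S * (1 / (of_int n)\<^sup>2)) + cmod (q s n) \<le> 1 / 2 * (16 * M * S * (1 / (of_int n)\<^sup>2)) + M * (1 / (of_int n)\<^sup>2)"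
      by (intro add_left_mono qb s)
    also have "\<dots> = (8 * M * S + M) * (1 / (of_int n)\<^sup>2)" by (simp add: algebra_simps)
    finally show "cmod (d s n * cis (of_int n * \<alpha>)) \<le> (8 * M * S + M) * (1 / (of_int n)\<^sup>2)" by simp
  next
    show "(\<lambda>n. a s n * cis (of_int n * \<alpha>)) abs_summable_on UNIV" if "s \<in> {0..}" for s
      using that by (intro abs_summable_mult_cis abs_summable_coefficients(1)[OF M b]) simp
  qed (use t abs_summable_inverse_square_mult in auto)
  then have t_der: "((\<lambda>s. fourier_series (a s) \<alpha>) has_vector_derivative fourier_series (d t) \<alpha>) (at t within {0..})"
    unfolding fourier_series_def .
  have "fourier_series (d t) \<alpha> = - (1 / 2) * fourier_series (p t) \<alpha> - fourier_series (q t) \<alpha>"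
    unfolding d_def by (rule fourier_series_linear_combination[OF psum qsum])
  also have "\<dots> = - (U * U\<^sub>x) - complex_of_real (Lambda_inv (\<lambda>x. Re (fourier_series (a t) x)) \<alpha>)"
    unfolding UU Lambda_inv_fourier_series[OF asum(1) herm zero] q_def by simp
  also have "U = complex_of_real (Re U)"
    unfolding U_def by (rule fourier_series_real[OF herm])
  finally have Re: "Re (fourier_series (d t) \<alpha>) = - (Re U * Re U\<^sub>x) - Lambda_inv (\<lambda>x. Re (fourier_series (a t) x)) \<alpha>"
    by simp
  show ?thesis
  proof (intro exI conjI)
    show "((\<lambda>r. Re (fourier_series (a r) \<alpha>)) has_real_derivative Re (fourier_series (d t) \<alpha>)) (at t within {0..})"
      unfolding has_real_derivative_iff_has_vector_derivative
      by (rule bounded_linear.has_vector_derivative[OF bounded_linear_Re t_der])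
    show "((\<lambda>x. Re (fourier_series (a t) x)) has_real_derivative Re U\<^sub>x) (at \<alpha>)"
      unfolding has_real_derivative_iff_has_vector_derivative
      by (rule bounded_linear.has_vector_derivative[OF bounded_linear_Re x_der])
    show "Re (fourier_series (d t) \<alpha>) + Re (fourier_series (a t) \<alpha>) * Re U\<^sub>x = - Lambda_inv (\<lambda>x. Re (fourier_series (a t) x)) \<alpha>"
      using Re by (simp add: U_def)
  qed
qed

lemma abs_powr_4: "\<bar>real_of_int n\<bar> powr 4 = of_int n ^ 4"
  by (cases "n = 0") simp_all

lemma is_Lambda_pow_Lambda_pow:
  "is_Lambda_pow s u w \<Longrightarrow> is_Lambda_pow s u (Lambda_pow s u)"
  unfolding Lambda_pow_def by (rule someI[where P = "is_Lambda_pow s u"])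

text \<open>Riesz-Fischer supplies some representative of the fourth derivative. The norm is taken
  of the chosen one, so it is bounded through its coefficients instead.\<close>

lemma H4_space_membership:
  assumes u: "u \<in> L2_torus" and bdd: "\<And>F. finite F \<Longrightarrow> (\<Sum>n\<in>F. of_int n ^ 8 * (cmod (fourier_coeff u n))\<^sup>2) \<le> B"
  shows "u \<in> H_space 4" "Hdot_norm 4 u \<le> sqrt (2 * pi * B)"
proof -
  define c where "c n = complex_of_real (\<bar>of_int n\<bar> powr 4) * fourier_coeff u n" for n
  have csq: "(cmod (c n))\<^sup>2 = of_int n ^ 8 * (cmod (fourier_coeff u n))\<^sup>2" for n
    by (simp add: c_def abs_powr_4 norm_mult norm_power power_mult_distrib flip: power_mult)
  have "hermitian c" using fourier_coeff_hermitian[of u] by (simp add: hermitian_def c_def)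
  moreover have "(\<Sum>n\<in>F. (cmod (c n))\<^sup>2) \<le> B" if "finite F" for F
    unfolding csq by (rule bdd[OF that])
  ultimately obtain w where w: "w \<in> L2_torus" "\<And>n. fourier_coeff w n = c n" "(LINT x|torus. (w x)\<^sup>2) \<le> 2 * pi * B"
    using riesz_fischer[of c B] by blast
  then have ex: "is_Lambda_pow 4 u w" by (simp add: is_Lambda_pow_def c_def)
  then show "u \<in> H_space 4" using u by (auto simp: H_space_def)
  have "is_Lambda_pow 4 u (Lambda_pow 4 u)" by (rule is_Lambda_pow_Lambda_pow[OF ex])
  then have W: "Lambda_pow 4 u \<in> L2_torus" "\<And>n. fourier_coeff (Lambda_pow 4 u) n = c n"
    by (auto simp: is_Lambda_pow_def c_def)
  have "(LINT x|torus. (Lambda_pow 4 u x)\<^sup>2) \<le> 2 * pi * B"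
    by (rule L2_bound_of_coefficients[OF W(1)]) (simp add: W(2) csq bdd)
  then show "Hdot_norm 4 u \<le> sqrt (2 * pi * B)" by (simp add: Hdot_norm_def L2_norm_torus)
qed

text \<open>With zero mean the L^2 part is dominated by the H^4 part, since |n| >= 1; each
  contributes 2 pi B.\<close>

lemma H4_norm_le:
  assumes u: "u \<in> L2_torus" and zero: "fourier_coeff u 0 = 0"
    and bdd: "\<And>F. finite F \<Longrightarrow> (\<Sum>n\<in>F. of_int n ^ 8 * (cmod (fourier_coeff u n))\<^sup>2) \<le> B"
  shows "H_norm 4 u \<le> sqrt (4 * pi * B)"
proof -
  have B: "0 \<le> B" using bdd[of "{}"] by simp
  have "(cmod (fourier_coeff u n))\<^sup>2 \<le> of_int n ^ 8 * (cmod (fourier_coeff u n))\<^sup>2" for n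
  proof (cases "n = 0")
    case False
    then have "1 \<le> \<bar>real_of_int n\<bar>" by linarith
    then have "1 \<le> real_of_int n ^ 8" using one_le_power[of "\<bar>real_of_int n\<bar>" 8] by simp
    then show ?thesis using mult_right_mono[of 1 "real_of_int n ^ 8" "(cmod (fourier_coeff u n))\<^sup>2"] by simp
  qed (simp add: zero)
  then have "(\<Sum>n\<in>F. (cmod (fourier_coeff u n))\<^sup>2) \<le> B" if "finite F" for F
    by (intro order.trans[OF sum_mono bdd[OF that]])
  then have "(LINT x|torus. (u x)\<^sup>2) \<le> 2 * pi * B" by (rule L2_bound_of_coefficients[OF u])
  then have 1: "(L2_norm u)\<^sup>2 \<le> 2 * pi * B" by (simp add: L2_norm_torus integral_nonneg_AE)
  have "0 \<le> Hdot_norm 4 u" by (simp add: Hdot_norm_def L2_norm_torus integral_nonneg_AE)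
  then have "(Hdot_norm 4 u)\<^sup>2 \<le> (sqrt (2 * pi * B))\<^sup>2"
    using H4_space_membership(2)[OF u bdd] by (intro power_mono) auto
  then have 2: "(Hdot_norm 4 u)\<^sup>2 \<le> 2 * pi * B" using B by simp
  show ?thesis unfolding H_norm_def using 1 2 by (intro real_sqrt_le_mono) simp
qed

lemma H4_coefficient_continuity:
  assumes sol: "fourier_solution a0 a" and t: "0 \<le> t" and e: "0 < e"
    and tail: "\<And>e. 0 < e \<Longrightarrow> \<exists>m::real. \<forall>t\<ge>0. \<forall>F. finite F \<longrightarrow> (\<forall>n\<in>F. m \<le> \<bar>of_int n\<bar>) \<longrightarrow>
        (\<Sum>n\<in>F. of_int n ^ 8 * (cmod (a t n))\<^sup>2) \<le> e"
  shows "\<forall>\<^sub>F r in at t within {0..}. \<forall>F. finite F \<longrightarrow> (\<Sum>n\<in>F. of_int n ^ 8 * (cmod (a r n - a t n))\<^sup>2) \<le> e"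
proof -
  \<comment> \<open>Beyond the cutoff, |x - y|^2 <= 2 |x|^2 + 2 |y|^2 yields 4 * e/8 = e/2. The
    other half of \<open>e\<close> is left for the finitely many low modes.\<close>
  obtain m :: real where m: "\<And>s F. 0 \<le> s \<Longrightarrow> finite F \<Longrightarrow> (\<forall>n\<in>F. m \<le> \<bar>of_int n\<bar>) \<Longrightarrow>
        (\<Sum>n\<in>F. of_int n ^ 8 * (cmod (a s n))\<^sup>2) \<le> e / 8"
    using tail[of "e / 8"] e by auto
  define I where "I = {-\<lceil>m\<rceil>..\<lceil>m\<rceil>}"
  define D where "D r n = of_int n ^ 8 * (cmod (a r n - a t n))\<^sup>2" for r n
  have D0: "0 \<le> D r n" for r n by (simp add: D_def)
  have "((\<lambda>r. a r n) \<longlongrightarrow> a t n) (at t within {0..})" for n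
  proof -
    have "((\<lambda>s. a s n) has_vector_derivative - (\<i> * of_int n / 2) * convolution (a t) n - a t n / of_int \<bar>n\<bar>) (at t within {0..})"
      using sol t by (simp add: fourier_solution_def)
    then show ?thesis using has_vector_derivative_continuous continuous_within by blast
  qed
  then have "((\<lambda>r. sum (D r) I) \<longlongrightarrow> (\<Sum>n\<in>I. of_int n ^ 8 * (cmod (a t n - a t n))\<^sup>2)) (at t within {0..})"
    unfolding D_def[abs_def] by (intro tendsto_intros)
  then have "((\<lambda>r. sum (D r) I) \<longlongrightarrow> 0) (at t within {0..})" by simp
  then have "\<forall>\<^sub>F r in at t within {0..}. sum (D r) I < e / 2"
    by (rule order_tendstoD(2)) (use e in simp)
  moreover have "\<forall>\<^sub>F r in at t within {0..}. r \<in> {0..}" by (simp add: eventually_at_filter)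
  ultimately show ?thesis
  proof eventually_elim
    case (elim r)
    then have r: "0 \<le> r" by simp
    show ?case
    proof (intro allI impI)
      fix F :: "int set" assume F: "finite F"
      have "sum (D r) F = sum (D r) (F \<inter> I) + sum (D r) (F - I)" by (rule sum.Int_Diff[OF F])
      also have "sum (D r) (F \<inter> I) \<le> sum (D r) I" by (intro sum_mono2) (auto simp: I_def D0)
      also have "sum (D r) (F - I) \<le> (\<Sum>n\<in>F - I. 2 * (of_int n ^ 8 * (cmod (a r n))\<^sup>2) + 2 * (of_int n ^ 8 * (cmod (a t n))\<^sup>2))"
      proof (rule sum_mono)
        fix n
        have "(cmod (a r n - a t n))\<^sup>2 \<le> (cmod (a r n) + cmod (a t n))\<^sup>2"
          by (intro power_mono norm_triangle_ineq4) simp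
        also have "\<dots> \<le> 2 * (cmod (a r n))\<^sup>2 + 2 * (cmod (a t n))\<^sup>2"
          using zero_le_power2[of "cmod (a r n) - cmod (a t n)"] by (simp add: power2_eq_square algebra_simps)
        finally have "D r n \<le> of_int n ^ 8 * (2 * (cmod (a r n))\<^sup>2 + 2 * (cmod (a t n))\<^sup>2)"
          unfolding D_def by (rule mult_left_mono) simp
        then show "D r n \<le> 2 * (of_int n ^ 8 * (cmod (a r n))\<^sup>2) + 2 * (of_int n ^ 8 * (cmod (a t n))\<^sup>2)"
          by (simp add: algebra_simps)
      qed
      also have "\<dots> = 2 * (\<Sum>n\<in>F - I. of_int n ^ 8 * (cmod (a r n))\<^sup>2) + 2 * (\<Sum>n\<in>F - I. of_int n ^ 8 * (cmod (a t n))\<^sup>2)"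
        by (simp only: sum.distrib sum_distrib_left)
      also have "\<dots> \<le> 2 * (e / 8) + 2 * (e / 8)"
      proof (intro add_mono mult_left_mono m r t ballI)
        fix n assume "n \<in> F - I"
        then have "\<lceil>m\<rceil> < \<bar>n\<bar>" by (auto simp: I_def)
        then show "m \<le> \<bar>of_int n\<bar>" by linarith
        then show "m \<le> \<bar>of_int n\<bar>" .
      qed (use F in auto)
      finally have "sum (D r) F \<le> e" using elim by simp
      then show "(\<Sum>n\<in>F. of_int n ^ 8 * (cmod (a r n - a t n))\<^sup>2) \<le> e" by (simp only: D_def[abs_def])
    qed
  qed
qed

theorem theorem3:
  "\<exists>\<epsilon>>0. \<forall>u0. u0 \<in> H_space 4 \<and> zero_mean u0 \<and> Hdot_norm 4 u0 \<le> \<epsilon> \<longrightarrow>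
     (\<exists>u. solves_Cauchy u0 u \<and> (\<forall>T>0. continuous_into_H 4 T u) \<and>
          (\<exists>C. \<forall>t\<ge>0. L2_norm (u t) \<le> C * (1 + t) powr (-2.25)))"
proof -
  define M :: real where "M = 1 / 10 ^ 8"
  have M: "0 < M" "M \<le> 1 / 10 ^ 8" "0 \<le> M" by (simp_all add: M_def)
  have "\<exists>u. solves_Cauchy u0 u \<and> (\<forall>T>0. continuous_into_H 4 T u) \<and>
          (\<exists>C. \<forall>t\<ge>0. L2_norm (u t) \<le> C * (1 + t) powr (-2.25))"
    if u0: "u0 \<in> H_space 4" "zero_mean u0" "Hdot_norm 4 u0 \<le> M / 2" for u0
  proof -
    define a0 where "a0 = fourier_coeff u0"
    have u0_L2: "u0 \<in> L2_torus" and W: "is_Lambda_pow 4 u0 (Lambda_pow 4 u0)"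
      using u0(1) is_Lambda_pow_Lambda_pow by (auto simp: H_space_def)
    have init: "(\<Sum>n\<in>F. of_int n ^ 8 * (cmod (a0 n))\<^sup>2) \<le> M\<^sup>2 / 4" if F: "finite F" for F
    proof -
      define X where "X = (\<Sum>n\<in>F. of_int n ^ 8 * (cmod (a0 n))\<^sup>2)"
      have "X = (\<Sum>n\<in>F. (cmod (fourier_coeff (Lambda_pow 4 u0) n))\<^sup>2)"
        using W unfolding X_def is_Lambda_pow_def
        by (intro sum.cong) (auto simp: abs_powr_4 norm_mult norm_power power_mult_distrib a0_def simp flip: power_mult)
      moreover have "0 \<le> X" unfolding X_def by (intro sum_nonneg) auto
      \<comment> \<open>Bessel's inequality carries a factor 2 pi in this normalization; it is at
        least 1 and is given away.\<close>
      ultimately have "X \<le> 2 * pi * (\<Sum>n\<in>F. (cmod (fourier_coeff (Lambda_pow 4 u0) n))\<^sup>2)"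
        using pi_gt3 mult_right_mono[of 1 "2 * pi" X] by simp
      also have "\<dots> \<le> (LINT x|torus. (Lambda_pow 4 u0 x)\<^sup>2)"
        using W by (intro bessel_inequality F) (simp add: is_Lambda_pow_def)
      also have "\<dots> = (Hdot_norm 4 u0)\<^sup>2" by (simp add: Hdot_norm_def L2_norm_torus integral_nonneg_AE)
      also have "\<dots> \<le> (M / 2)\<^sup>2"
        using u0(3) by (intro power_mono) (simp_all add: Hdot_norm_def L2_norm_torus integral_nonneg_AE)
      finally show ?thesis by (simp add: X_def power_divide)
    qed
    have herm: "hermitian a0" unfolding a0_def by (rule fourier_coeff_hermitian)
    have zero: "a0 0 = 0"
      using u0(2) by (simp add: a0_def fourier_coeff_torus zero_mean_def set_integral_torus)
    show ?thesis
    proof (rule fourier_solution_exists[OF herm zero M(1,2) init])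
      fix a assume sol: "fourier_solution a0 a"
        and b: "\<And>t n. 0 \<le> t \<Longrightarrow> cmod (a t n) \<le> M / \<bar>of_int n\<bar> ^ 4"
        and decay: "\<And>t F. 0 \<le> t \<Longrightarrow> finite F \<Longrightarrow> (\<Sum>n\<in>F. (cmod (a t n))\<^sup>2) \<le> 19684 * M\<^sup>2 / (1 + t) ^ 6"
        and H4: "\<And>t F. 0 \<le> t \<Longrightarrow> finite F \<Longrightarrow> (\<Sum>n\<in>F. of_int n ^ 8 * (cmod (a t n))\<^sup>2) \<le> M\<^sup>2"
        and tail: "\<And>e. 0 < e \<Longrightarrow> \<exists>m::real. \<forall>t\<ge>0. \<forall>F. finite F \<longrightarrow> (\<forall>n\<in>F. m \<le> \<bar>of_int n\<bar>) \<longrightarrow>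
          (\<Sum>n\<in>F. of_int n ^ 8 * (cmod (a t n))\<^sup>2) \<le> e"
      define u where "u t x = Re (fourier_series (a t) x)" for t x
      have a: "a t abs_summable_on UNIV" "(\<lambda>n. of_int n * a t n) abs_summable_on UNIV" "hermitian (a t)" "a t 0 = 0"
        if "0 \<le> t" for t
        using abs_summable_coefficients[OF M(3) b[OF that]] sol that by (auto simp: fourier_solution_def)
      have u_L2: "u t \<in> L2_torus" if "0 \<le> t" for t
        unfolding u_def[abs_def] by (rule L2_torus_fourier_series[OF a(1,2)[OF that]])
      have u_coeff: "fourier_coeff (u t) n = a t n" if "0 \<le> t" for t n
        unfolding u_def[abs_def] by (rule fourier_coeff_fourier_series[OF a(1,3)[OF that]])
      have "solves_Cauchy u0 u"
        unfolding solves_Cauchy_def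
      proof (intro conjI allI impI)
        show "\<exists>u_t u_\<alpha>. ((\<lambda>r. u r \<alpha>) has_real_derivative u_t) (at t within {0..}) \<and>
          (u t has_real_derivative u_\<alpha>) (at \<alpha>) \<and> u_t + u t \<alpha> * u_\<alpha> = - Lambda_inv (u t) \<alpha>" if "0 \<le> t" for t \<alpha>
          unfolding u_def[abs_def] by (rule fourier_solution_solves_pde[OF sol M(3) b that])
        have "a 0 = a0" using sol by (simp add: fourier_solution_def)
        then show "AE \<alpha> in lebesgue. u 0 \<alpha> = u0 \<alpha>"
          using u_L2[of 0] u_coeff[of 0] by (intro fourier_coeff_unique u0_L2) (simp_all add: a0_def)
      qed
      moreover have "continuous_into_H 4 T u" if "0 < T" for T
        unfolding continuous_into_H_def
      proof (intro conjI ballI)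
        show "u t \<in> H_space 4" if "t \<in> {0..T}" for t
          using that H4[of t] u_coeff[of t] by (intro H4_space_membership(1)[OF u_L2, of _ "M\<^sup>2"]) simp_all
        fix t assume "t \<in> {0..T}"
        then have t: "0 \<le> t" by simp
        have "((\<lambda>r. H_norm 4 (\<lambda>\<alpha>. u r \<alpha> - u t \<alpha>)) \<longlongrightarrow> 0) (at t within {0..})"
        proof (rule tendstoI)
          fix e :: real assume e: "0 < e"
          \<comment> \<open>Solves sqrt (4 pi B) = e/2, the bound of
            \<open>H4_norm_le\<close>.\<close>
          define B where "B = (e / 2)\<^sup>2 / (4 * pi)"
          have B: "0 < B" using e by (simp add: B_def)
          have "\<forall>\<^sub>F r in at t within {0..}. \<forall>F. finite F \<longrightarrow>
              (\<Sum>n\<in>F. of_int n ^ 8 * (cmod (a r n - a t n))\<^sup>2) \<le> B"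
            by (rule H4_coefficient_continuity[OF sol t B]) (rule tail)
          moreover have "\<forall>\<^sub>F r in at t within {0..}. r \<in> {0..}" by (simp add: eventually_at_filter)
          ultimately show "\<forall>\<^sub>F r in at t within {0..}. dist (H_norm 4 (\<lambda>\<alpha>. u r \<alpha> - u t \<alpha>)) 0 < e"
          proof eventually_elim
            case (elim r)
            then have r: "0 \<le> r" by simp
            define v where "v \<alpha> = u r \<alpha> - u t \<alpha>" for \<alpha>
            have v: "v \<in> L2_torus" unfolding v_def[abs_def] by (rule L2_torus_diff[OF u_L2[OF r] u_L2[OF t]])
            have vc: "fourier_coeff v n = a r n - a t n" for n
              unfolding v_def[abs_def] using fourier_coeff_diff[OF L2_torusD(3)[OF u_L2[OF r]] L2_torusD(3)[OF u_L2[OF t]]]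
              by (simp add: u_coeff r t)
            have "H_norm 4 v \<le> sqrt (4 * pi * B)"
              using elim(1) by (intro H4_norm_le[OF v]) (simp_all add: vc a(4) r t)
            also have "\<dots> = e / 2" using e by (simp add: B_def real_sqrt_divide)
            also have "\<dots> < e" using e by simp
            finally have "H_norm 4 v < e" .
            moreover have "0 \<le> H_norm 4 v" by (simp add: H_norm_def)
            ultimately show ?case by (simp add: v_def[abs_def])
          qed
        qed
        then show "((\<lambda>r. H_norm 4 (\<lambda>\<alpha>. u r \<alpha> - u t \<alpha>)) \<longlongrightarrow> 0) (at t within {0..T})"
          by (rule tendsto_within_subset) auto
      qed
      moreover have "L2_norm (u t) \<le> sqrt (2 * pi * 19684 * M\<^sup>2) * (1 + t) powr (- 2.25)" if t: "0 \<le> t" for t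
      proof -
        have "(LINT x|torus. (u t x)\<^sup>2) \<le> 2 * pi * (19684 * M\<^sup>2 / (1 + t) ^ 6)"
          by (rule L2_bound_of_coefficients[OF u_L2[OF t]]) (simp add: u_coeff[OF t] decay[OF t])
        then have "L2_norm (u t) \<le> sqrt (2 * pi * 19684 * M\<^sup>2 / (1 + t) ^ 6)"
          unfolding L2_norm_torus by (intro real_sqrt_le_mono) (simp add: mult_ac)
        also have "(1 + t) ^ 6 = ((1 + t) ^ 3)\<^sup>2" by (simp flip: power_mult)
        also have "sqrt (2 * pi * 19684 * M\<^sup>2 / ((1 + t) ^ 3)\<^sup>2) = sqrt (2 * pi * 19684 * M\<^sup>2) * (1 / (1 + t) ^ 3)"
        proof -
          have "sqrt (((1 + t) ^ 3)\<^sup>2) = (1 + t) ^ 3" by (rule real_sqrt_unique) (use t in auto)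
          then show ?thesis unfolding real_sqrt_divide by simp
        qed
        also have "1 / (1 + t) ^ 3 = (1 + t) powr (- 3)"
          using t by (simp add: powr_minus powr_numeral divide_inverse)
        \<comment> \<open>The rate obtained is 3, and 1 + t >= 1.\<close>
        also have "\<dots> \<le> (1 + t) powr (- 2.25)" using t by (intro powr_mono) auto
        finally show ?thesis by (simp add: mult_left_mono)
      qed
      ultimately show ?thesis by blast
    qed
  qed
  then show ?thesis using M(1) by (intro exI[of _ "M / 2"]) auto
qed

end
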